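(* Let $\mathcal{A}$ be a von Neumann algebra with no central summand of type $I_1$, and let $n\ge 2$ be an integer. Then every Lie $n$-derivation on $\mathcal{A}$ is standard.
   Context: Linear means $\mathbb{C}$-linear (no continuity is assumed); $\mathcal{Z}(\mathcal{A})$ is the centre of $\mathcal{A}$. $[x,y]=xy-yx$. Define $p_1(x_1)=x_1$ and $p_n(x_1,\dots,x_n)=[p_{n-1}(x_1,\dots,x_{n-1}),x_n]$ for $n\ge2$; for $n\ge 2$, $p_n(x_1,\dots,x_n)$ is called an $(n-1)$-th commutator. A linear map $\varphi:\mathcal{A}\to\mathcal{A}$ is a Lie $n$-derivation if $\varphi(p_n(x_1,\dots,x_n))=\sum_{i=1}^n p_n(x_1,\dots,x_{i-1},\varphi(x_i),x_{i+1},\dots,x_n)$ for all $x_1,\dots,x_n\in\mathcal{A}$. A Lie $n$-derivation is standard if it equals $h+\tau$ with $h$ a derivation on $\mathcal{A}$ (linear, $h(xy)=h(x)y+xh(y)$) and $\tau$ a linear mapping from $\mathcal{A}$ into $\mathcal{Z}(\mathcal{A})$ vanishing on all $(n-1)$-th commutators of $\mathcal{A}$. *)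

theory Defs
  imports "HOL-Analysis.Analysis"
begin

section \<open>Complex Hilbert spaces\<close>

class complex_vector = ab_group_add +
  fixes scaleC :: "complex \<Rightarrow> 'a \<Rightarrow> 'a" (infixr \<open>*\<^sub>C\<close> 75)
  assumes scaleC_add_right: "a *\<^sub>C (x + y) = a *\<^sub>C x + a *\<^sub>C y"
    and scaleC_add_left: "(a + b) *\<^sub>C x = a *\<^sub>C x + b *\<^sub>C x"
    and scaleC_scaleC: "a *\<^sub>C b *\<^sub>C x = (a * b) *\<^sub>C x"
    and scaleC_one: "1 *\<^sub>C x = x"

text \<open>
  The underlying real inner product is the real part of the complex one, so that
  \<open>norm x = sqrt (Re (cinner x x))\<close>, and definiteness of \<open>cinner\<close> is inherited from
  \<^class>\<open>real_inner\<close>.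
\<close>

class complex_inner = complex_vector + real_inner +
  fixes cinner :: "'a \<Rightarrow> 'a \<Rightarrow> complex"
  assumes scaleR_scaleC: "r *\<^sub>R x = complex_of_real r *\<^sub>C x"
    and cinner_commute: "cinner x y = cnj (cinner y x)"
    and cinner_add_left: "cinner (x + y) z = cinner x z + cinner y z"
    and cinner_scaleC_left: "cinner (a *\<^sub>C x) y = a * cinner x y"
    and inner_eq_Re_cinner: "inner x y = Re (cinner x y)"
begin

lemma cinner_add_right: "cinner x (y + z) = cinner x y + cinner x z"
  by (metis cinner_add_left cinner_commute complex_cnj_add)

lemma cinner_scaleC_right: "cinner x (a *\<^sub>C y) = cnj a * cinner x y"
  by (metis cinner_scaleC_left cinner_commute complex_cnj_mult)

lemma cinner_self: "cinner x x = complex_of_real (inner x x)"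
  by (metis cinner_commute complex_is_Real_iff Reals_cnj_iff inner_eq_Re_cinner of_real_Re)

lemma norm_scaleC: "norm (a *\<^sub>C x) = cmod a * norm x"
proof -
  have "cinner (a *\<^sub>C x) (a *\<^sub>C x) = complex_of_real ((cmod a)\<^sup>2) * cinner x x"
    unfolding cinner_scaleC_left cinner_scaleC_right
    by (simp only: complex_norm_square mult.assoc mult.commute mult.left_commute)
  then have "inner (a *\<^sub>C x) (a *\<^sub>C x) = (cmod a)\<^sup>2 * inner x x"
    by (metis cinner_self of_real_eq_iff of_real_mult)
  then show ?thesis
    by (simp add: norm_eq_sqrt_inner real_sqrt_mult)
qed

end

class chilbert_space = complex_inner + complete_space
begin

subclass banach ..

end


section \<open>The algebra of bounded complex-linear operators on a Hilbert space\<close>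

typedef (overloaded) 'h bounded_op =
  "{f :: 'h::chilbert_space \<Rightarrow> 'h. bounded_linear f \<and> (\<forall>c x. f (c *\<^sub>C x) = c *\<^sub>C f x)}"
  morphisms op_apply Bounded_Op
proof
  show "(\<lambda>x. x) \<in> {f :: 'h \<Rightarrow> 'h. bounded_linear f \<and> (\<forall>c x. f (c *\<^sub>C x) = c *\<^sub>C f x)}"
    by simp
qed

setup_lifting type_definition_bounded_op

lemma scaleC_zero_right [simp]: "c *\<^sub>C (0 :: 'a::complex_vector) = 0"
  using scaleC_add_right[of c 0 "0::'a"] by simp

lemma scaleC_minus_right: "c *\<^sub>C (- x :: 'a::complex_vector) = - (c *\<^sub>C x)"
  using scaleC_add_right[of c x "- x"] by (simp add: eq_neg_iff_add_eq_0 add.commute)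

lemma scaleC_diff_right: "c *\<^sub>C (x - y :: 'a::complex_vector) = c *\<^sub>C x - c *\<^sub>C y"
  using scaleC_add_right[of c x "- y"] by (simp add: scaleC_minus_right)

lemma bounded_linear_scaleC: "bounded_linear (\<lambda>x :: 'h::complex_inner. c *\<^sub>C x)"
proof (rule bounded_linear_intro[where K = "cmod c"])
  fix r :: real and x :: 'h
  show "c *\<^sub>C r *\<^sub>R x = r *\<^sub>R c *\<^sub>C x"
    by (simp add: scaleR_scaleC scaleC_scaleC mult.commute)
qed (simp_all add: scaleC_add_right norm_scaleC mult.commute)

text \<open>
  The product is composition. The class \<open>ring_1\<close> is not available because \<open>1 = 0\<close> on the
  zero space.
\<close>

instantiation bounded_op :: (chilbert_space) "{ring, monoid_mult}"
begin

lift_definition zero_bounded_op :: "'a bounded_op" is "\<lambda>x. 0" by simp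
lift_definition one_bounded_op :: "'a bounded_op" is "\<lambda>x. x" by simp
lift_definition plus_bounded_op :: "'a bounded_op \<Rightarrow> 'a bounded_op \<Rightarrow> 'a bounded_op"
  is "\<lambda>f g x. f x + g x" by (auto intro: bounded_linear_add simp: scaleC_add_right)
lift_definition uminus_bounded_op :: "'a bounded_op \<Rightarrow> 'a bounded_op"
  is "\<lambda>f x. - f x" by (auto intro: bounded_linear_minus simp: scaleC_minus_right)
lift_definition minus_bounded_op :: "'a bounded_op \<Rightarrow> 'a bounded_op \<Rightarrow> 'a bounded_op"
  is "\<lambda>f g x. f x - g x" by (auto intro: bounded_linear_sub simp: scaleC_diff_right)
lift_definition times_bounded_op :: "'a bounded_op \<Rightarrow> 'a bounded_op \<Rightarrow> 'a bounded_op"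
  is "\<lambda>f g x. f (g x)" by (auto intro: bounded_linear_compose)

instance
  by standard (transfer; auto simp: algebra_simps linear_simps)+

end

instantiation bounded_op :: (chilbert_space) complex_vector
begin

lift_definition scaleC_bounded_op :: "complex \<Rightarrow> 'a bounded_op \<Rightarrow> 'a bounded_op"
  is "\<lambda>c f x. c *\<^sub>C f x"
  by (auto intro: bounded_linear_compose[OF bounded_linear_scaleC]
      simp: scaleC_scaleC mult.commute)

instance
  by standard
    (transfer; simp add: scaleC_add_right scaleC_add_left scaleC_scaleC scaleC_one)+

end


section \<open>Von Neumann algebras\<close>

definition is_adjoint :: "'h::chilbert_space bounded_op \<Rightarrow> 'h bounded_op \<Rightarrow> bool"
  where "is_adjoint S T \<longleftrightarrow> (\<forall>x y. cinner (op_apply T x) y = cinner x (op_apply S y))"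

definition star_subalgebra :: "'h::chilbert_space bounded_op set \<Rightarrow> bool"
  where "star_subalgebra M \<longleftrightarrow>
    0 \<in> M \<and>
    (\<forall>S\<in>M. \<forall>T\<in>M. S + T \<in> M) \<and>
    (\<forall>c. \<forall>T\<in>M. c *\<^sub>C T \<in> M) \<and>
    (\<forall>S\<in>M. \<forall>T\<in>M. S * T \<in> M) \<and>
    (\<forall>T\<in>M. \<exists>S\<in>M. is_adjoint S T)"

definition commutant :: "'h::chilbert_space bounded_op set \<Rightarrow> 'h bounded_op set"
  where "commutant M = {T. \<forall>S\<in>M. T * S = S * T}"

text \<open>In particular \<open>1 \<in> M\<close>, since every commutant contains the identity.\<close>

definition von_neumann_algebra :: "'h::chilbert_space bounded_op set \<Rightarrow> bool"
  where "von_neumann_algebra M \<longleftrightarrow> star_subalgebra M \<and> commutant (commutant M) = M"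

definition center :: "'h::chilbert_space bounded_op set \<Rightarrow> 'h bounded_op set"
  where "center M = {z \<in> M. \<forall>x\<in>M. z * x = x * z}"

definition projection :: "'h::chilbert_space bounded_op \<Rightarrow> bool"
  where "projection p \<longleftrightarrow> p * p = p \<and> is_adjoint p p"

definition abelian_projection ::
    "'h::chilbert_space bounded_op set \<Rightarrow> 'h bounded_op \<Rightarrow> bool"
  where "abelian_projection M e \<longleftrightarrow>
    projection e \<and> e \<in> M \<and>
    (\<forall>x\<in>M. \<forall>y\<in>M. (e * x * e) * (e * y * e) = (e * y * e) * (e * x * e))"

text \<open>
  A von Neumann algebra is of type \<open>I\<^sub>n\<close> if its unit is the sum of \<open>n\<close> equivalent orthogonal
  abelian projections; so it is of type \<open>I\<^sub>1\<close> if its unit is itself an abelian projection.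
  The central summands of \<open>M\<close> are the algebras \<open>z M\<close>, with unit \<open>z\<close>, for \<open>z\<close> a central
  projection, and \<open>z\<close> is abelian in \<open>z M\<close> iff it is abelian in \<open>M\<close>.  The zero algebra is not
  counted as a summand.
\<close>

definition has_type_I1_central_summand :: "'h::chilbert_space bounded_op set \<Rightarrow> bool"
  where "has_type_I1_central_summand M \<longleftrightarrow>
    (\<exists>z \<in> center M. z \<noteq> 0 \<and> abelian_projection M z)"


section \<open>Lie \<open>n\<close>-derivations\<close>

definition lie_bracket :: "'a::ring \<Rightarrow> 'a \<Rightarrow> 'a"
  where "lie_bracket x y = x * y - y * x"

text \<open>
  \<open>lie_poly n x\<close> is \<open>p\<^sub>n(x\<^sub>1, \<dots>, x\<^sub>n)\<close>; it reads only \<open>x 1, \<dots>, x n\<close>.  The value at \<open>n = 0\<close> is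
  a dummy.
\<close>

fun lie_poly :: "nat \<Rightarrow> (nat \<Rightarrow> 'a::ring) \<Rightarrow> 'a"
  where
    "lie_poly 0 x = 0"
  | "lie_poly (Suc 0) x = x 1"
  | "lie_poly (Suc (Suc n)) x = lie_bracket (lie_poly (Suc n) x) (x (Suc (Suc n)))"

text \<open>
  Maps on an algebra \<open>A\<close> are total functions whose values outside \<open>A\<close> are irrelevant.
\<close>

definition clinear_map_on ::
    "'a::complex_vector set \<Rightarrow> 'b::complex_vector set \<Rightarrow> ('a \<Rightarrow> 'b) \<Rightarrow> bool"
  where "clinear_map_on A B f \<longleftrightarrow>
    f \<in> A \<rightarrow> B \<and>
    (\<forall>x\<in>A. \<forall>y\<in>A. f (x + y) = f x + f y) \<and>
    (\<forall>c. \<forall>x\<in>A. f (c *\<^sub>C x) = c *\<^sub>C f x)"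

definition derivation_on ::
    "'h::chilbert_space bounded_op set \<Rightarrow> ('h bounded_op \<Rightarrow> 'h bounded_op) \<Rightarrow> bool"
  where "derivation_on A h \<longleftrightarrow>
    clinear_map_on A A h \<and> (\<forall>x\<in>A. \<forall>y\<in>A. h (x * y) = h x * y + x * h y)"

definition lie_n_derivation_on ::
    "nat \<Rightarrow> 'h::chilbert_space bounded_op set \<Rightarrow> ('h bounded_op \<Rightarrow> 'h bounded_op) \<Rightarrow> bool"
  where "lie_n_derivation_on n A \<phi> \<longleftrightarrow>
    clinear_map_on A A \<phi> \<and>
    (\<forall>x. (\<forall>i\<in>{1..n}. x i \<in> A) \<longrightarrow>
      \<phi> (lie_poly n x) = (\<Sum>i=1..n. lie_poly n (x(i := \<phi> (x i)))))"

definition standard_on ::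
    "nat \<Rightarrow> 'h::chilbert_space bounded_op set \<Rightarrow> ('h bounded_op \<Rightarrow> 'h bounded_op) \<Rightarrow> bool"
  where "standard_on n A \<phi> \<longleftrightarrow>
    (\<exists>h \<tau>. derivation_on A h \<and>
      clinear_map_on A (center A) \<tau> \<and>
      (\<forall>x. (\<forall>i\<in>{1..n}. x i \<in> A) \<longrightarrow> \<tau> (lie_poly n x) = 0) \<and>
      (\<forall>x\<in>A. \<phi> x = h x + \<tau> x))"

end

theory Submission
  imports Defs
begin

text \<open>Let \<open>p\<close> be a projection of the algebra \<open>A\<close>, put \<open>f = 1 - p\<close>, and regard the elements of \<open>A\<close>
as two by two matrices over the corners \<open>pAp\<close>, \<open>pAf\<close>, \<open>fAp\<close>, \<open>fAf\<close>. Suppose that neither \<open>p\<close>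
nor \<open>f\<close> is annihilated by a nonzero element through \<open>A\<close>: if \<open>pAx = 0\<close> or \<open>fAx = 0\<close>, then
\<open>x = 0\<close>.

\<^bold>\<open>Algebra.\<close> Because \<open>[x, p]\<close> only sees the off-diagonal part of \<open>x\<close>, on which bracketing with
\<open>p\<close> is \<open>\<plusminus>1\<close>, filling the last slots of an iterated bracket with \<open>p\<close> turns the Lie
\<open>n\<close>-derivation identity into an identity for the off-diagonal parts of single and double
brackets. For this \<open>\<phi> p\<close> must be central, which holds after an inner derivation has been
subtracted, and the length must be even and at least \<open>4\<close>, which costs nothing because an
identity of length \<open>k\<close> (in the slots after the first) can be composed with itself. Then \<open>\<phi>\<close>
preserves the diagonal and maps each off-diagonal corner to itself (\<open>cross_zero\<close>). For \<open>a\<close>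
in \<open>pAp\<close> the component of \<open>\<phi> a\<close> in \<open>fAf\<close> lies in the centre of \<open>fAf\<close>, hence is cut out by a
central element of \<open>A\<close>; likewise with \<open>p\<close> and \<open>f\<close> exchanged. Removing these central elements
from \<open>\<phi>\<close> leaves a map \<open>h\<close> that preserves all four corners, and such a map is a derivation
(\<open>graded_lie.leibniz\<close>): a product of a diagonal and an off-diagonal corner element is up to
sign a bracket, so the product rule for it is part of the bracket identities; faithfulness
of the off-diagonal corners extends it to \<open>pAp\<close> and \<open>fAf\<close>; and for products of the two
opposite off-diagonal corners the failure of the product rule is multiplication by a central
element of square zero.

\<^bold>\<open>Analysis.\<close> A von Neumann algebra contains the projections onto kernels of its elements, so
right annihilators are generated by projections, and annihilators of two-sided ideals by
central ones (\<open>ideal_annihilator\<close>). Absolute values of self-adjoint elements produce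
spectral projections, and iterating gives a binary expansion of each self-adjoint
contraction whose digits are symmetries \<open>2 e - 1\<close> (\<open>binary_expansion\<close>). It follows that an
algebra all of whose projections are central is commutative, and that central elements of a
corner \<open>pAp\<close> are of the form \<open>z p\<close> with \<open>z\<close> central (\<open>corner_center_lift\<close>), since this is
true of central projections. If no central summand is abelian, each of them contains a
noncentral projection; a maximal family of such projections living on orthogonal central
summands adds up to the required \<open>p\<close> (\<open>balanced_projection_exists\<close>).

The central map \<open>\<tau> = \<phi> - h\<close> vanishes on iterated brackets because brackets do not see
central summands of their arguments, so that the formulas for \<open>\<phi>\<close> and for \<open>h\<close> agree there.\<close>

section \<open>Iterated brackets and their derivatives\<close>

notation lie_bracket (\<open>\<lbrace>_, _\<rbrace>\<close>)

text \<open>The derivative along \<open>\<phi>\<close> of the iterated bracket \<open>foldl lie_bracket x ys\<close>, where \<open>x'\<close> is the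
value assigned to the derivative of \<open>x\<close>. Keeping \<open>x'\<close> as an argument makes the sum over all
slots a recursion over the list, which composes along concatenation.\<close>
fun fold_deriv :: "('a::ring \<Rightarrow> 'a) \<Rightarrow> 'a \<Rightarrow> 'a \<Rightarrow> 'a list \<Rightarrow> 'a"
  where
    "fold_deriv \<phi> x x' [] = x'"
  | "fold_deriv \<phi> x x' (y # ys) = fold_deriv \<phi> \<lbrace>x, y\<rbrace> (\<lbrace>x', y\<rbrace> + \<lbrace>x, \<phi> y\<rbrace>) ys"

lemma fold_deriv_append:
  "fold_deriv \<phi> x x' (ys @ zs) = fold_deriv \<phi> (foldl lie_bracket x ys) (fold_deriv \<phi> x x' ys) zs"
  by (induction ys arbitrary: x x') auto

lemma lie_bracket_zero [simp]: "\<lbrace>0, x\<rbrace> = 0" "\<lbrace>x, 0\<rbrace> = 0"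
  by (simp_all add: lie_bracket_def)

lemma foldl_lie_bracket_zero [simp]: "foldl lie_bracket 0 ys = 0"
  by (induction ys) auto

lemma fold_deriv_zero: "fold_deriv \<phi> 0 x' ys = foldl lie_bracket x' ys"
  by (induction ys arbitrary: x') auto

lemma fold_deriv_diff:
  "fold_deriv (\<lambda>x. \<phi> x - d x) x (x' - x'') ys = fold_deriv \<phi> x x' ys - fold_deriv d x x'' ys"
proof (induction ys arbitrary: x x' x'')
  case (Cons y ys)
  have "\<lbrace>x' - x'', y\<rbrace> + \<lbrace>x, \<phi> y - d y\<rbrace> = (\<lbrace>x', y\<rbrace> + \<lbrace>x, \<phi> y\<rbrace>) - (\<lbrace>x'', y\<rbrace> + \<lbrace>x, d y\<rbrace>)"
    by (simp add: lie_bracket_def algebra_simps)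
  then show ?case using Cons by simp
qed simp

section \<open>Semiprime algebras\<close>

locale semiprime_algebra =
  fixes A :: "'a::{ring,monoid_mult,complex_vector} set"
  assumes zero_closed [simp, intro]: "0 \<in> A"
    and one_closed [simp, intro]: "1 \<in> A"
    and add_closed [simp, intro]: "x \<in> A \<Longrightarrow> y \<in> A \<Longrightarrow> x + y \<in> A"
    and diff_closed [simp, intro]: "x \<in> A \<Longrightarrow> y \<in> A \<Longrightarrow> x - y \<in> A"
    and mult_closed [simp, intro]: "x \<in> A \<Longrightarrow> y \<in> A \<Longrightarrow> x * y \<in> A"
    and scale_closed [simp, intro]: "x \<in> A \<Longrightarrow> c *\<^sub>C x \<in> A"
    and scale_left: "(c *\<^sub>C (x::'a)) * y = c *\<^sub>C (x * y)"
    and scale_right: "(x::'a) * (c *\<^sub>C y) = c *\<^sub>C (x * y)"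
    and semiprime: "x \<in> A \<Longrightarrow> (\<And>y. y \<in> A \<Longrightarrow> x * y * x = 0) \<Longrightarrow> x = 0"
begin

definition Z :: "'a set" where "Z = {z \<in> A. \<forall>x\<in>A. z * x = x * z}"

lemma Z_closed [simp]: "z \<in> Z \<Longrightarrow> z \<in> A"
  and Z_commute: "z \<in> Z \<Longrightarrow> x \<in> A \<Longrightarrow> z * x = x * z"
  by (auto simp: Z_def)

lemma uminus_closed [simp, intro]: "x \<in> A \<Longrightarrow> - x \<in> A"
  using diff_closed[of 0 x] by simp

lemma lie_closed [simp, intro]: "x \<in> A \<Longrightarrow> y \<in> A \<Longrightarrow> \<lbrace>x, y\<rbrace> \<in> A"
  by (simp add: lie_bracket_def)

lemma foldl_closed: "x \<in> A \<Longrightarrow> set ys \<subseteq> A \<Longrightarrow> foldl lie_bracket x ys \<in> A"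
  by (induction ys arbitrary: x) auto

lemma lie_Z: "z \<in> Z \<Longrightarrow> x \<in> A \<Longrightarrow> \<lbrace>z, x\<rbrace> = 0" "z \<in> Z \<Longrightarrow> x \<in> A \<Longrightarrow> \<lbrace>x, z\<rbrace> = 0"
  by (simp_all add: lie_bracket_def Z_commute)

lemma ZI: "z \<in> A \<Longrightarrow> (\<And>x. x \<in> A \<Longrightarrow> \<lbrace>z, x\<rbrace> = 0) \<Longrightarrow> z \<in> Z"
proof -
  assume z: "z \<in> A" and c: "\<And>x. x \<in> A \<Longrightarrow> \<lbrace>z, x\<rbrace> = 0"
  have "z * x = x * z" if "x \<in> A" for x
    using c[OF that] unfolding lie_bracket_def by (rule eq_iff_diff_eq_0[THEN iffD2])
  with z show "z \<in> Z" unfolding Z_def by blast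
qed

lemma Z_ops: "z \<in> Z \<Longrightarrow> w \<in> Z \<Longrightarrow> z + w \<in> Z" "z \<in> Z \<Longrightarrow> w \<in> Z \<Longrightarrow> z - w \<in> Z"
  "z \<in> Z \<Longrightarrow> c *\<^sub>C z \<in> Z" "0 \<in> Z"
  unfolding Z_def by (simp_all add: distrib_left distrib_right left_diff_distrib right_diff_distrib
    scale_left scale_right)

lemma double_zero: "(x::'a) + x = 0 \<Longrightarrow> x = 0"
proof -
  assume "x + x = 0"
  then have "(1/2) *\<^sub>C x + (1/2) *\<^sub>C x = 0"
    using scaleC_add_right[of "1/2" x x] by simp
  then show ?thesis
    by (simp add: scaleC_add_left[symmetric] scaleC_one)
qed

lemma scale_nat: "(\<Sum>i<n. x) = of_nat n *\<^sub>C (x::'a)"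
proof (induction n)
  case 0 show ?case using scaleC_add_left[of 0 0 x] by simp
next
  case (Suc n) then show ?case by (simp add: scaleC_add_left scaleC_one algebra_simps)
qed

lemma scale_cancel: "c *\<^sub>C (x::'a) = 0 \<Longrightarrow> c \<noteq> 0 \<Longrightarrow> x = 0"
  by (metis scaleC_scaleC scaleC_one scaleC_zero_right left_inverse)

text \<open>In a semiprime algebra \<open>eAe\<close> the second centre is the centre. If \<open>c = [x, u]\<close> is central,
then so is \<open>[x, x u] = x c\<close>, whence \<open>0 = [x c, u] = c\<^sup>2\<close>; a central element of square zero
vanishes.\<close>
lemma commute_if_brackets_commute:
  assumes e: "e \<in> A" "e * x = x" "x * e = x" "e * e = e" and x: "x \<in> A"
    and c: "\<And>y w. y \<in> A \<Longrightarrow> w \<in> A \<Longrightarrow> \<lbrace>\<lbrace>x, e * y * e\<rbrace>, e * w * e\<rbrace> = 0"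
    and y: "y \<in> A"
  shows "\<lbrace>x, e * y * e\<rbrace> = 0"
proof (rule semiprime)
  define u where "u = e * y * e"
  define c where "c = \<lbrace>x, u\<rbrace>"
  have eu: "e * u = u" "u * e = u" using e(4) by (simp_all add: u_def flip: mult.assoc) (simp add: mult.assoc e(4))
  have ec: "e * c = c" "c * e = c" using eu e by (simp_all add: c_def lie_bracket_def algebra_simps)
     (simp_all add: e(2) eu flip: mult.assoc)
  have cc: "\<lbrace>c, e * w * e\<rbrace> = 0" if "w \<in> A" for w
    using assms(6)[OF y that] by (simp add: c_def u_def)
  have cu: "c * u = u * c" using cc[OF y] by (simp add: u_def lie_bracket_def)
  have cx: "c * x = x * c" using cc[OF x] e by (simp add: lie_bracket_def)
  have ux: "e * (x * u) * e = x * u" using e eu by (simp add: mult.assoc) (simp add: eu e flip: mult.assoc)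
  have "\<lbrace>x, x * u\<rbrace> = x * c"
    by (simp add: c_def lie_bracket_def algebra_simps)
  moreover have "u \<in> A" using y e by (simp add: u_def)
  then have "\<lbrace>\<lbrace>x, x * u\<rbrace>, u\<rbrace> = 0"
    using assms(6)[of "x * u" y] x y by (simp add: ux flip: u_def)
  ultimately have "\<lbrace>x * c, u\<rbrace> = 0" by simp
  moreover have "\<lbrace>x * c, u\<rbrace> = c * c"
  proof -
    have "\<lbrace>x * c, u\<rbrace> = x * (c * u) - u * x * c" by (simp add: lie_bracket_def mult.assoc)
    also have "\<dots> = (x * u - u * x) * c" by (simp add: cu algebra_simps)
    finally show ?thesis by (simp add: c_def lie_bracket_def)
  qed
  ultimately have c2: "c * c = 0" by simp
  fix w assume w: "w \<in> A"
  have "c * w * c = c * (e * w * e) * c" using ec by (simp add: mult.assoc) (simp add: ec flip: mult.assoc)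
  also have "\<dots> = (e * w * e) * (c * c)" using cc[OF w] by (simp add: lie_bracket_def mult.assoc)
  finally show "\<lbrace>x, e * y * e\<rbrace> * w * \<lbrace>x, e * y * e\<rbrace> = 0" unfolding c2 by (simp add: c_def u_def)
qed (use e x y in auto)

text \<open>The upper central series of a semiprime algebra stops at the centre, by repeated use of the
previous lemma with \<open>e = 1\<close>.\<close>
lemma central_if_iterated_brackets_vanish:
  assumes "x \<in> A" and "\<And>ys. set ys \<subseteq> A \<Longrightarrow> length ys = Suc j \<Longrightarrow> foldl lie_bracket x ys = 0"
  shows "x \<in> Z"
  using assms
proof (induction j arbitrary: x)
  case 0
  show ?case by (rule ZI) (use 0 0(2)[of "[_]"] in auto)
next
  case (Suc j)
  have "\<lbrace>x, y\<rbrace> \<in> Z" if "y \<in> A" for y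
  proof (rule Suc.IH)
    show "foldl lie_bracket \<lbrace>x, y\<rbrace> ys = 0" if "set ys \<subseteq> A" "length ys = Suc j" for ys
      using Suc.prems(2)[of "y # ys"] that \<open>y \<in> A\<close> by simp
  qed (use Suc.prems that in auto)
  then have "\<lbrace>\<lbrace>x, 1 * y * 1\<rbrace>, 1 * w * 1\<rbrace> = 0" if "y \<in> A" "w \<in> A" for y w
    using that by (simp add: lie_Z)
  from commute_if_brackets_commute[of 1 x, OF _ _ _ _ _ this] Suc.prems(1)
  show ?case by (intro ZI) auto
qed

definition splits :: "('a \<Rightarrow> 'a) \<Rightarrow> bool"
  where "splits \<phi> \<longleftrightarrow> (\<exists>h \<tau>. clinear_map_on A A h \<and> (\<forall>x\<in>A. \<forall>y\<in>A. h (x * y) = h x * y + x * h y) \<and>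
    clinear_map_on A Z \<tau> \<and> (\<forall>x\<in>A. \<phi> x = h x + \<tau> x))"

text \<open>A Lie \<open>(k + 1)\<close>-derivation; \<open>k\<close> counts the slots after the first one.\<close>
definition lie_fold_derivation :: "nat \<Rightarrow> ('a \<Rightarrow> 'a) \<Rightarrow> bool"
  where "lie_fold_derivation k \<phi> \<longleftrightarrow> clinear_map_on A A \<phi> \<and>
    (\<forall>x\<in>A. \<forall>ys. set ys \<subseteq> A \<longrightarrow> length ys = k \<longrightarrow>
       \<phi> (foldl lie_bracket x ys) = fold_deriv \<phi> x (\<phi> x) ys)"

text \<open>An iterated bracket of length \<open>2 k\<close> is one of length \<open>k\<close> whose first entry is again one of
length \<open>k\<close>. Applied twice, this makes the number of slots divisible by \<open>4\<close>, which removes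
all signs \<open>(-1)\<^sup>k\<close> and leaves room for two free slots.\<close>
lemma lie_fold_derivation_double:
  assumes "lie_fold_derivation k \<phi>" shows "lie_fold_derivation (2 * k) \<phi>"
  unfolding lie_fold_derivation_def
proof (intro conjI ballI allI impI)
  fix x ys assume x: "x \<in> A" and ys: "set ys \<subseteq> A" "length ys = 2 * k"
  define us vs where "us = take k ys" and "vs = drop k ys"
  have eq: "ys = us @ vs" and l: "length us = k" "length vs = k"
    using ys by (auto simp: us_def vs_def)
  have s: "set us \<subseteq> A" "set vs \<subseteq> A" using ys eq by auto
  have "foldl lie_bracket x us \<in> A" using x s foldl_closed by auto
  then show "\<phi> (foldl lie_bracket x ys) = fold_deriv \<phi> x (\<phi> x) ys"
    using assms x s l by (auto simp: lie_fold_derivation_def eq fold_deriv_append)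
qed (use assms in \<open>auto simp: lie_fold_derivation_def\<close>)

end

section \<open>Peirce decompositions\<close>

text \<open>The hypotheses are symmetric in \<open>p\<close> and \<open>f\<close>, so that every result about one corner gives the
result about the opposite corner by exchanging them.\<close>
locale peirce = semiprime_algebra A for A :: "'a::{ring,monoid_mult,complex_vector} set" +
  fixes p f :: 'a
  assumes p_closed [simp, intro]: "p \<in> A" and f_closed [simp, intro]: "f \<in> A"
    and pf_sum: "p + f = 1"
    and pp [simp]: "p * p = p" and pf [simp]: "p * f = 0" and fp [simp]: "f * p = 0" and ff [simp]: "f * f = f"
    and faithful_p_left: "x \<in> A \<Longrightarrow> (\<And>y. y \<in> A \<Longrightarrow> p * y * x = 0) \<Longrightarrow> x = 0"
    and faithful_p_right: "x \<in> A \<Longrightarrow> (\<And>y. y \<in> A \<Longrightarrow> x * y * p = 0) \<Longrightarrow> x = 0"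
    and faithful_f_left: "x \<in> A \<Longrightarrow> (\<And>y. y \<in> A \<Longrightarrow> f * y * x = 0) \<Longrightarrow> x = 0"
    and faithful_f_right: "x \<in> A \<Longrightarrow> (\<And>y. y \<in> A \<Longrightarrow> x * y * f = 0) \<Longrightarrow> x = 0"
    and lift_p: "c \<in> A \<Longrightarrow> p * c = c \<Longrightarrow> c * p = c \<Longrightarrow>
      (\<And>y. y \<in> A \<Longrightarrow> \<lbrace>c, p * y * p\<rbrace> = 0) \<Longrightarrow> \<exists>z\<in>Z. z * p = c"
    and lift_f: "c \<in> A \<Longrightarrow> f * c = c \<Longrightarrow> c * f = c \<Longrightarrow>
      (\<And>y. y \<in> A \<Longrightarrow> \<lbrace>c, f * y * f\<rbrace> = 0) \<Longrightarrow> \<exists>z\<in>Z. z * f = c"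
begin

lemma swapped: "peirce A f p"
  using pf_sum by unfold_locales (auto simp: add.commute intro: faithful_p_left faithful_p_right
    faithful_f_left faithful_f_right lift_p lift_f)

lemma pp' [simp]: "p * (p * x) = p * x" and pf' [simp]: "p * (f * x) = 0"
  and fp' [simp]: "f * (p * x) = 0" and ff' [simp]: "f * (f * x) = f * x"
  by (simp_all flip: mult.assoc)

lemma peirce_split: "p * x + f * x = x" "x * p + x * f = x"
  by (simp_all add: pf_sum flip: distrib_left distrib_right)

definition off_diag :: "'a \<Rightarrow> 'a" where "off_diag x = p * x * f + f * x * p"

definition corner :: "'a \<Rightarrow> 'a \<Rightarrow> 'a set" where "corner u v = {x \<in> A. u * x = x \<and> x * v = x}"

lemma cornerD:
  "x \<in> corner p v \<Longrightarrow> p * x = x" "x \<in> corner p v \<Longrightarrow> f * x = 0"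
  "x \<in> corner p v \<Longrightarrow> p * (x * y) = x * y" "x \<in> corner p v \<Longrightarrow> f * (x * y) = 0"
  "x \<in> corner f v \<Longrightarrow> f * x = x" "x \<in> corner f v \<Longrightarrow> p * x = 0"
  "x \<in> corner f v \<Longrightarrow> f * (x * y) = x * y" "x \<in> corner f v \<Longrightarrow> p * (x * y) = 0"
  "x \<in> corner u p \<Longrightarrow> x * p = x" "x \<in> corner u p \<Longrightarrow> x * f = 0"
  "x \<in> corner u p \<Longrightarrow> x * (p * y) = x * y" "x \<in> corner u p \<Longrightarrow> x * (f * y) = 0"
  "x \<in> corner u f \<Longrightarrow> x * f = x" "x \<in> corner u f \<Longrightarrow> x * p = 0"
  "x \<in> corner u f \<Longrightarrow> x * (f * y) = x * y" "x \<in> corner u f \<Longrightarrow> x * (p * y) = 0"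
  unfolding corner_def
  by (auto simp flip: mult.assoc) (metis mult.assoc pf fp mult_zero_left mult_zero_right)+

lemma corner_mult_zero:
  "x \<in> corner u p \<Longrightarrow> y \<in> corner f w \<Longrightarrow> x * y = 0"
  "x \<in> corner u f \<Longrightarrow> y \<in> corner p w \<Longrightarrow> x * y = 0"
  using cornerD(12)[of x u y] cornerD(16)[of x u y] cornerD(1)[of y w] cornerD(5)[of y w] by auto

lemma corner_mult_zero':
  "x \<in> corner u p \<Longrightarrow> y \<in> corner f w \<Longrightarrow> x * (y * v) = 0"
  "x \<in> corner u f \<Longrightarrow> y \<in> corner p w \<Longrightarrow> x * (y * v) = 0"
  using corner_mult_zero[of x u y w] by (simp_all flip: mult.assoc)

lemma corner_closed: "x \<in> corner u v \<Longrightarrow> x \<in> A"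
  by (simp add: corner_def)

lemma corner_mult: "x \<in> corner u v \<Longrightarrow> y \<in> corner v' w \<Longrightarrow> x * y \<in> corner u w"
  unfolding corner_def by (auto simp: mult.assoc) (metis mult.assoc)

lemma corner_add: "x \<in> corner u v \<Longrightarrow> y \<in> corner u v \<Longrightarrow> x + y \<in> corner u v"
  and corner_diff: "x \<in> corner u v \<Longrightarrow> y \<in> corner u v \<Longrightarrow> x - y \<in> corner u v"
  by (auto simp: corner_def algebra_simps)

lemma compress_corner:
  assumes "x \<in> A"
  shows "p * x * p \<in> corner p p" "p * x * f \<in> corner p f" "f * x * p \<in> corner f p" "f * x * f \<in> corner f f"
  using assms by (auto simp: corner_def mult.assoc)

lemma peirce_sum: "x = p * x * p + p * x * f + (f * x * p + f * x * f)"
  by (metis peirce_split mult.assoc distrib_left)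

text \<open>Bracketing with \<open>p\<close> multiplies \<open>pAf\<close> by \<open>-1\<close>, \<open>fAp\<close> by \<open>1\<close>, and kills the diagonal.\<close>
lemma ad_p_twice: "\<lbrace>\<lbrace>x, p\<rbrace>, p\<rbrace> = off_diag x"
proof -
  have "\<lbrace>\<lbrace>x, p\<rbrace>, p\<rbrace> = x * p - p * (x * p) + (p * x - p * (x * p))"
    by (simp add: lie_bracket_def algebra_simps)
  also have "x * p - p * (x * p) = f * (x * p)"
    using peirce_split(1)[of "x * p"] by (simp add: algebra_simps)
  also have "p * x - p * (x * p) = p * x * f"
    using peirce_split(2)[of "p * x"] by (simp add: algebra_simps)
  finally show ?thesis by (simp add: off_diag_def mult.assoc add.commute)
qed

lemma off_off [simp]: "off_diag (off_diag x) = off_diag x"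
  by (simp add: off_diag_def algebra_simps)

lemma foldl_ad_p: "foldl lie_bracket x (replicate (2 * Suc j) p) = off_diag x"
proof (induction j arbitrary: x)
  case 0
  have "replicate (2 * Suc 0) p = [p, p]" by (simp add: numeral_2_eq_2)
  then show ?case by (simp only: foldl.simps ad_p_twice)
next
  case (Suc j)
  have "replicate (2 * Suc (Suc j)) p = p # p # replicate (2 * Suc j) p"
    by (metis mult_Suc_right numeral_2_eq_2 add_Suc add_0 replicate_Suc)
  then show ?case using Suc by (simp only: foldl.simps ad_p_twice off_off)
qed

lemma off_simps: "off_diag (x + y) = off_diag x + off_diag y" "off_diag (x - y) = off_diag x - off_diag y" "off_diag 0 = 0"
  "off_diag (c *\<^sub>C x) = c *\<^sub>C off_diag x"
  by (simp_all add: off_diag_def algebra_simps scale_left scale_right scaleC_add_right)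

lemma off_corner: "x \<in> corner p f \<Longrightarrow> off_diag x = x" "x \<in> corner f p \<Longrightarrow> off_diag x = x"
  "x \<in> corner p p \<Longrightarrow> off_diag x = 0" "x \<in> corner f f \<Longrightarrow> off_diag x = 0"
  by (simp_all add: off_diag_def cornerD mult.assoc)

lemma off_eq_zeroD: assumes "off_diag x = 0" shows "x = p * x * p + f * x * f"
proof -
  have "p * off_diag x * f = 0" "f * off_diag x * p = 0" using assms by auto
  then have "p * x * f = 0" "f * x * p = 0" by (simp_all add: off_diag_def algebra_simps)
  then show ?thesis using peirce_sum[of x] by simp
qed

lemma off_bracket_p: "off_diag \<lbrace>x, p\<rbrace> = \<lbrace>x, p\<rbrace>"
proof -
  have "off_diag \<lbrace>x, p\<rbrace> = f * x * p - p * x * f"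
    by (simp add: off_diag_def lie_bracket_def algebra_simps)
  also have "\<dots> = (p * x * p + f * x * p) - (p * x * p + p * x * f)" by simp
  also have "\<dots> = \<lbrace>x, p\<rbrace>"
    unfolding lie_bracket_def by (metis peirce_split mult.assoc)
  finally show ?thesis .
qed

lemma zero_corner_pp:
  assumes "x \<in> corner p p" and "\<And>m. m \<in> corner p f \<Longrightarrow> x * m = 0" shows "x = 0"
proof (rule faithful_f_right)
  fix y assume "y \<in> A"
  then show "x * y * f = 0" using assms(2)[OF compress_corner(2)] cornerD(11)[OF assms(1)]
    by (simp add: mult.assoc)
qed (use assms corner_closed in auto)

text \<open>For \<open>m\<close> in \<open>pAf\<close> both \<open>m\<close> and \<open>a m\<close> commute with \<open>c\<close>, so \<open>[c, a] m = 0\<close>, and \<open>pAf\<close> is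
faithful as a left module over \<open>pAp\<close>.\<close>
lemma central_by_off_diagonal_pp:
  assumes c: "c \<in> A" "c * p = p * c"
    and 1: "\<And>m. m \<in> corner p f \<Longrightarrow> c * m = m * c"
    and a: "a \<in> corner p p"
  shows "c * a = a * c"
proof -
  have "c * a - a * c = 0"
  proof (rule zero_corner_pp)
    have "c * a = c * p * a" "a * c = a * (p * c)"
      using a by (simp_all add: cornerD mult.assoc)
    then have "c * a = p * (c * a)" "a * c = (a * c) * p"
      using c(2) a by (simp_all add: mult.assoc cornerD)
    then show "c * a - a * c \<in> corner p p"
      using a c corner_closed[OF a]
      by (simp add: corner_def algebra_simps) (metis cornerD(9) cornerD(1) mult.assoc)
    fix m assume m: "m \<in> corner p f"
    have "(c * a - a * c) * m = c * (a * m) - a * (c * m)" by (simp add: algebra_simps)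
    also have "\<dots> = 0" using 1[OF m] 1[OF corner_mult[OF a m]] by (simp add: mult.assoc)
    finally show "(c * a - a * c) * m = 0" .
  qed
  then show ?thesis by simp
qed

lemma central_by_off_diagonal:
  assumes c: "c \<in> A" "c * p = p * c"
    and 1: "\<And>m. m \<in> corner p f \<Longrightarrow> c * m = m * c"
    and 2: "\<And>m. m \<in> corner f p \<Longrightarrow> c * m = m * c"
  shows "c \<in> Z"
proof -
  have pc: "c * (p * x * p) = (p * x * p) * c" if "x \<in> A" for x
    using central_by_off_diagonal_pp[OF c 1] compress_corner(1)[OF that] by blast
  have f_eq: "f = 1 - p" using pf_sum by (simp add: algebra_simps)
  interpret swap: peirce A f p by (rule swapped)
  have "c * f = f * c" using c(2) by (simp add: f_eq algebra_simps)
  then have fc: "c * (f * x * f) = (f * x * f) * c" if "x \<in> A" for x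
    using swap.central_by_off_diagonal_pp[OF c(1) _ 2] compress_corner(4)[OF that] by blast
  have "c * x = x * c" if x: "x \<in> A" for x
  proof -
    have "c * (p * x * p + p * x * f + (f * x * p + f * x * f))
        = (p * x * p + p * x * f + (f * x * p + f * x * f)) * c"
      unfolding distrib_left distrib_right
      using pc[OF x] fc[OF x] 1[OF compress_corner(2)[OF x]] 2[OF compress_corner(3)[OF x]] by argo
    then show ?thesis using peirce_sum[of x] by simp
  qed
  then show ?thesis using c unfolding Z_def by blast
qed

lemma Z_zero: assumes z: "z \<in> Z" shows "z * f = 0 \<Longrightarrow> z = 0" "z * p = 0 \<Longrightarrow> z = 0"
proof -
  have *: "z * y * u = y * (z * u)" if "y \<in> A" for y u
    using Z_commute[OF z that] by (metis mult.assoc)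
  show "z = 0" if "z * f = 0"
    by (rule faithful_f_right[OF Z_closed[OF z]]) (simp only: * that mult_zero_right)
  show "z = 0" if "z * p = 0"
    by (rule faithful_p_right[OF Z_closed[OF z]]) (simp only: * that mult_zero_right)
qed

end

section \<open>Corner-preserving maps that respect off-diagonal brackets\<close>

text \<open>The hypotheses constrain only the off-diagonal parts of brackets; the product rule for
products that lie on the diagonal has to be deduced from them.\<close>
locale graded_lie = peirce A p f for A :: "'a::{ring,monoid_mult,complex_vector} set" and p f +
  fixes h :: "'a \<Rightarrow> 'a"
  assumes h_add: "x \<in> A \<Longrightarrow> y \<in> A \<Longrightarrow> h (x + y) = h x + h y"
    and h_pp: "x \<in> corner p p \<Longrightarrow> h x \<in> corner p p" and h_pf: "x \<in> corner p f \<Longrightarrow> h x \<in> corner p f"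
    and h_fp: "x \<in> corner f p \<Longrightarrow> h x \<in> corner f p" and h_ff: "x \<in> corner f f \<Longrightarrow> h x \<in> corner f f"
    and h_bracket: "x \<in> A \<Longrightarrow> y \<in> A \<Longrightarrow>
      h \<lbrace>\<lbrace>x, y\<rbrace>, p\<rbrace> = \<lbrace>\<lbrace>h x, y\<rbrace> + \<lbrace>x, h y\<rbrace>, p\<rbrace>"
    and h_triple: "x \<in> A \<Longrightarrow> y \<in> A \<Longrightarrow> z \<in> A \<Longrightarrow> h (off_diag \<lbrace>\<lbrace>x, y\<rbrace>, z\<rbrace>) =
      off_diag (\<lbrace>\<lbrace>h x, y\<rbrace>, z\<rbrace> + \<lbrace>\<lbrace>x, h y\<rbrace>, z\<rbrace> + \<lbrace>\<lbrace>x, y\<rbrace>, h z\<rbrace>)"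
begin

lemma h_zero [simp]: "h 0 = 0" using h_add[of 0 0] by simp

lemma h_minus: "x \<in> A \<Longrightarrow> h (- x) = - h x"
  using h_add[of x "- x"] by (simp add: eq_neg_iff_add_eq_0 add.commute)

lemma h_closed: assumes "x \<in> A" shows "h x \<in> A"
proof -
  note c = compress_corner[OF assms]
  have "h (p * x * p + p * x * f + (f * x * p + f * x * f)) =
      h (p * x * p) + h (p * x * f) + (h (f * x * p) + h (f * x * f))"
    using assms by (simp add: h_add)
  then have "h x = h (p * x * p) + h (p * x * f) + (h (f * x * p) + h (f * x * f))"
    using peirce_sum[of x] by simp
  moreover have "\<dots> \<in> A"
    using corner_closed[OF h_pp] corner_closed[OF h_pf] corner_closed[OF h_fp] corner_closed[OF h_ff] c
    by simp
  ultimately show ?thesis by simp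
qed

lemma swapped_graded: "graded_lie A f p h"
proof -
  interpret swap: peirce A f p by (rule swapped)
  have off_diag: "swap.off_diag x = off_diag x" for x by (simp add: off_diag_def swap.off_diag_def add.commute)
  have f_eq: "f = 1 - p" using pf_sum by (simp add: algebra_simps)
  have br: "\<lbrace>x, f\<rbrace> = - \<lbrace>x, p\<rbrace>" for x by (simp add: f_eq lie_bracket_def algebra_simps)
  show ?thesis
  proof unfold_locales
    fix x y z assume "x \<in> A" "y \<in> A" "z \<in> A"
    then show "h (swap.off_diag \<lbrace>\<lbrace>x, y\<rbrace>, z\<rbrace>) =
      swap.off_diag (\<lbrace>\<lbrace>h x, y\<rbrace>, z\<rbrace> + \<lbrace>\<lbrace>x, h y\<rbrace>, z\<rbrace> + \<lbrace>\<lbrace>x, y\<rbrace>, h z\<rbrace>)"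
      unfolding off_diag by (rule h_triple)
  qed (auto simp: br h_minus h_bracket h_add h_pp h_pf h_fp h_ff)
qed

text \<open>Here \<open>a m = [a, m]\<close> is itself an off-diagonal bracket.\<close>
lemma h_pp_pf:
  assumes a: "a \<in> corner p p" and m: "m \<in> corner p f"
  shows "h (a * m) = h a * m + a * h m"
proof -
  note ha = h_pp[OF a] and hm = h_pf[OF m]
  have "\<lbrace>\<lbrace>a, m\<rbrace>, p\<rbrace> = - (a * m)"
    using a m by (simp add: lie_bracket_def cornerD corner_mult_zero mult.assoc algebra_simps)
  moreover have "\<lbrace>\<lbrace>h a, m\<rbrace> + \<lbrace>a, h m\<rbrace>, p\<rbrace> = - (h a * m + a * h m)"
    using a m ha hm by (simp add: lie_bracket_def cornerD corner_mult_zero mult.assoc algebra_simps)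
  ultimately have "- h (a * m) = - (h a * m + a * h m)"
    using h_bracket[of a m] a m corner_closed by (simp del: minus_add_distrib add: h_minus)
  then show ?thesis by (simp only: neg_equal_iff_equal)
qed

lemma h_pf_ff:
  assumes m: "m \<in> corner p f" and b: "b \<in> corner f f"
  shows "h (m * b) = h m * b + m * h b"
proof -
  note hb = h_ff[OF b] and hm = h_pf[OF m]
  have "\<lbrace>\<lbrace>m, b\<rbrace>, p\<rbrace> = - (m * b)"
    using b m by (simp add: lie_bracket_def cornerD corner_mult_zero mult.assoc algebra_simps)
  moreover have "\<lbrace>\<lbrace>h m, b\<rbrace> + \<lbrace>m, h b\<rbrace>, p\<rbrace> = - (h m * b + m * h b)"
    using b m hb hm by (simp add: lie_bracket_def cornerD corner_mult_zero mult.assoc algebra_simps)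
  ultimately have "- h (m * b) = - (h m * b + m * h b)"
    using h_bracket[of m b] b m corner_closed by (simp del: minus_add_distrib add: h_minus)
  then show ?thesis by (simp only: neg_equal_iff_equal)
qed

text \<open>Expand \<open>h (a b m)\<close> for \<open>m\<close> in \<open>pAf\<close> in two ways and cancel \<open>m\<close> by faithfulness.\<close>
lemma h_pp_pp:
  assumes a: "a \<in> corner p p" and b: "b \<in> corner p p"
  shows "h (a * b) = h a * b + a * h b"
proof -
  have "h (a * b) - (h a * b + a * h b) = 0"
  proof (rule zero_corner_pp)
    show "h (a * b) - (h a * b + a * h b) \<in> corner p p"
      by (intro corner_diff corner_add h_pp corner_mult[OF a b] corner_mult[OF h_pp[OF a] b]
          corner_mult[OF a h_pp[OF b]])
    fix m assume m: "m \<in> corner p f"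
    have "h (a * b) * m + a * b * h m = h (a * (b * m))"
      using h_pp_pf[OF corner_mult[OF a b] m] by (simp add: mult.assoc)
    also have "\<dots> = h a * (b * m) + a * (h b * m + b * h m)"
      using h_pp_pf[OF a corner_mult[OF b m]] h_pp_pf[OF b m] by simp
    finally show "(h (a * b) - (h a * b + a * h b)) * m = 0"
      by (simp add: algebra_simps)
  qed
  then show ?thesis by simp
qed

definition defect :: "'a \<Rightarrow> 'a \<Rightarrow> 'a" where "defect x y = h (x * y) - h x * y - x * h y"

text \<open>This is the double bracket \<open>[[m, m'], n] = m m' n + n m' m\<close>, after the product rules for
\<open>(m m') n\<close> and \<open>n (m' m)\<close> have been subtracted.\<close>
lemma defect_sandwich:
  assumes m: "m \<in> corner p f" and m': "m' \<in> corner f p" and n: "n \<in> corner p f"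
  shows "defect m m' * n + n * defect m' m = 0"
proof -
  note hm = h_pf[OF m] and hm' = h_fp[OF m'] and hn = h_pf[OF n]
  note c = corner_mult[OF m m'] corner_mult[OF m' m]
  have "off_diag \<lbrace>\<lbrace>m, m'\<rbrace>, n\<rbrace> = (m * m') * n + n * (m' * m)"
    using m m' n by (simp add: off_diag_def lie_bracket_def cornerD corner_mult_zero corner_mult_zero' algebra_simps)
  then have "h (off_diag \<lbrace>\<lbrace>m, m'\<rbrace>, n\<rbrace>) = h (m * m') * n + m * m' * h n + (h n * (m' * m) + n * h (m' * m))"
    using h_add[of "(m * m') * n" "n * (m' * m)"] h_pp_pf[OF c(1) n] h_pf_ff[OF n c(2)] corner_closed m m' n
    by simp
  moreover have "off_diag (\<lbrace>\<lbrace>h m, m'\<rbrace>, n\<rbrace> + \<lbrace>\<lbrace>m, h m'\<rbrace>, n\<rbrace> + \<lbrace>\<lbrace>m, m'\<rbrace>, h n\<rbrace>) =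
    h m * m' * n + n * m' * h m + (m * h m' * n + n * h m' * m) + (m * m' * h n + h n * m' * m)"
    using m m' n hm hm' hn
    by (simp add: off_diag_def lie_bracket_def cornerD corner_mult_zero corner_mult_zero' algebra_simps)
  ultimately show ?thesis
    using h_triple[of m m' n] corner_closed m m' n by (simp add: defect_def algebra_simps)
qed

lemma defect_left_mult:
  assumes a: "a \<in> corner p p" and m: "m \<in> corner p f" and m': "m' \<in> corner f p"
  shows "defect (a * m) m' = a * defect m m'"
  using h_pp_pf[OF a m] h_pp_pp[OF a corner_mult[OF m m']]
  by (simp add: defect_def algebra_simps)

end

lemmas (in graded_lie) h_ff_fp = graded_lie.h_pp_pf[OF swapped_graded]
lemmas (in graded_lie) h_fp_pp = graded_lie.h_pf_ff[OF swapped_graded]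
lemmas (in graded_lie) h_ff_ff = graded_lie.h_pp_pp[OF swapped_graded]
lemmas (in graded_lie) defect_sandwich' = graded_lie.defect_sandwich[OF swapped_graded]

context graded_lie
begin

text \<open>Let \<open>e1 = defect m m'\<close> in \<open>pAp\<close> and \<open>e2 = defect m' m\<close> in \<open>fAf\<close>. By the sandwich identity
\<open>e1 n = - n e2\<close> for all \<open>n\<close>, so \<open>e1 - e2\<close> is central; whereas expanding \<open>h (m m' m)\<close> in two
ways gives \<open>e1 m = m e2\<close>. Hence \<open>e1 m = 0\<close>, and since the defect is \<open>pAp\<close>-linear in its
first argument, \<open>e1\<^sup>2 = defect (e1 m) m' = 0\<close>. As \<open>e1\<close> is a central multiple of \<open>p\<close>, it
vanishes.\<close>
lemma defect_zero:
  assumes m: "m \<in> corner p f" and m': "m' \<in> corner f p"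
  shows "defect m m' = 0"
proof (rule semiprime)
  define e1 where "e1 = defect m m'"
  define e2 where "e2 = defect m' m"
  have e1: "e1 \<in> corner p p" unfolding e1_def defect_def
    by (intro corner_diff h_pp corner_mult[OF m m'] corner_mult[OF h_pf[OF m] m'] corner_mult[OF m h_fp[OF m']])
  have e2: "e2 \<in> corner f f" unfolding e2_def defect_def
    by (intro corner_diff h_ff corner_mult[OF m' m] corner_mult[OF h_fp[OF m'] m] corner_mult[OF m' h_pf[OF m]])
  note cl = corner_closed[OF e1] corner_closed[OF e2]
  have c: "e1 - e2 \<in> Z"
  proof (rule central_by_off_diagonal)
    fix n assume n: "n \<in> corner p f"
    then have "e1 * n + n * e2 = 0" using defect_sandwich[OF m m'] by (simp add: e1_def e2_def)
    then show "(e1 - e2) * n = n * (e1 - e2)"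
      using e1 e2 n by (simp add: algebra_simps corner_mult_zero add_eq_0_iff2)
  next
    fix n assume n: "n \<in> corner f p"
    then have "e2 * n + n * e1 = 0" using defect_sandwich'[OF m' m] by (simp add: e1_def e2_def)
    then show "(e1 - e2) * n = n * (e1 - e2)"
      using e1 e2 n by (simp add: algebra_simps corner_mult_zero add_eq_0_iff2)
  qed (use cl e1 e2 in \<open>auto simp: algebra_simps cornerD\<close>)
  have "h (m * m') * m + m * m' * h m = h (m * (m' * m))"
    using h_pp_pf[OF corner_mult[OF m m'] m] by (simp add: mult.assoc)
  also have "\<dots> = h m * (m' * m) + m * h (m' * m)"
    using h_pf_ff[OF m corner_mult[OF m' m]] .
  finally have "e1 * m = m * e2"
    by (simp add: e1_def e2_def defect_def algebra_simps)
  then have "e1 * m + e1 * m = 0" using defect_sandwich[OF m m' m] by (simp add: e1_def e2_def)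
  then have "e1 * m = 0" by (rule double_zero)
  then have sq: "e1 * e1 = 0"
    using defect_left_mult[OF e1 m m'] by (simp add: e1_def[symmetric]) (simp add: defect_def)
  fix y assume y: "y \<in> A"
  have e1c: "e1 = (e1 - e2) * p" using e1 e2 by (simp add: algebra_simps cornerD)
  have "e1 * y * e1 = e1 * y * ((e1 - e2) * p)" using e1c by simp
  also have "\<dots> = e1 * (y * (e1 - e2)) * p" by (simp add: mult.assoc)
  also have "\<dots> = e1 * ((e1 - e2) * y) * p" using Z_commute[OF c y] by simp
  also have "\<dots> = 0" using e1 e2 sq by (simp add: algebra_simps corner_mult_zero' ) (simp add: sq flip: mult.assoc)
  finally show "defect m m' * y * defect m m' = 0" by (simp add: e1_def)
qed (use m m' corner_closed h_closed in \<open>auto simp: defect_def\<close>)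

lemma h_pf_fp: "m \<in> corner p f \<Longrightarrow> m' \<in> corner f p \<Longrightarrow> h (m * m') = h m * m' + m * h m'"
  using defect_zero[of m m'] by (simp add: defect_def algebra_simps)

end

lemmas (in graded_lie) h_fp_pf = graded_lie.h_pf_fp[OF swapped_graded]

context graded_lie
begin

lemma leibniz:
  assumes x: "x \<in> A" and y: "y \<in> A"
  shows "h (x * y) = h x * y + x * h y"
proof -
  define L where "L x y \<longleftrightarrow> h (x * y) = h x * y + x * h y" for x y
  have L1: "L (x + x') y" if "x \<in> A" "x' \<in> A" "y \<in> A" "L x y" "L x' y" for x x' y
    using that by (simp add: L_def h_add algebra_simps)
  have L2: "L x (y + y')" if "x \<in> A" "y \<in> A" "y' \<in> A" "L x y" "L x y'" for x y y'
    using that by (simp add: L_def h_add algebra_simps)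
  have L3: "L x (p * y * p + p * y * f + (f * y * p + f * y * f))"
    if "x \<in> A" "y \<in> A" "L x (p * y * p)" "L x (p * y * f)" "L x (f * y * p)" "L x (f * y * f)" for x y
    using that by (intro L2) auto
  have "L (p * x * p + p * x * f + (f * x * p + f * x * f)) (p * y * p + p * y * f + (f * y * p + f * y * f))"
    using x y compress_corner[OF x] compress_corner[OF y]
    by (intro L1 L3 add_closed mult_closed p_closed f_closed)
      (auto simp: L_def h_pp_pp h_pp_pf h_pf_ff h_pf_fp h_fp_pp h_fp_pf h_ff_ff h_ff_fp
        corner_mult_zero corner_mult_zero(1)[OF h_pp] corner_mult_zero(1)[OF h_fp]
        corner_mult_zero(2)[OF h_pf] corner_mult_zero(2)[OF h_ff]
        corner_mult_zero(1)[OF _ h_fp] corner_mult_zero(1)[OF _ h_ff]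
        corner_mult_zero(2)[OF _ h_pp] corner_mult_zero(2)[OF _ h_pf])
  then show ?thesis using peirce_sum[of x] peirce_sum[of y] by (simp add: L_def)
qed

end

section \<open>Lie derivations along a Peirce decomposition\<close>

text \<open>That \<open>\<phi> p\<close> is diagonal is achieved by subtracting an inner derivation.\<close>
locale peirce_lie = peirce A p f for A :: "'a::{ring,monoid_mult,complex_vector} set" and p f +
  fixes \<phi> :: "'a \<Rightarrow> 'a" and k :: nat
  assumes lie_fold: "lie_fold_derivation k \<phi>"
    and even_k: "even k" and k_ge_4: "k \<ge> 4"
    and phi_p: "\<phi> p * p = p * \<phi> p"
begin

lemma phi_closed [simp, intro]: "x \<in> A \<Longrightarrow> \<phi> x \<in> A"
  and phi_add: "x \<in> A \<Longrightarrow> y \<in> A \<Longrightarrow> \<phi> (x + y) = \<phi> x + \<phi> y"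
  and phi_scale: "x \<in> A \<Longrightarrow> \<phi> (c *\<^sub>C x) = c *\<^sub>C \<phi> x"
  and phi_fold: "x \<in> A \<Longrightarrow> set ys \<subseteq> A \<Longrightarrow> length ys = k \<Longrightarrow>
    \<phi> (foldl lie_bracket x ys) = fold_deriv \<phi> x (\<phi> x) ys"
  using lie_fold by (auto simp: lie_fold_derivation_def clinear_map_on_def)

lemma phi_zero [simp]: "\<phi> 0 = 0" using phi_add[of 0 0] by simp

lemma phi_minus: "x \<in> A \<Longrightarrow> \<phi> (- x) = - \<phi> x"
  using phi_add[of x "- x"] by (simp add: eq_neg_iff_add_eq_0 add.commute)

text \<open>All brackets with \<open>1\<close> vanish, and the derivative of \<open>[1, y\<^sub>1, \<dots>, y\<^sub>k]\<close> is \<open>[\<phi> 1, y\<^sub>1, \<dots>, y\<^sub>k]\<close>.\<close>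
lemma phi_one: "\<phi> 1 \<in> Z"
proof (rule central_if_iterated_brackets_vanish)
  fix ys assume ys: "set ys \<subseteq> A" "length ys = Suc (k - 1)"
  then obtain y zs where ys': "ys = y # zs" by (cases ys) auto
  have "length ys = k" using ys k_ge_4 by simp
  with phi_fold[of 1 ys] ys(1) have "fold_deriv \<phi> 1 (\<phi> 1) ys = 0"
    by (simp add: ys' lie_bracket_def)
  then show "foldl lie_bracket (\<phi> 1) ys = 0"
    by (simp add: ys' lie_bracket_def fold_deriv_zero)
qed simp

lemma phi_p_f: "\<phi> p * f = f * \<phi> p"
proof -
  have f_eq: "f = 1 - p" using pf_sum by (simp add: algebra_simps)
  show ?thesis unfolding f_eq using phi_p by (simp add: left_diff_distrib right_diff_distrib)
qed

lemma swapped_lie: "peirce_lie A f p \<phi> k"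
proof -
  interpret swap: peirce A f p by (rule swapped)
  have "\<phi> f = \<phi> 1 - \<phi> p" using phi_add[of p f] by (simp add: pf_sum)
  then have "\<phi> f * f = f * \<phi> f"
    using phi_p_f Z_commute[OF phi_one f_closed] by (simp add: left_diff_distrib right_diff_distrib)
  then show ?thesis
    by unfold_locales (use lie_fold even_k k_ge_4 in auto)
qed

lemma bracket_phi_p_corner:
  assumes m: "m \<in> corner p f" shows "\<lbrace>m, \<phi> p\<rbrace> \<in> corner p f"
proof -
  have "p * (\<phi> p * m) = \<phi> p * m" "m * (\<phi> p * f) = m * \<phi> p"
    using phi_p phi_p_f cornerD(1)[OF m] cornerD(13)[OF m] by (metis mult.assoc)+
  then show ?thesis
    using m corner_closed[OF m]
    by (simp add: corner_def lie_bracket_def right_diff_distrib left_diff_distrib mult.assoc flip: mult.assoc[of p m])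
qed

text \<open>Each slot filled with \<open>p\<close> contributes one copy of \<open>[m, \<phi> p]\<close>, with a sign that does not
depend on the slot because \<open>[m, \<phi> p]\<close> lies in \<open>pAf\<close> together with \<open>m\<close>.\<close>
lemma fold_deriv_replicate_p:
  assumes m: "m \<in> corner p f"
  shows "fold_deriv \<phi> m x' (replicate (2 * Suc j) p) =
    off_diag x' - (\<Sum>i<Suc j. \<lbrace>m, \<phi> p\<rbrace> + \<lbrace>m, \<phi> p\<rbrace>)"
proof (induction j arbitrary: x')
  have 1: "\<lbrace>m, p\<rbrace> = - m" "\<lbrace>- m, p\<rbrace> = m" using m by (simp_all add: lie_bracket_def cornerD)
  define y where "y = \<lbrace>m, \<phi> p\<rbrace>"
  have yc: "y \<in> corner p f" unfolding y_def by (rule bracket_phi_p_corner[OF m])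
  then have "p * y = y" "y * p = 0" by (simp_all add: cornerD)
  then have 2: "\<lbrace>y, p\<rbrace> = - y" by (simp add: lie_bracket_def)
  have step: "fold_deriv \<phi> m x' (p # p # r) = fold_deriv \<phi> m (off_diag x' - (y + y)) r" for r x'
  proof -
    have "\<lbrace>\<lbrace>x', p\<rbrace> + y, p\<rbrace> + \<lbrace>- m, \<phi> p\<rbrace> = off_diag x' - (y + y)"
    proof -
      have "\<lbrace>\<lbrace>x', p\<rbrace> + y, p\<rbrace> = \<lbrace>\<lbrace>x', p\<rbrace>, p\<rbrace> + \<lbrace>y, p\<rbrace>" by (simp add: lie_bracket_def algebra_simps)
      moreover have "\<lbrace>- m, \<phi> p\<rbrace> = - y" by (simp add: y_def lie_bracket_def)
      ultimately show ?thesis by (simp only: ad_p_twice 2) simp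
    qed
    then show ?thesis by (simp add: 1 y_def)
  qed
  have offy: "off_diag y = y" using yc by (rule off_corner)
  {
    case 0
    have "replicate (2 * Suc 0) p = [p, p]" by (simp add: numeral_2_eq_2)
    then show ?case using step[of x' "[]"] by (simp only: fold_deriv.simps y_def) simp
  next
    case (Suc j)
    have "replicate (2 * Suc (Suc j)) p = p # p # replicate (2 * Suc j) p"
      by (metis mult_Suc_right numeral_2_eq_2 add_Suc add_0 replicate_Suc)
    then have "fold_deriv \<phi> m x' (replicate (2 * Suc (Suc j)) p) =
      off_diag (off_diag x' - (y + y)) - (\<Sum>i<Suc j. y + y)"
      using step Suc.IH by (simp only: y_def)
    also have "off_diag (off_diag x' - (y + y)) = off_diag x' - (y + y)" by (simp add: off_simps offy)
    finally show ?case unfolding y_def[symmetric] by (simp add: algebra_simps)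
  }
qed

lemma k_form: obtains j where "k = 2 * Suc (Suc j)"
proof -
  obtain i where "k = 2 * i" using even_k by blast
  then have "k = 2 * Suc (Suc (i - 2))" using k_ge_4 by simp
  then show ?thesis by (rule that)
qed

text \<open>Compare off-diagonal parts in the identity for \<open>m = [m, p, \<dots>, p]\<close>: the term \<open>off_diag (\<phi> m)\<close>
occurs on both sides, so a nonzero multiple of \<open>[m, \<phi> p]\<close> is \<open>0\<close>.\<close>
lemma corner_pf_commutes_phi_p:
  assumes m: "m \<in> corner p f" shows "\<lbrace>m, \<phi> p\<rbrace> = 0"
proof -
  obtain j where k: "k = 2 * Suc (Suc j)" by (rule k_form)
  define s where "s = \<lbrace>m, \<phi> p\<rbrace> + \<lbrace>m, \<phi> p\<rbrace>"
  have "set (replicate k p) \<subseteq> A" by (simp add: set_replicate_conv_if)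
  then have "\<phi> (foldl lie_bracket m (replicate k p)) = fold_deriv \<phi> m (\<phi> m) (replicate k p)"
    using phi_fold corner_closed[OF m] by simp
  then have eq: "\<phi> m = off_diag (\<phi> m) - of_nat (Suc (Suc j)) *\<^sub>C s"
    unfolding k foldl_ad_p fold_deriv_replicate_p[OF m] off_corner(1)[OF m] scale_nat s_def .
  have "of_nat (Suc (Suc j)) *\<^sub>C s = off_diag (\<phi> m) - \<phi> m"
    using eq by (metis add_diff_cancel_left' diff_add_cancel)
  then have "off_diag (of_nat (Suc (Suc j)) *\<^sub>C s) = off_diag (off_diag (\<phi> m) - \<phi> m)"
    by (rule arg_cong)
  then have "of_nat (Suc (Suc j)) *\<^sub>C off_diag s = 0"
    unfolding off_simps off_off by (simp only: diff_self)
  then have "off_diag s = 0" by (rule scale_cancel) (simp del: of_nat_Suc)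
  moreover have "off_diag s = s"
    using off_corner(1)[OF bracket_phi_p_corner[OF m]] by (simp add: s_def off_simps)
  ultimately have "s = 0" by simp
  then show ?thesis unfolding s_def by (rule double_zero)
qed

lemma phi_p_central: "\<phi> p \<in> Z"
proof (rule central_by_off_diagonal)
  interpret swap: peirce_lie A f p \<phi> k by (rule swapped_lie)
  show "\<phi> p * m = m * \<phi> p" if "m \<in> corner p f" for m
    using corner_pf_commutes_phi_p[OF that] by (simp add: lie_bracket_def)
  show "\<phi> p * m = m * \<phi> p" if m: "m \<in> corner f p" for m
  proof -
    have "\<phi> f * m = m * \<phi> f"
      using swap.corner_pf_commutes_phi_p[OF m] by (simp add: lie_bracket_def)
    moreover have "\<phi> f = \<phi> 1 - \<phi> p" using phi_add[of p f] by (simp add: pf_sum)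
    ultimately show ?thesis
      using Z_commute[OF phi_one corner_closed[OF m]] by (simp add: algebra_simps)
  qed
qed (use phi_p in auto)

lemma fold_deriv_p:
  assumes "x \<in> A"
  shows "fold_deriv \<phi> x x' (replicate j p) = foldl lie_bracket x' (replicate j p)"
  using assms by (induction j arbitrary: x x') (auto simp: lie_Z phi_p_central)

lemma phi_off: assumes "x \<in> A" shows "\<phi> (off_diag x) = off_diag (\<phi> x)"
proof -
  obtain j where k: "k = 2 * Suc (Suc j)" by (rule k_form)
  have "set (replicate k p) \<subseteq> A" by (simp add: set_replicate_conv_if)
  then show ?thesis
    using phi_fold[OF assms, of "replicate k p"] fold_deriv_p[OF assms, of "\<phi> x" k]
    by (simp only: k foldl_ad_p length_replicate)
qed

text \<open>Use the first two slots for \<open>y\<close> and \<open>z\<close> and fill the others with \<open>p\<close>. The trailing copies of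
\<open>p\<close> project onto the off-diagonal part.\<close>
lemma phi_triple:
  assumes "x \<in> A" "y \<in> A" "z \<in> A"
  shows "\<phi> (off_diag \<lbrace>\<lbrace>x, y\<rbrace>, z\<rbrace>) =
    off_diag (\<lbrace>\<lbrace>\<phi> x, y\<rbrace>, z\<rbrace> + \<lbrace>\<lbrace>x, \<phi> y\<rbrace>, z\<rbrace> + \<lbrace>\<lbrace>x, y\<rbrace>, \<phi> z\<rbrace>)"
proof -
  obtain j where k: "k = 2 * Suc (Suc j)" by (rule k_form)
  have "set (y # z # replicate (2 * Suc j) p) \<subseteq> A" using assms by (simp add: set_replicate_conv_if)
  moreover have "length (y # z # replicate (2 * Suc j) p) = k" by (simp add: k)
  ultimately have "\<phi> (foldl lie_bracket x (y # z # replicate (2 * Suc j) p)) =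
    fold_deriv \<phi> x (\<phi> x) (y # z # replicate (2 * Suc j) p)"
    by (rule phi_fold[OF assms(1)])
  then have "\<phi> (off_diag \<lbrace>\<lbrace>x, y\<rbrace>, z\<rbrace>) = off_diag (\<lbrace>\<lbrace>\<phi> x, y\<rbrace> + \<lbrace>x, \<phi> y\<rbrace>, z\<rbrace> + \<lbrace>\<lbrace>x, y\<rbrace>, \<phi> z\<rbrace>)"
    using assms by (simp only: foldl.simps fold_deriv.simps foldl_ad_p fold_deriv_p lie_closed)
  moreover have "\<lbrace>\<lbrace>\<phi> x, y\<rbrace> + \<lbrace>x, \<phi> y\<rbrace>, z\<rbrace> = \<lbrace>\<lbrace>\<phi> x, y\<rbrace>, z\<rbrace> + \<lbrace>\<lbrace>x, \<phi> y\<rbrace>, z\<rbrace>"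
    by (simp add: lie_bracket_def algebra_simps)
  ultimately show ?thesis by simp
qed

lemma phi_bracket:
  assumes "x \<in> A" "y \<in> A"
  shows "\<phi> \<lbrace>\<lbrace>x, y\<rbrace>, p\<rbrace> = \<lbrace>\<lbrace>\<phi> x, y\<rbrace> + \<lbrace>x, \<phi> y\<rbrace>, p\<rbrace>"
proof -
  have "\<lbrace>\<lbrace>\<phi> x, y\<rbrace>, p\<rbrace> + \<lbrace>\<lbrace>x, \<phi> y\<rbrace>, p\<rbrace> = \<lbrace>\<lbrace>\<phi> x, y\<rbrace> + \<lbrace>x, \<phi> y\<rbrace>, p\<rbrace>"
    by (simp add: lie_bracket_def algebra_simps)
  then show ?thesis
    using phi_triple[OF assms p_closed] assms
    by (simp add: off_bracket_p lie_Z phi_p_central)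
qed

text \<open>The component of \<open>\<phi> m\<close> in the wrong off-diagonal corner.\<close>
definition cross :: "'a \<Rightarrow> 'a" where "cross m = f * \<phi> m * p"

text \<open>The map \<open>cross\<close> reverses the bimodule structure, because the sign of bracketing with \<open>p\<close> on
\<open>fAp\<close> is opposite to that on \<open>pAf\<close>.\<close>
lemma cross_left:
  assumes a: "a \<in> corner p p" and m: "m \<in> corner p f"
  shows "cross (a * m) = cross m * a"
proof -
  have "\<lbrace>\<lbrace>a, m\<rbrace>, p\<rbrace> = - (a * m)"
    using a m by (simp add: lie_bracket_def cornerD corner_mult_zero mult.assoc algebra_simps)
  then have "- \<phi> (a * m) = \<lbrace>\<lbrace>\<phi> a, m\<rbrace> + \<lbrace>a, \<phi> m\<rbrace>, p\<rbrace>"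
    using phi_bracket[of a m] a m corner_closed by (simp add: phi_minus)
  then have "f * (- \<phi> (a * m)) * p = f * \<lbrace>\<lbrace>\<phi> a, m\<rbrace> + \<lbrace>a, \<phi> m\<rbrace>, p\<rbrace> * p" by simp
  also have "\<dots> = - (cross m * a)"
    using a m by (simp add: lie_bracket_def cross_def cornerD corner_mult_zero algebra_simps)
  finally show ?thesis by (simp add: cross_def)
qed

lemma cross_right:
  assumes m: "m \<in> corner p f" and b: "b \<in> corner f f"
  shows "cross (m * b) = b * cross m"
proof -
  have "\<lbrace>\<lbrace>m, b\<rbrace>, p\<rbrace> = - (m * b)"
    using b m by (simp add: lie_bracket_def cornerD corner_mult_zero mult.assoc algebra_simps)
  then have "- \<phi> (m * b) = \<lbrace>\<lbrace>\<phi> m, b\<rbrace> + \<lbrace>m, \<phi> b\<rbrace>, p\<rbrace>"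
    using phi_bracket[of m b] b m corner_closed by (simp add: phi_minus)
  then have "f * (- \<phi> (m * b)) * p = f * \<lbrace>\<lbrace>\<phi> m, b\<rbrace> + \<lbrace>m, \<phi> b\<rbrace>, p\<rbrace> * p" by simp
  also have "\<dots> = - (b * cross m)"
    using b m by (simp add: lie_bracket_def cross_def cornerD corner_mult_zero algebra_simps)
  finally show ?thesis by (simp add: cross_def)
qed

text \<open>Put \<open>v = cross n\<close>. For \<open>m\<close> in \<open>pAf\<close> and \<open>m'\<close> in \<open>fAp\<close> the double bracket
\<open>[[m, m'], n] = m m' n + n m' m\<close> yields \<open>v m m' + m' m v\<close> by the reversed module rules and
the negative of this by the derivation identity. With \<open>m' = v\<close> this gives \<open>v m v = 0\<close> for
all \<open>m\<close> in \<open>pAf\<close>, hence \<open>v A v = 0\<close>.\<close>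
lemma cross_zero: assumes n: "n \<in> corner p f" shows "cross n = 0"
proof (rule semiprime)
  define v where "v = cross n"
  have v: "v \<in> corner f p"
    unfolding v_def cross_def using compress_corner(3)[of "\<phi> n"] n corner_closed by auto
  have vmv: "v * m * v = 0" if m: "m \<in> corner p f" for m
  proof -
    have "off_diag \<lbrace>\<lbrace>m, v\<rbrace>, n\<rbrace> = (m * v) * n + n * (v * m)"
      using m v n by (simp add: off_diag_def lie_bracket_def cornerD corner_mult_zero corner_mult_zero' algebra_simps)
    then have "f * \<phi> (off_diag \<lbrace>\<lbrace>m, v\<rbrace>, n\<rbrace>) * p = cross ((m * v) * n) + cross (n * (v * m))"
      using m v n corner_closed by (simp add: phi_add cross_def algebra_simps)
    also have "\<dots> = v * (m * v) + (v * m) * v"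
      using cross_left[OF corner_mult[OF m v] n] cross_right[OF n corner_mult[OF v m]]
      by (simp add: v_def)
    finally have 1: "f * \<phi> (off_diag \<lbrace>\<lbrace>m, v\<rbrace>, n\<rbrace>) * p = v * (m * v) + (v * m) * v" .
    have "f * off_diag (\<lbrace>\<lbrace>\<phi> m, v\<rbrace>, n\<rbrace> + \<lbrace>\<lbrace>m, \<phi> v\<rbrace>, n\<rbrace> + \<lbrace>\<lbrace>m, v\<rbrace>, \<phi> n\<rbrace>) * p =
      f * \<lbrace>\<lbrace>m, v\<rbrace>, \<phi> n\<rbrace> * p"
      using m v n by (simp add: off_diag_def lie_bracket_def cornerD corner_mult_zero corner_mult_zero' algebra_simps)
    also have "\<dots> = - (v * m * v + v * (m * v))"
      using m v n by (simp add: v_def[unfolded cross_def] lie_bracket_def algebra_simps cornerD corner_mult_zero corner_mult_zero')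
    finally have "v * (m * v) + (v * m) * v = - (v * m * v + v * (m * v))"
      using 1 phi_triple[of m v n] m v n corner_closed by simp
    then have "(v * m * v + v * m * v) + (v * m * v + v * m * v) = 0"
      by (metis mult.assoc eq_neg_iff_add_eq_0)
    then show ?thesis by (rule double_zero[THEN double_zero])
  qed
  fix y assume "y \<in> A"
  then have "v * y * v = v * (p * y * f) * v" using v by (simp add: cornerD mult.assoc)
  then show "cross n * y * cross n = 0" using vmv[OF compress_corner(2)] \<open>y \<in> A\<close> by (simp add: v_def)
qed (use n corner_closed in \<open>auto simp: cross_def\<close>)

lemma phi_pf: assumes m: "m \<in> corner p f" shows "\<phi> m \<in> corner p f"
proof -
  have "\<phi> m = off_diag (\<phi> m)" using phi_off[of m] m corner_closed off_corner(1) by metis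
  also have "\<dots> = p * \<phi> m * f" using cross_zero[OF m] by (simp add: off_diag_def cross_def)
  finally show ?thesis using compress_corner(2)[of "\<phi> m"] m corner_closed by auto
qed

lemma phi_pp_diagonal: assumes a: "a \<in> corner p p" shows "\<phi> a = p * \<phi> a * p + f * \<phi> a * f"
  using phi_off[of a] off_corner(3)[OF a] corner_closed[OF a] by (intro off_eq_zeroD) simp

lemma phi_pp_commutator_central:
  assumes a: "a \<in> corner p p" and b: "b \<in> corner f f"
  shows "\<lbrace>\<phi> a, b\<rbrace> + \<lbrace>a, \<phi> b\<rbrace> \<in> Z"
proof (rule central_if_iterated_brackets_vanish)
  show "\<lbrace>\<phi> a, b\<rbrace> + \<lbrace>a, \<phi> b\<rbrace> \<in> A" using a b corner_closed by auto
  fix ys assume ys: "set ys \<subseteq> A" "length ys = Suc (k - 2)"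
  have "length (b # ys) = k" "set (b # ys) \<subseteq> A" using ys k_ge_4 b corner_closed by auto
  moreover have "\<lbrace>a, b\<rbrace> = 0" using a b by (simp add: lie_bracket_def corner_mult_zero)
  ultimately show "foldl lie_bracket (\<lbrace>\<phi> a, b\<rbrace> + \<lbrace>a, \<phi> b\<rbrace>) ys = 0"
    using phi_fold[of a "b # ys"] a corner_closed by (simp add: fold_deriv_zero)
qed

text \<open>For \<open>b\<close> in \<open>fAf\<close> we have \<open>[a, b] = 0\<close>, so all brackets starting with \<open>[\<phi> a, b] + [a, \<phi> b]\<close>
vanish and this element is central. Its component in \<open>fAf\<close> is \<open>[f \<phi>(a) f, b]\<close>; therefore
\<open>f \<phi>(a) f\<close> lies in the second centre of \<open>fAf\<close>, which is the centre.\<close>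
lemma phi_pp_lift: assumes a: "a \<in> corner p p" shows "\<exists>z\<in>Z. z * f = f * \<phi> a * f"
proof (rule lift_f)
  define c where "c = f * \<phi> a * f"
  have c: "c \<in> corner f f" unfolding c_def using compress_corner(4)[of "\<phi> a"] a corner_closed by auto
  have *: "\<lbrace>\<lbrace>c, f * y * f\<rbrace>, f * w * f\<rbrace> = 0" if "y \<in> A" "w \<in> A" for y w
  proof -
    note b = compress_corner(4)[OF that(1)]
    define W where "W = \<lbrace>\<phi> a, f * y * f\<rbrace> + \<lbrace>a, \<phi> (f * y * f)\<rbrace>"
    have W: "W \<in> Z" unfolding W_def by (rule phi_pp_commutator_central[OF a b])
    have "f * W * f = \<lbrace>c, f * y * f\<rbrace>"
      using a by (simp add: W_def c_def lie_bracket_def algebra_simps cornerD)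
    moreover have "f * W * f = W * f" using Z_commute[OF W f_closed] by (simp add: mult.assoc)
    moreover have "\<lbrace>W * f, f * w * f\<rbrace> = 0"
      using Z_commute[OF W, of "f * w * f"] that(2) Z_commute[OF W f_closed]
      by (simp add: lie_bracket_def mult.assoc)
    ultimately show ?thesis by simp
  qed
  show "\<lbrace>f * \<phi> a * f, f * y * f\<rbrace> = 0" if "y \<in> A" for y
    using commute_if_brackets_commute[OF f_closed _ _ ff _ * that] c corner_closed[OF c]
    by (simp add: cornerD c_def)
qed (use a corner_closed in \<open>auto simp: mult.assoc\<close>)

end

lemmas (in peirce_lie) phi_fp = peirce_lie.phi_pf[OF swapped_lie]
lemmas (in peirce_lie) phi_ff_diagonal = peirce_lie.phi_pp_diagonal[OF swapped_lie]

context peirce_lie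
begin

text \<open>The element \<open>z\<close> with \<open>z f = f \<phi>(a) f\<close> is unique, so an arbitrary choice depends linearly on
\<open>a\<close>.\<close>
lemma ex_central_part:
  "\<exists>g. \<forall>x\<in>A. g x \<in> Z \<and> g x * f = f * \<phi> (p * x * p) * f"
  using phi_pp_lift[OF compress_corner(1)] by (intro bchoice) blast

lemma central_part_linear:
  assumes g: "\<forall>x\<in>A. g x \<in> Z \<and> g x * f = f * \<phi> (p * x * p) * f"
  shows "x \<in> A \<Longrightarrow> y \<in> A \<Longrightarrow> g (x + y) = g x + g y" "x \<in> A \<Longrightarrow> g (c *\<^sub>C x) = c *\<^sub>C g x"
    "x \<in> A \<Longrightarrow> p * x * p = 0 \<Longrightarrow> g x = 0"
proof -
  show "g (x + y) = g x + g y" if "x \<in> A" "y \<in> A"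
  proof -
    have "p * (x + y) * p = p * x * p + p * y * p" by (simp add: algebra_simps)
    then have "(g (x + y) - (g x + g y)) * f = 0"
      using that g by (simp add: left_diff_distrib distrib_right distrib_left phi_add)
    moreover have "g (x + y) - (g x + g y) \<in> Z" using that g by (intro Z_ops) auto
    ultimately have "g (x + y) - (g x + g y) = 0" by (rule Z_zero(1)[rotated])
    then show ?thesis by simp
  qed
  show "g (c *\<^sub>C x) = c *\<^sub>C g x" if "x \<in> A"
  proof -
    have "p * (c *\<^sub>C x) * p = c *\<^sub>C (p * x * p)" by (simp add: scale_left scale_right)
    then have "(g (c *\<^sub>C x) - c *\<^sub>C g x) * f = 0"
      using that g by (simp add: left_diff_distrib phi_scale scale_left scale_right)
    moreover have "g (c *\<^sub>C x) - c *\<^sub>C g x \<in> Z" using that g by (intro Z_ops) auto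
    ultimately have "g (c *\<^sub>C x) - c *\<^sub>C g x = 0" by (rule Z_zero(1)[rotated])
    then show ?thesis by simp
  qed
  show "g x = 0" if "x \<in> A" "p * x * p = 0"
    by (rule Z_zero(1)) (use that g in auto)
qed

text \<open>The central part of \<open>x\<close> collects what \<open>\<phi> (p x p)\<close> does in \<open>fAf\<close> and what \<open>\<phi> (f x f)\<close> does in
\<open>pAp\<close>. It is zero off the diagonal and invisible to brackets, so \<open>\<phi> - \<tau>\<close> inherits the
bracket identities of \<open>\<phi>\<close> and now preserves the corners.\<close>
lemma splits_phi: "splits \<phi>"
proof -
  interpret swap: peirce_lie A f p \<phi> k by (rule swapped_lie)
  obtain g where g: "\<forall>x\<in>A. g x \<in> Z \<and> g x * f = f * \<phi> (p * x * p) * f"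
    using ex_central_part by blast
  obtain g' where g': "\<forall>x\<in>A. g' x \<in> Z \<and> g' x * p = p * \<phi> (f * x * f) * p"
    using swap.ex_central_part by blast
  note gl = central_part_linear[OF g] swap.central_part_linear[OF g']
  define \<tau> where "\<tau> x = g x + g' x" for x
  define h where "h x = \<phi> x - \<tau> x" for x
  have tau_Z: "\<tau> x \<in> Z" if "x \<in> A" for x using that g g' Z_ops by (simp add: \<tau>_def)
  have tau_add: "\<tau> (x + y) = \<tau> x + \<tau> y" if "x \<in> A" "y \<in> A" for x y
    using that gl by (simp add: \<tau>_def)
  have tau_scale: "\<tau> (c *\<^sub>C x) = c *\<^sub>C \<tau> x" if "x \<in> A" for x c
    using that gl by (simp add: \<tau>_def scaleC_add_right)
  have tau_off: "\<tau> x = 0" if "x \<in> A" "off_diag x = x" for x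
  proof -
    have "p * off_diag x * p = 0" "f * off_diag x * f = 0" by (simp_all add: off_diag_def algebra_simps)
    then show ?thesis using gl that by (simp add: \<tau>_def)
  qed
  have h_off: "h x = \<phi> x" if "x \<in> A" "off_diag x = x" for x using tau_off[OF that] by (simp add: h_def)
  have lie_h: "\<lbrace>h x, y\<rbrace> = \<lbrace>\<phi> x, y\<rbrace>" "\<lbrace>y, h x\<rbrace> = \<lbrace>y, \<phi> x\<rbrace>" if "x \<in> A" "y \<in> A" for x y
    using Z_commute[OF tau_Z[OF that(1)] that(2)] by (simp_all add: lie_bracket_def h_def algebra_simps)
  have off_closed: "off_diag x \<in> A" if "x \<in> A" for x using that by (simp add: off_diag_def)
  interpret graded_lie A p f h
  proof unfold_locales
    show "h (x + y) = h x + h y" if "x \<in> A" "y \<in> A" for x y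
      using that by (simp add: h_def phi_add tau_add)
    show "h x \<in> corner p f" if "x \<in> corner p f" for x
      using h_off phi_pf[OF that] off_corner(1)[OF that] corner_closed[OF that] by simp
    show "h x \<in> corner f p" if "x \<in> corner f p" for x
      using h_off phi_fp[OF that] off_corner(2)[OF that] corner_closed[OF that] by simp
    show "h x \<in> corner p p" if x: "x \<in> corner p p" for x
    proof -
      have xA: "x \<in> A" using x corner_closed by blast
      have e: "p * x * p = x" "f * x * f = 0" using x by (simp_all add: cornerD)
      then have "h x = p * \<phi> x * p + g x * f - g x"
        using phi_pp_diagonal[OF x] g xA gl(6)[OF xA] by (simp add: h_def \<tau>_def)
      moreover have "g x = p * g x * p + g x * f"
        using Z_commute[OF _ p_closed, of "g x"] g xA peirce_split(2)[of "g x"] by (simp add: mult.assoc add.commute)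
      ultimately have "h x = p * \<phi> x * p - p * g x * p" by (metis add_diff_cancel_right)
      then show ?thesis using compress_corner(1) corner_diff g xA by simp
    qed
    show "h x \<in> corner f f" if x: "x \<in> corner f f" for x
    proof -
      have xA: "x \<in> A" using x corner_closed by blast
      have e: "f * x * f = x" "p * x * p = 0" using x by (simp_all add: cornerD)
      then have "h x = f * \<phi> x * f + g' x * p - g' x"
        using phi_ff_diagonal[OF x] g' xA gl(3)[OF xA] by (simp add: h_def \<tau>_def)
      moreover have "g' x = f * g' x * f + g' x * p"
        using Z_commute[OF _ f_closed, of "g' x"] g' xA peirce_split(2)[of "g' x"] by (simp add: mult.assoc add.commute)
      ultimately have "h x = f * \<phi> x * f - f * g' x * f" by (metis add_diff_cancel_right)
      then show ?thesis using compress_corner(4) corner_diff g' xA by simp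
    qed
    show "h \<lbrace>\<lbrace>x, y\<rbrace>, p\<rbrace> = \<lbrace>\<lbrace>h x, y\<rbrace> + \<lbrace>x, h y\<rbrace>, p\<rbrace>" if "x \<in> A" "y \<in> A" for x y
      using h_off[OF _ off_bracket_p] phi_bracket[OF that] lie_h that by simp
    show "h (off_diag \<lbrace>\<lbrace>x, y\<rbrace>, z\<rbrace>) =
      off_diag (\<lbrace>\<lbrace>h x, y\<rbrace>, z\<rbrace> + \<lbrace>\<lbrace>x, h y\<rbrace>, z\<rbrace> + \<lbrace>\<lbrace>x, y\<rbrace>, h z\<rbrace>)" if "x \<in> A" "y \<in> A" "z \<in> A" for x y z
      using h_off[OF off_closed off_off] phi_triple[OF that] lie_h that by simp
  qed
  have "h (c *\<^sub>C x) = c *\<^sub>C h x" if "x \<in> A" for x c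
    using that by (simp add: h_def phi_scale tau_scale scaleC_diff_right)
  then have "clinear_map_on A A h" using h_closed h_add by (simp add: clinear_map_on_def)
  moreover have "clinear_map_on A Z \<tau>" using tau_Z tau_add tau_scale by (simp add: clinear_map_on_def)
  moreover have "\<phi> x = h x + \<tau> x" for x by (simp add: h_def)
  ultimately show ?thesis unfolding splits_def using leibniz by blast
qed

end

lemma (in semiprime_algebra) fold_deriv_derivation:
  assumes "\<And>x y. x \<in> A \<Longrightarrow> y \<in> A \<Longrightarrow> d \<lbrace>x, y\<rbrace> = \<lbrace>d x, y\<rbrace> + \<lbrace>x, d y\<rbrace>"
    and "x \<in> A" "set ys \<subseteq> A"
  shows "d (foldl lie_bracket x ys) = fold_deriv d x (d x) ys"
  using assms(2,3)
proof (induction ys arbitrary: x)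
  case (Cons y ys)
  then show ?case using assms(1)[of x y] by simp
qed simp

theorem (in peirce) lie_fold_derivation_splits:
  assumes \<phi>: "lie_fold_derivation k \<phi>" and k: "k \<ge> 1"
  shows "splits \<phi>"
proof -
  have \<phi>4: "lie_fold_derivation (4 * k) \<phi>"
    using lie_fold_derivation_double[OF lie_fold_derivation_double[OF \<phi>]] by simp
  note \<phi>D = \<phi>4[unfolded lie_fold_derivation_def clinear_map_on_def]
  have pA: "\<phi> p \<in> A" using \<phi>D by auto
  \<comment> \<open>chosen so that \<open>[p, t]\<close> is the off-diagonal part of \<open>\<phi> p\<close>\<close>
  define t where "t = p * \<phi> p * f - f * \<phi> p * p"
  have tA: "t \<in> A" using pA by (simp add: t_def)
  define d where "d x = \<lbrace>x, t\<rbrace>" for x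
  have d_lie: "d \<lbrace>x, y\<rbrace> = \<lbrace>d x, y\<rbrace> + \<lbrace>x, d y\<rbrace>" for x y
    by (simp add: d_def lie_bracket_def algebra_simps)
  have d_mult: "d (x * y) = d x * y + x * d y" for x y
    by (simp add: d_def lie_bracket_def algebra_simps)
  have d_add: "d (x + y) = d x + d y" for x y
    by (simp add: d_def lie_bracket_def algebra_simps)
  have d_scale: "d (c *\<^sub>C x) = c *\<^sub>C d x" for x c
    by (simp add: d_def lie_bracket_def scale_left scale_right scaleC_diff_right)
  have d_closed: "d x \<in> A" if "x \<in> A" for x using that tA by (simp add: d_def)
  define \<psi> where "\<psi> x = \<phi> x - d x" for x
  have "\<psi> (foldl lie_bracket x ys) = fold_deriv \<psi> x (\<psi> x) ys"
    if "x \<in> A" "set ys \<subseteq> A" "length ys = 4 * k" for x ys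
    using \<phi>D that fold_deriv_derivation[of d x ys] d_lie fold_deriv_diff[of \<phi> d x "\<phi> x" "d x" ys]
    by (simp add: \<psi>_def[abs_def])
  then have \<psi>: "lie_fold_derivation (4 * k) \<psi>"
    using \<phi>D d_closed d_add d_scale
    by (auto simp: lie_fold_derivation_def clinear_map_on_def \<psi>_def Pi_iff scaleC_diff_right)
  have "\<psi> p * p = p * \<psi> p"
  proof -
    have "p * \<psi> p * f = 0" "f * \<psi> p * p = 0"
      by (simp_all add: \<psi>_def d_def t_def lie_bracket_def algebra_simps)
    then have "\<psi> p = p * \<psi> p * p + f * \<psi> p * f" using peirce_sum[of "\<psi> p"] by simp
    moreover have "(p * \<psi> p * p + f * \<psi> p * f) * p = p * (p * \<psi> p * p + f * \<psi> p * f)"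
      by (simp add: algebra_simps)
    ultimately show ?thesis by metis
  qed
  then interpret lie: peirce_lie A p f \<psi> "4 * k"
    by unfold_locales (use \<psi> k in auto)
  obtain h \<tau> where h: "h \<in> A \<rightarrow> A" "\<forall>x\<in>A. \<forall>y\<in>A. h (x + y) = h x + h y" "\<forall>c. \<forall>x\<in>A. h (c *\<^sub>C x) = c *\<^sub>C h x"
    "\<forall>x\<in>A. \<forall>y\<in>A. h (x * y) = h x * y + x * h y"
    and \<tau>: "\<tau> \<in> A \<rightarrow> Z" "\<forall>x\<in>A. \<forall>y\<in>A. \<tau> (x + y) = \<tau> x + \<tau> y" "\<forall>c. \<forall>x\<in>A. \<tau> (c *\<^sub>C x) = c *\<^sub>C \<tau> x"
    and sum: "\<forall>x\<in>A. \<psi> x = h x + \<tau> x"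
    using lie.splits_phi[unfolded splits_def clinear_map_on_def] by blast
  show ?thesis
    unfolding splits_def clinear_map_on_def
  proof (intro exI conjI)
    show "(\<lambda>x. h x + d x) \<in> A \<rightarrow> A" using h d_closed by auto
    show "\<forall>x\<in>A. \<forall>y\<in>A. h (x + y) + d (x + y) = h x + d x + (h y + d y)" using h d_add by simp
    show "\<forall>c. \<forall>x\<in>A. h (c *\<^sub>C x) + d (c *\<^sub>C x) = c *\<^sub>C (h x + d x)"
      using h d_scale by (simp add: scaleC_add_right)
    show "\<forall>x\<in>A. \<forall>y\<in>A. h (x * y) + d (x * y) = (h x + d x) * y + x * (h y + d y)"
      using h d_mult by (simp add: algebra_simps)
    show "\<forall>x\<in>A. \<phi> x = h x + d x + \<tau> x" using sum by (simp add: \<psi>_def algebra_simps)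
  qed (use \<tau> in auto)
qed

section \<open>Iterated brackets of indexed families\<close>

lemma lie_poly_cong: "(\<And>i. i \<in> {1..n} \<Longrightarrow> x i = y i) \<Longrightarrow> lie_poly n x = lie_poly n y"
  by (induction n x rule: lie_poly.induct) auto

lemma lie_poly_foldl: "lie_poly (Suc k) x = foldl lie_bracket (x 1) (map x [2..<Suc (Suc k)])"
proof (induction k)
  case (Suc k)
  have "[2..<Suc (Suc (Suc k))] = [2..<Suc (Suc k)] @ [Suc (Suc k)]" by simp
  then show ?case using Suc by simp
qed simp

lemma sum_lie_poly_fold_deriv:
  "(\<Sum>i=1..Suc k. lie_poly (Suc k) (x(i := \<phi> (x i)))) =
    fold_deriv \<phi> (x 1) (\<phi> (x 1)) (map x [2..<Suc (Suc k)])"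
proof (induction k)
  case (Suc k)
  define n where "n = Suc k"
  have *: "[2..<Suc (Suc (Suc k))] = [2..<Suc (Suc k)] @ [Suc (Suc k)]" by simp
  have "(\<Sum>i=1..n. lie_poly (Suc n) (x(i := \<phi> (x i)))) =
    (\<Sum>i=1..n. \<lbrace>lie_poly n (x(i := \<phi> (x i))), x (Suc n)\<rbrace>)"
    by (intro sum.cong) (auto simp: n_def)
  also have "\<dots> = \<lbrace>\<Sum>i=1..n. lie_poly n (x(i := \<phi> (x i))), x (Suc n)\<rbrace>"
    by (simp add: lie_bracket_def sum_subtractf sum_distrib_left sum_distrib_right)
  finally have 1: "(\<Sum>i=1..n. lie_poly (Suc n) (x(i := \<phi> (x i)))) =
     \<lbrace>\<Sum>i=1..n. lie_poly n (x(i := \<phi> (x i))), x (Suc n)\<rbrace>" .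
  have 2: "lie_poly (Suc n) (x(Suc n := \<phi> (x (Suc n)))) = \<lbrace>lie_poly n x, \<phi> (x (Suc n))\<rbrace>"
    using lie_poly_cong[of n "x(Suc n := \<phi> (x (Suc n)))" x] by (simp add: n_def)
  have "(\<Sum>i=1..Suc n. lie_poly (Suc n) (x(i := \<phi> (x i)))) =
    (\<Sum>i=1..n. lie_poly (Suc n) (x(i := \<phi> (x i)))) + lie_poly (Suc n) (x(Suc n := \<phi> (x (Suc n))))"
    by (rule sum.cl_ivl_Suc[THEN trans]) (simp only: if_False n_def, simp)
  also have "\<dots> = \<lbrace>fold_deriv \<phi> (x 1) (\<phi> (x 1)) (map x [2..<Suc n]), x (Suc n)\<rbrace> + \<lbrace>lie_poly n x, \<phi> (x (Suc n))\<rbrace>"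
    unfolding 1 2 unfolding n_def Suc ..
  also have "\<dots> = fold_deriv \<phi> (x 1) (\<phi> (x 1)) (map x [2..<Suc (Suc n)])"
    unfolding n_def * by (simp only: map_append fold_deriv_append lie_poly_foldl) (simp del: upt_Suc)
  finally show ?case unfolding n_def .
qed simp

section \<open>Operators, adjoints and orthogonal projections\<close>

notation op_apply (infixr \<open>\<cdot>\<close> 75)

lemma op_eqI: "(\<And>v. S \<cdot> v = T \<cdot> v) \<Longrightarrow> S = T"
  by (simp add: op_apply_inject[symmetric] fun_eq_iff)

lemma op_simps [simp]:
  "(S + T) \<cdot> v = S \<cdot> v + T \<cdot> v" "(S - T) \<cdot> v = S \<cdot> v - T \<cdot> v" "(- T) \<cdot> v = - (T \<cdot> v)"
  "(S * T) \<cdot> v = S \<cdot> T \<cdot> v" "0 \<cdot> v = 0" "1 \<cdot> v = v" "(c *\<^sub>C T) \<cdot> v = c *\<^sub>C (T \<cdot> v)"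
  by (transfer; simp)+

lemma bounded_linear_op: "bounded_linear (op_apply T)"
  using op_apply[of T] by simp

lemma op_scaleC: "T \<cdot> (c *\<^sub>C v) = c *\<^sub>C (T \<cdot> v)"
  using op_apply[of T] by simp

lemmas op_linear = linear_simps[OF bounded_linear_op]

lemma bounded_opI:
  assumes "bounded_linear g" "\<And>c x. g (c *\<^sub>C x) = c *\<^sub>C g x"
  obtains T where "\<And>v. T \<cdot> v = g v"
  using that[of "Bounded_Op g"] assms Bounded_Op_inverse[of g] by simp

lemma scaleC_mult_left: "(c *\<^sub>C S) * T = c *\<^sub>C (S * (T::'h::chilbert_space bounded_op))"
  and scaleC_mult_right: "S * (c *\<^sub>C T) = c *\<^sub>C (S * (T::'h::chilbert_space bounded_op))"
  by (rule op_eqI; simp add: op_scaleC)+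

text \<open>The imaginary part of \<open>cinner a b\<close> is the real inner product of \<open>- \<i> a\<close> and \<open>b\<close>, so for
complex-linear operators the real adjoint relation implies the complex one.\<close>
lemma is_adjoint_iff: "is_adjoint S T \<longleftrightarrow> (\<forall>x y. inner (T \<cdot> x) y = inner x (S \<cdot> y))"
proof
  assume r: "\<forall>x y. inner (T \<cdot> x) y = inner x (S \<cdot> y)"
  have im: "Im (cinner a b) = inner ((- \<i>) *\<^sub>C a) b" for a b :: 'a
    by (simp add: inner_eq_Re_cinner cinner_scaleC_left)
  show "is_adjoint S T"
    unfolding is_adjoint_def
  proof (intro allI complex_eqI)
    fix x y
    show "Re (cinner (T \<cdot> x) y) = Re (cinner x (S \<cdot> y))"
      using r by (simp flip: inner_eq_Re_cinner)
    show "Im (cinner (T \<cdot> x) y) = Im (cinner x (S \<cdot> y))"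
      using r by (simp only: im op_scaleC[symmetric])
  qed
qed (simp add: is_adjoint_def inner_eq_Re_cinner)

lemma is_adjoint_sym: "is_adjoint S T \<Longrightarrow> is_adjoint T S"
  unfolding is_adjoint_iff by (metis inner_commute)

lemma is_adjoint_unique: "is_adjoint S T \<Longrightarrow> is_adjoint S' T \<Longrightarrow> S = S'"
  unfolding is_adjoint_iff by (rule op_eqI) (metis vector_eq_ldot)

lemma is_adjoint_mult: "is_adjoint S T \<Longrightarrow> is_adjoint S' T' \<Longrightarrow> is_adjoint (S' * S) (T * T')"
  by (simp add: is_adjoint_iff)

lemma is_adjoint_add: "is_adjoint S T \<Longrightarrow> is_adjoint S' T' \<Longrightarrow> is_adjoint (S + S') (T + T')"
  and is_adjoint_diff: "is_adjoint S T \<Longrightarrow> is_adjoint S' T' \<Longrightarrow> is_adjoint (S - S') (T - T')"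
  by (simp_all add: is_adjoint_iff inner_add_left inner_add_right inner_diff_left inner_diff_right)

lemma is_adjoint_scaleC: "is_adjoint S T \<Longrightarrow> is_adjoint (cnj c *\<^sub>C S) (c *\<^sub>C T)"
  by (simp add: is_adjoint_def cinner_scaleC_left cinner_scaleC_right)

lemma is_adjoint_01 [simp]: "is_adjoint 1 1" "is_adjoint 0 0"
  by (simp_all add: is_adjoint_iff)

text \<open>The projection theorem: a sequence in \<open>R\<close> that minimises the distance to \<open>v\<close> is Cauchy by
the parallelogram law.\<close>
lemma nearest_point_exists:
  fixes R :: "'h::{real_inner,complete_space} set"
  assumes cl: "closed R" and sub: "subspace R"
  shows "\<exists>a\<in>R. \<forall>r\<in>R. inner (v - a) r = 0"
proof -
  define f where "f r = (norm (v - r))\<^sup>2" for r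
  define d where "d = Inf (f ` R)"
  have ne: "f ` R \<noteq> {}" using subspace_0[OF sub] by blast
  have bdd: "bdd_below (f ` R)" by (rule bdd_belowI[of _ 0]) (auto simp: f_def)
  have d_le: "d \<le> f r" if "r \<in> R" for r using that bdd by (auto simp: d_def intro: cInf_lower)
  have "\<exists>r\<in>R. f r < d + 1 / real (Suc n)" for n
    using cInf_lessD[OF ne, of "d + 1 / real (Suc n)"] by (auto simp: d_def)
  then obtain r where r: "\<And>n. r n \<in> R" "\<And>n. f (r n) < d + 1 / real (Suc n)" by metis
  have par: "(norm (x - y))\<^sup>2 = 2 * f x + 2 * f y - 4 * f ((1/2) *\<^sub>R (x + y))" for x y
  proof -
    have "v - (1/2) *\<^sub>R (x + y) = (1/2) *\<^sub>R ((v - x) + (v - y))" by (simp add: algebra_simps flip: scaleR_2)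
    moreover have "x - y = (v - y) - (v - x)" by simp
    ultimately show ?thesis
      unfolding f_def power2_norm_eq_inner by (simp only:) (simp add: algebra_simps inner_commute)
  qed
  have dist: "(norm (r m - r n))\<^sup>2 \<le> 2 / real (Suc m) + 2 / real (Suc n)" for m n
  proof -
    have "d \<le> f ((1/2) *\<^sub>R (r m + r n))"
      using sub r by (intro d_le) (auto simp: subspace_def)
    then show ?thesis using par[of "r m" "r n"] r(2)[of m] r(2)[of n] by simp
  qed
  have "Cauchy r"
  proof (rule metric_CauchyI)
    fix e :: real assume e: "e > 0"
    obtain N where N: "4 / e\<^sup>2 < real N" using reals_Archimedean2 by blast
    have "dist (r m) (r n) < e" if "m \<ge> N" "n \<ge> N" for m n
    proof -
      have "4 < real N * e\<^sup>2" using N e by (simp add: field_simps)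
      then have N0: "4 / real (Suc N) < e\<^sup>2" using e by (simp add: field_simps) (smt (verit) zero_less_power)
      have "2 / real (Suc m) \<le> 2 / real (Suc N)" "2 / real (Suc n) \<le> 2 / real (Suc N)"
        using that by (auto intro!: divide_left_mono)
      then have "(norm (r m - r n))\<^sup>2 < e\<^sup>2" using dist[of m n] N0 by linarith
      then show ?thesis using e by (simp add: dist_norm power2_less_imp_less)
    qed
    then show "\<exists>M. \<forall>m\<ge>M. \<forall>n\<ge>M. dist (r m) (r n) < e" by blast
  qed
  then obtain a where a: "r \<longlonglongrightarrow> a" using Cauchy_convergent convergent_def by blast
  have aR: "a \<in> R" using closed_sequentially[OF cl _ a] r(1) by blast
  have "(\<lambda>n. f (r n)) \<longlonglongrightarrow> f a" unfolding f_def by (intro tendsto_intros a)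
  moreover have "(\<lambda>n. d + 1 / real (Suc n)) \<longlonglongrightarrow> d + 0"
    by (intro tendsto_intros LIMSEQ_Suc lim_1_over_n)
  ultimately have fa: "f a \<le> d" using r(2) LIMSEQ_le[of "\<lambda>n. f (r n)" "f a" "\<lambda>n. d + 1 / real (Suc n)" "d + 0"]
    by (auto intro: less_imp_le)
  show ?thesis
  proof (intro bexI[OF _ aR] ballI)
    fix s assume s: "s \<in> R"
    define c where "c = inner (v - a) s"
    show "inner (v - a) s = 0"
    proof (cases "s = 0")
      case False
      \<comment> \<open>the minimiser of the quadratic \<open>t \<mapsto> f (a + t s)\<close>\<close>
      define t where "t = c / inner s s"
      have "a + t *\<^sub>R s \<in> R" using sub aR s by (auto simp: subspace_def)
      then have "f a \<le> f (a + t *\<^sub>R s)" using d_le fa by (meson order_trans)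
      also have "f (a + t *\<^sub>R s) = f a - 2 * t * c + t * t * inner s s"
        unfolding f_def power2_norm_eq_inner c_def by (simp add: algebra_simps inner_commute)
      also have "t * t * inner s s = t * c" using False by (simp add: t_def)
      finally have "c * t \<le> 0" by simp
      moreover have pos: "inner s s > 0" using False by simp
      ultimately have "c * c \<le> 0" unfolding t_def times_divide_eq_right pos_divide_le_eq[OF pos] by simp
      then show ?thesis unfolding c_def[symmetric] by (auto simp: mult_le_0_iff)
    qed simp
  qed
qed

lemma subspace_closure:
  fixes S :: "'a::real_normed_vector set"
  assumes S: "subspace S" shows "subspace (closure S)"
  unfolding subspace_def
proof (intro conjI ballI allI)
  show "0 \<in> closure S" using subspace_0[OF S] closure_subset by blast
  fix x c assume x: "x \<in> closure S"
  then obtain u where u: "\<And>n. u n \<in> S" "u \<longlonglongrightarrow> x" unfolding closure_sequential by blast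
  have "(\<lambda>n. c *\<^sub>R u n) \<longlonglongrightarrow> c *\<^sub>R x" by (intro tendsto_intros u)
  then show "c *\<^sub>R x \<in> closure S"
    unfolding closure_sequential using u(1) S by (intro exI[of _ "\<lambda>n. c *\<^sub>R u n"]) (auto simp: subspace_scale)
  fix y assume y: "y \<in> closure S"
  then obtain v where v: "\<And>n. v n \<in> S" "v \<longlonglongrightarrow> y" unfolding closure_sequential by blast
  have "(\<lambda>n. u n + v n) \<longlonglongrightarrow> x + y" by (intro tendsto_intros u v)
  then show "x + y \<in> closure S"
    unfolding closure_sequential using u(1) v(1) S by (intro exI[of _ "\<lambda>n. u n + v n"]) (auto simp: subspace_add)
qed

lemma projection_onto:
  fixes R :: "'h::chilbert_space set"
  assumes cl: "closed R" and sub: "subspace R" and cx: "\<And>c x. x \<in> R \<Longrightarrow> c *\<^sub>C x \<in> R"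
  obtains P where "projection P" "\<And>v. P \<cdot> v \<in> R" "\<And>v a. a \<in> R \<Longrightarrow> (\<And>r. r \<in> R \<Longrightarrow> inner (v - a) r = 0) \<Longrightarrow> P \<cdot> v = a"
    "\<And>v r. r \<in> R \<Longrightarrow> inner (v - P \<cdot> v) r = 0"
proof -
  obtain q where q: "\<And>v. q v \<in> R" "\<And>v r. r \<in> R \<Longrightarrow> inner (v - q v) r = 0"
    using nearest_point_exists[OF cl sub] by metis
  have uniq: "q v = a" if a: "a \<in> R" "\<And>r. r \<in> R \<Longrightarrow> inner (v - a) r = 0" for v a
  proof -
    have r: "q v - a \<in> R" using q a sub by (simp add: subspace_diff)
    have "inner (q v - a) (q v - a) = inner (v - a) (q v - a) - inner (v - q v) (q v - a)"
      by (simp add: inner_diff_left)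
    also have "\<dots> = 0" using q(2)[OF r] a(2)[OF r] by simp
    finally show ?thesis by simp
  qed
  have cx_orth: "inner (c *\<^sub>C x) r = 0" if "\<And>r. r \<in> R \<Longrightarrow> inner x r = 0" "r \<in> R" for c x r
  proof -
    have "inner (c *\<^sub>C x) r = inner x (cnj c *\<^sub>C r)"
      by (simp add: inner_eq_Re_cinner cinner_scaleC_left cinner_scaleC_right)
    then show ?thesis using that cx by simp
  qed
  have ip: "inner (q v) r = inner v r" if "r \<in> R" for v r
    using q(2)[OF that, of v] by (simp only: inner_diff_left right_minus_eq)
  have "bounded_linear q"
  proof (rule bounded_linear_intro[where K = 1])
    show "q (x + y) = q x + q y" for x y
      by (intro uniq) (auto simp: subspace_add[OF sub] q(1) ip inner_add_left inner_diff_left)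
    show "q (c *\<^sub>R x) = c *\<^sub>R q x" for c x
      by (intro uniq) (auto simp: subspace_scale[OF sub] q(1) ip inner_diff_left)
    show "norm (q x) \<le> norm x * 1" for x
    proof -
      have "norm (q x) * norm (q x) = inner x (q x)"
        using ip[OF q(1), of x x] by (simp add: dot_square_norm power2_eq_square)
      also have "\<dots> \<le> norm x * norm (q x)" by (rule norm_cauchy_schwarz)
      finally show ?thesis by (cases "q x = 0") auto
    qed
  qed
  moreover have "q (c *\<^sub>C x) = c *\<^sub>C q x" for c x
  proof (rule uniq)
    show "inner (c *\<^sub>C x - c *\<^sub>C q x) r = 0" if "r \<in> R" for r
      using cx_orth[of "x - q x" r c] q(2) that by (simp add: scaleC_diff_right)
  qed (use q cx in auto)
  ultimately obtain P where P: "\<And>v. P \<cdot> v = q v" using bounded_opI by blast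
  have "inner (q x) y = inner x (q y)" for x y
    using ip[OF q(1), of x y] ip[OF q(1), of y x] by (simp add: inner_commute)
  then have "is_adjoint P P" by (simp add: is_adjoint_iff P)
  moreover have "P * P = P"
    by (intro op_eqI) (simp add: P, intro uniq, auto simp: q(1))
  ultimately have "projection P" by (simp add: projection_def)
  then show ?thesis by (rule that) (use q uniq in \<open>auto simp only: P\<close>)
qed

section \<open>Annihilators in a von Neumann algebra\<close>

locale vn_algebra =
  fixes M :: "'h::chilbert_space bounded_op set"
  assumes vn: "von_neumann_algebra M"
begin

lemma M_zero [simp, intro]: "0 \<in> M"
  and M_add [simp, intro]: "S \<in> M \<Longrightarrow> T \<in> M \<Longrightarrow> S + T \<in> M"
  and M_scaleC [simp, intro]: "T \<in> M \<Longrightarrow> c *\<^sub>C T \<in> M"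
  and M_mult [simp, intro]: "S \<in> M \<Longrightarrow> T \<in> M \<Longrightarrow> S * T \<in> M"
  and M_adjoint: "T \<in> M \<Longrightarrow> \<exists>S\<in>M. is_adjoint S T"
  using vn by (auto simp: von_neumann_algebra_def star_subalgebra_def)

lemma M_commutantI: "(\<And>S. S \<in> commutant M \<Longrightarrow> T * S = S * T) \<Longrightarrow> T \<in> M"
  using vn by (auto simp: von_neumann_algebra_def commutant_def)

lemma commutantD: "S \<in> commutant M \<Longrightarrow> T \<in> M \<Longrightarrow> S * T = T * S"
  by (auto simp: commutant_def)

lemma M_one [simp, intro]: "1 \<in> M"
  by (rule M_commutantI) simp

lemma M_diff [simp, intro]: assumes "S \<in> M" "T \<in> M" shows "S - T \<in> M"
proof -
  have "S - T = S + (-1) *\<^sub>C T"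
  proof (rule op_eqI)
    fix v
    have "(-1) *\<^sub>C x = - x" for x :: 'h
      using scaleR_scaleC[of "-1" x] by simp
    then show "(S - T) \<cdot> v = (S + (-1) *\<^sub>C T) \<cdot> v" by simp
  qed
  then show ?thesis using assms by (simp only: M_add M_scaleC)
qed

text \<open>The common kernel of \<open>S\<close> is the orthogonal complement of the closed span \<open>R\<close> of the ranges
of the adjoints of \<open>S\<close>. The commutant leaves both \<open>R\<close> and the common kernel invariant, so it
commutes with the projection onto \<open>R\<close>, which therefore belongs to \<open>M = M''\<close>.\<close>
lemma right_annihilator_projection:
  assumes S: "S \<subseteq> M"
  obtains e where "projection e" "e \<in> M" "\<And>x. (\<forall>s\<in>S. s * x = 0) \<longleftrightarrow> e * x = x"
proof -
  define X where "X = {t \<cdot> w | t w. t \<in> M \<and> (\<exists>s\<in>S. is_adjoint t s)}"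
  define R where "R = closure (span X)"
  have sub: "subspace R" by (simp add: R_def subspace_closure subspace_span)
  have cl: "closed R" by (simp add: R_def)
  have inv: "g x \<in> R" if g: "bounded_linear g" and gX: "\<And>x. x \<in> X \<Longrightarrow> g x \<in> X" and x: "x \<in> R" for g x
  proof -
    have "g ` span X \<subseteq> span X"
      using gX linear_span_image[OF bounded_linear.linear[OF g], of X]
      by (metis image_subsetI span_mono)
    then have "closure (g ` span X) \<subseteq> R" unfolding R_def by (rule closure_mono)
    then show ?thesis
      using closure_bounded_linear_image_subset[OF g, of "span X"] x by (auto simp: R_def)
  qed
  have cxR: "c *\<^sub>C x \<in> R" if "x \<in> R" for c x
  proof (rule inv[OF bounded_linear_scaleC _ that])
    fix x assume "x \<in> X" then show "c *\<^sub>C x \<in> X"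
      unfolding X_def by (force simp flip: op_scaleC)
  qed
  obtain P where P: "projection P" "\<And>v. P \<cdot> v \<in> R"
    "\<And>v a. a \<in> R \<Longrightarrow> (\<And>r. r \<in> R \<Longrightarrow> inner (v - a) r = 0) \<Longrightarrow> P \<cdot> v = a"
    "\<And>v r. r \<in> R \<Longrightarrow> inner (v - P \<cdot> v) r = 0"
    using projection_onto[OF cl sub cxR] by blast
  have XR: "X \<subseteq> R" unfolding R_def by (meson closure_subset span_superset subset_trans)
  have orth: "(\<forall>r\<in>R. inner u r = 0) \<longleftrightarrow> (\<forall>s\<in>S. s \<cdot> u = 0)" for u
  proof
    assume u: "\<forall>r\<in>R. inner u r = 0"
    show "\<forall>s\<in>S. s \<cdot> u = 0"
    proof
      fix s assume s: "s \<in> S"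
      then obtain t where t: "t \<in> M" "is_adjoint t s" using M_adjoint S by blast
      then have "t \<cdot> s \<cdot> u \<in> X" unfolding X_def using s by blast
      then have "inner u (t \<cdot> s \<cdot> u) = 0" using u XR by blast
      then have "inner (s \<cdot> u) (s \<cdot> u) = 0" using t(2) unfolding is_adjoint_iff by metis
      then show "s \<cdot> u = 0" by simp
    qed
  next
    assume u: "\<forall>s\<in>S. s \<cdot> u = 0"
    have "inner u x = 0" if "x \<in> X" for x
    proof -
      obtain t w s where "x = t \<cdot> w" "s \<in> S" "is_adjoint t s" using \<open>x \<in> X\<close> unfolding X_def by blast
      then show ?thesis using u unfolding is_adjoint_iff by (metis inner_zero_left)
    qed
    then have "X \<subseteq> {x. inner u x = 0}" by auto
    moreover have "subspace {x. inner u x = 0}" by (simp add: subspace_def inner_add_right)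
    moreover have "closed {x. inner u x = 0}" by (intro closed_Collect_eq continuous_intros)
    ultimately have "R \<subseteq> {x. inner u x = 0}"
      unfolding R_def by (intro closure_minimal span_minimal)
    then show "\<forall>r\<in>R. inner u r = 0" by auto
  qed
  have PM: "P \<in> M"
  proof (rule M_commutantI)
    fix T assume T: "T \<in> commutant M"
    have *: "T \<cdot> s \<cdot> v = s \<cdot> T \<cdot> v" if "s \<in> M" for s v
      using commutantD[OF T that] by (metis op_simps(4))
    show "P * T = T * P"
    proof (rule op_eqI)
      fix v
      have "P \<cdot> T \<cdot> v = T \<cdot> P \<cdot> v"
      proof (rule P(3))
        show "T \<cdot> P \<cdot> v \<in> R"
        proof (rule inv[OF bounded_linear_op _ P(2)])
          fix x assume "x \<in> X" then show "T \<cdot> x \<in> X"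
            unfolding X_def using * by blast
        qed
        have "\<forall>s\<in>S. s \<cdot> (v - P \<cdot> v) = 0" using orth P(4) by blast
        then have "\<forall>s\<in>S. s \<cdot> T \<cdot> (v - P \<cdot> v) = 0" using * S by (metis op_linear(3) subsetD)
        then have "\<forall>r\<in>R. inner (T \<cdot> (v - P \<cdot> v)) r = 0" using orth by blast
        then show "\<And>r. r \<in> R \<Longrightarrow> inner (T \<cdot> v - T \<cdot> P \<cdot> v) r = 0" by (simp add: op_linear)
      qed
      then show "(P * T) \<cdot> v = (T * P) \<cdot> v" by simp
    qed
  qed
  have pr: "projection (1 - P)"
    using P(1) by (auto simp: projection_def algebra_simps intro!: is_adjoint_diff)
  have "(\<forall>s\<in>S. s * x = 0) \<longleftrightarrow> (1 - P) * x = x" for x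
  proof
    assume a: "\<forall>s\<in>S. s * x = 0"
    have "P \<cdot> x \<cdot> v = 0" for v
    proof (rule P(3))
      have "\<forall>s\<in>S. s \<cdot> x \<cdot> v = 0" using a by (metis op_simps(4,5))
      then show "\<And>r. r \<in> R \<Longrightarrow> inner (x \<cdot> v - 0) r = 0" unfolding diff_zero using orth by blast
    qed (use subspace_0[OF sub] in auto)
    then show "(1 - P) * x = x" by (intro op_eqI) simp
  next
    assume a: "(1 - P) * x = x"
    show "\<forall>s\<in>S. s * x = 0"
    proof
      fix s assume s: "s \<in> S"
      have "s \<cdot> x \<cdot> v = 0" for v
      proof -
        have "x \<cdot> v = x \<cdot> v - P \<cdot> x \<cdot> v" using arg_cong[OF a, of "\<lambda>T. T \<cdot> v"] by simp
        moreover have "\<forall>s\<in>S. s \<cdot> (x \<cdot> v - P \<cdot> x \<cdot> v) = 0" using orth P(4) by blast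
        ultimately show ?thesis using s by metis
      qed
      then show "s * x = 0" by (intro op_eqI) simp
    qed
  qed
  then show ?thesis using that[of "1 - P"] PM pr by simp
qed

end

section \<open>Absolute values and sign projections\<close>

definition contraction :: "'h::chilbert_space bounded_op \<Rightarrow> bool"
  where "contraction T \<longleftrightarrow> (\<forall>v. norm (T \<cdot> v) \<le> norm v)"

lemma contractionD: "contraction T \<Longrightarrow> norm (T \<cdot> v) \<le> norm v"
  by (simp add: contraction_def)

text \<open>Completeness of the algebra of operators, in the form of pointwise limits of sequences with
summable increments.\<close>
lemma bounded_op_limit:
  fixes T :: "nat \<Rightarrow> 'h::chilbert_space bounded_op"
  assumes d: "summable d" "\<And>k. 0 \<le> d k"
    and T: "\<And>k v. norm (T (Suc k) \<cdot> v - T k \<cdot> v) \<le> d k * norm v"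
  obtains L where "\<And>v. (\<lambda>k. T k \<cdot> v) \<longlonglongrightarrow> L \<cdot> v"
proof -
  have tel: "(\<Sum>k<n. T (Suc k) \<cdot> v - T k \<cdot> v) = T n \<cdot> v - T 0 \<cdot> v" for n v
    by (rule sum_lessThan_telescope)
  have "convergent (\<lambda>n. T n \<cdot> v)" for v
  proof -
    have "summable (\<lambda>k. T (Suc k) \<cdot> v - T k \<cdot> v)"
      by (rule summable_comparison_test'[OF summable_mult2[OF d(1), of "norm v"]]) (rule T)
    then have "(\<lambda>n. \<Sum>k<n. T (Suc k) \<cdot> v - T k \<cdot> v) \<longlonglongrightarrow> (\<Sum>k. T (Suc k) \<cdot> v - T k \<cdot> v)"
      by (rule summable_LIMSEQ)
    then have "(\<lambda>n. T n \<cdot> v - T 0 \<cdot> v + T 0 \<cdot> v) \<longlonglongrightarrow> (\<Sum>k. T (Suc k) \<cdot> v - T k \<cdot> v) + T 0 \<cdot> v"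
      unfolding tel by (intro tendsto_intros)
    then show ?thesis by (auto simp: convergent_def)
  qed
  then obtain l where l: "\<And>v. (\<lambda>n. T n \<cdot> v) \<longlonglongrightarrow> l v"
    unfolding convergent_def by metis
  obtain K where K: "\<And>v. norm (T 0 \<cdot> v) \<le> norm v * K"
    using bounded_linear.bounded[OF bounded_linear_op] by blast
  have lim: "l v = w" if "(\<lambda>n. T n \<cdot> v) \<longlonglongrightarrow> w" for v w
    using LIMSEQ_unique[OF l that] .
  have "bounded_linear l"
  proof (rule bounded_linear_intro[where K = "K + suminf d"])
    show "l (v + w) = l v + l w" for v w
      by (rule lim) (simp add: op_linear tendsto_add l)
    show "l (c *\<^sub>R v) = c *\<^sub>R l v" for c v
      by (rule lim) (simp add: op_linear tendsto_scaleR l)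
    show "norm (l v) \<le> norm v * (K + suminf d)" for v
    proof (rule Lim_bounded[OF tendsto_norm[OF l]], intro allI impI)
      fix n
      have "norm (T n \<cdot> v) = norm (T 0 \<cdot> v + (\<Sum>k<n. T (Suc k) \<cdot> v - T k \<cdot> v))"
        by (simp add: tel)
      also have "\<dots> \<le> norm (T 0 \<cdot> v) + (\<Sum>k<n. d k * norm v)"
        by (intro norm_triangle_le add_left_mono sum_norm_le T)
      also have "\<dots> \<le> norm v * K + suminf d * norm v"
        unfolding sum_distrib_right[symmetric]
        by (intro add_mono K mult_right_mono sum_le_suminf d) (auto simp: d)
      finally show "norm (T n \<cdot> v) \<le> norm v * (K + suminf d)" by (simp add: algebra_simps)
    qed
  qed
  moreover have "l (c *\<^sub>C v) = c *\<^sub>C l v" for c v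
    by (rule lim) (simp add: op_scaleC bounded_linear.tendsto[OF bounded_linear_scaleC l])
  ultimately show ?thesis using bounded_opI[of l] l that by metis
qed

lemma limit_commute:
  assumes L: "\<And>v. (\<lambda>k. T k \<cdot> v) \<longlonglongrightarrow> L \<cdot> v" and S: "\<And>k. S * T k = T k * S"
  shows "S * L = L * S"
proof (rule op_eqI)
  fix v
  have "(\<lambda>k. S \<cdot> T k \<cdot> v) \<longlonglongrightarrow> S \<cdot> L \<cdot> v"
    by (rule bounded_linear.tendsto[OF bounded_linear_op L])
  moreover have "S \<cdot> T k \<cdot> v = T k \<cdot> S \<cdot> v" for k using S[of k] by (metis op_simps(4))
  ultimately have "(\<lambda>k. T k \<cdot> S \<cdot> v) \<longlonglongrightarrow> S \<cdot> L \<cdot> v" by simp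
  from LIMSEQ_unique[OF this L] show "(S * L) \<cdot> v = (L * S) \<cdot> v" by simp
qed

lemma limit_adjoint:
  assumes L: "\<And>v. (\<lambda>k. T k \<cdot> v) \<longlonglongrightarrow> L \<cdot> v" and S: "\<And>k. is_adjoint (T k) (T k)"
  shows "is_adjoint L L"
  unfolding is_adjoint_iff
proof (intro allI)
  fix v w
  have "(\<lambda>k. inner (T k \<cdot> v) w) \<longlonglongrightarrow> inner (L \<cdot> v) w" by (intro tendsto_intros L)
  moreover have "(\<lambda>k. inner v (T k \<cdot> w)) \<longlonglongrightarrow> inner v (L \<cdot> w)" by (intro tendsto_intros L)
  moreover have "inner (T k \<cdot> v) w = inner v (T k \<cdot> w)" for k using S by (simp add: is_adjoint_iff)
  ultimately show "inner (L \<cdot> v) w = inner v (L \<cdot> w)" using LIMSEQ_unique by simp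
qed

text \<open>The iteration \<open>y \<mapsto> (x + y\<^sup>2) / 2\<close> for \<open>1 - sqrt (1 - x)\<close>, and the same iteration for the
scalar \<open>x = 1\<close>, whose increments dominate those of the operator iteration. This controls the
limit even when the norm of \<open>x\<close> is \<open>1\<close>, where the iteration is not a strict contraction.\<close>
fun sqrt_bound :: "nat \<Rightarrow> real" where
  "sqrt_bound 0 = 0" | "sqrt_bound (Suc n) = (1 + (sqrt_bound n)\<^sup>2) / 2"

fun sqrt_iter :: "'h::chilbert_space bounded_op \<Rightarrow> nat \<Rightarrow> 'h bounded_op" where
  "sqrt_iter x 0 = 0" | "sqrt_iter x (Suc n) = (1/2) *\<^sub>C (x + sqrt_iter x n * sqrt_iter x n)"

lemma half_scaleC: "(1/2) *\<^sub>C (v::'h::complex_inner) = (1/2) *\<^sub>R v"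
  using scaleR_scaleC[of "1/2" v] by simp

lemma sqrt_bound_range: "0 \<le> sqrt_bound n \<and> sqrt_bound n \<le> 1"
proof (induction n)
  case (Suc n)
  then have "(sqrt_bound n)\<^sup>2 \<le> 1" by (simp add: power_le_one)
  then show ?case using zero_le_power2[of "sqrt_bound n"] by simp
qed simp

lemma sqrt_bound_mono: "sqrt_bound n \<le> sqrt_bound (Suc n)"
proof -
  have "0 \<le> (1 - sqrt_bound n)\<^sup>2" by simp
  then show ?thesis by (simp add: power2_diff)
qed

lemma sqrt_iter_bound:
  assumes "contraction x" shows "norm (sqrt_iter x n \<cdot> v) \<le> sqrt_bound n * norm v"
proof (induction n arbitrary: v)
  case (Suc n)
  have "norm (sqrt_iter x n \<cdot> sqrt_iter x n \<cdot> v) \<le> sqrt_bound n * (sqrt_bound n * norm v)"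
    using Suc[of "sqrt_iter x n \<cdot> v"] Suc[of v] sqrt_bound_range[of n]
    by (meson mult_left_mono order_trans)
  moreover have "norm (x \<cdot> v + sqrt_iter x n \<cdot> sqrt_iter x n \<cdot> v) \<le> norm (x \<cdot> v) + norm (sqrt_iter x n \<cdot> sqrt_iter x n \<cdot> v)"
    by (rule norm_triangle_ineq)
  ultimately have "norm (x \<cdot> v + sqrt_iter x n \<cdot> sqrt_iter x n \<cdot> v) \<le> norm v + sqrt_bound n * (sqrt_bound n * norm v)"
    using contractionD[OF assms, of v] by linarith
  moreover have "sqrt_iter x (Suc n) \<cdot> v = (1/2) *\<^sub>R (x \<cdot> v + sqrt_iter x n \<cdot> sqrt_iter x n \<cdot> v)"
    by (simp add: half_scaleC)
  moreover have "sqrt_bound (Suc n) * norm v = (1/2) * (norm v + sqrt_bound n * (sqrt_bound n * norm v))"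
    by (simp add: power2_eq_square algebra_simps)
  ultimately show ?case by simp
qed simp

lemma sqrt_iter_diff:
  assumes x: "contraction x"
  shows "norm (sqrt_iter x (Suc n) \<cdot> v - sqrt_iter x n \<cdot> v) \<le> (sqrt_bound (Suc n) - sqrt_bound n) * norm v"
proof (induction n arbitrary: v)
  case 0 then show ?case using contractionD[OF x, of v] by (simp add: half_scaleC)
next
  case (Suc n)
  define Y Z r s where "Y = sqrt_iter x (Suc n)" and "Z = sqrt_iter x n"
    and "r = sqrt_bound (Suc n)" and "s = sqrt_bound n"
  have rs: "0 \<le> r" "0 \<le> s" "s \<le> r" using sqrt_bound_range sqrt_bound_mono unfolding r_def s_def by blast+
  have IH: "norm (Y \<cdot> v - Z \<cdot> v) \<le> (r - s) * norm v" for v using Suc[of v] unfolding Y_def Z_def r_def s_def .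
  have bY: "norm (Y \<cdot> v) \<le> r * norm v" for v unfolding Y_def r_def by (rule sqrt_iter_bound[OF x])
  have bZ: "norm (Z \<cdot> v) \<le> s * norm v" for v unfolding Z_def s_def by (rule sqrt_iter_bound[OF x])
  have eq: "Y \<cdot> Y \<cdot> v - Z \<cdot> Z \<cdot> v = Y \<cdot> (Y \<cdot> v - Z \<cdot> v) + (Y \<cdot> Z \<cdot> v - Z \<cdot> Z \<cdot> v)"
    by (simp add: op_linear)
  have "norm (Y \<cdot> (Y \<cdot> v - Z \<cdot> v)) \<le> r * ((r - s) * norm v)"
    using bY[of "Y \<cdot> v - Z \<cdot> v"] IH[of v] rs by (meson mult_left_mono order_trans)
  moreover have "norm (Y \<cdot> Z \<cdot> v - Z \<cdot> Z \<cdot> v) \<le> (r - s) * (s * norm v)"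
    using IH[of "Z \<cdot> v"] bZ[of v] rs by (meson mult_left_mono order_trans diff_ge_0_iff_ge)
  ultimately have "norm (Y \<cdot> Y \<cdot> v - Z \<cdot> Z \<cdot> v) \<le> r * ((r - s) * norm v) + (r - s) * (s * norm v)"
    unfolding eq by (intro norm_triangle_le) linarith
  also have "\<dots> = (r\<^sup>2 - s\<^sup>2) * norm v" by (simp add: algebra_simps power2_eq_square)
  finally have b: "norm (Y \<cdot> Y \<cdot> v - Z \<cdot> Z \<cdot> v) \<le> (r\<^sup>2 - s\<^sup>2) * norm v" .
  have "sqrt_iter x (Suc (Suc n)) \<cdot> v - sqrt_iter x (Suc n) \<cdot> v = (1/2) *\<^sub>R (Y \<cdot> Y \<cdot> v - Z \<cdot> Z \<cdot> v)"
    unfolding Y_def Z_def sqrt_iter.simps(2)[of x "Suc n"]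
    by (simp add: half_scaleC algebra_simps)
  moreover have "sqrt_bound (Suc (Suc n)) - sqrt_bound (Suc n) = (1/2) * (r\<^sup>2 - s\<^sup>2)"
    unfolding r_def s_def sqrt_bound.simps(2)[of "Suc n"] by (simp add: field_simps)
  ultimately show ?case using b by (simp only: norm_scaleR)
qed

lemma sqrt_exists:
  fixes x :: "'h::chilbert_space bounded_op"
  assumes x: "contraction x" "is_adjoint x x"
  obtains s where "is_adjoint s s" "s * s = 1 - x" "\<And>v. 0 \<le> inner (s \<cdot> v) v"
    "\<And>T. T * x = x * T \<Longrightarrow> T * s = s * T"
proof -
  define Y where "Y = sqrt_iter x"
  have "summable (\<lambda>n. sqrt_bound (Suc n) - sqrt_bound n)"
  proof -
    have "incseq sqrt_bound" using sqrt_bound_mono by (rule incseq_SucI)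
    then obtain l where "sqrt_bound \<longlonglongrightarrow> l"
      using incseq_convergent[of sqrt_bound 1] sqrt_bound_range by blast
    then show ?thesis by (rule telescope_summable)
  qed
  then obtain L where L: "\<And>v. (\<lambda>n. Y n \<cdot> v) \<longlonglongrightarrow> L \<cdot> v"
    using bounded_op_limit[of "\<lambda>n. sqrt_bound (Suc n) - sqrt_bound n" Y] sqrt_bound_mono sqrt_iter_diff[OF x(1)]
    unfolding Y_def by (metis diff_ge_0_iff_ge)
  have Yc: "norm (Y n \<cdot> v) \<le> norm v" for n v
    using sqrt_iter_bound[OF x(1), of n v] sqrt_bound_range[of n] mult_right_mono[of "sqrt_bound n" 1 "norm v"]
    unfolding Y_def by simp
  have Lc: "norm (L \<cdot> v) \<le> norm v" for v
    by (rule Lim_bounded[OF tendsto_norm[OF L]]) (use Yc in blast)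
  have YY: "(\<lambda>n. Y n \<cdot> Y n \<cdot> v) \<longlonglongrightarrow> L \<cdot> L \<cdot> v" for v
  proof -
    have "(\<lambda>n. Y n \<cdot> (Y n \<cdot> v - L \<cdot> v)) \<longlonglongrightarrow> 0"
    proof (rule Lim_null_comparison)
      show "\<forall>\<^sub>F n in sequentially. norm (Y n \<cdot> (Y n \<cdot> v - L \<cdot> v)) \<le> norm (Y n \<cdot> v - L \<cdot> v)"
        using Yc by simp
      show "(\<lambda>n. norm (Y n \<cdot> v - L \<cdot> v)) \<longlonglongrightarrow> 0"
        using L[of v] by (simp add: tendsto_norm_zero_iff LIM_zero_iff)
    qed
    from tendsto_add[OF this L[of "L \<cdot> v"]] show ?thesis by (simp add: op_linear)
  qed
  have fixpoint: "L \<cdot> v = (1/2) *\<^sub>R (x \<cdot> v + L \<cdot> L \<cdot> v)" for v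
  proof -
    have "(\<lambda>n. (1/2) *\<^sub>R (x \<cdot> v + Y n \<cdot> Y n \<cdot> v)) \<longlonglongrightarrow> (1/2) *\<^sub>R (x \<cdot> v + L \<cdot> L \<cdot> v)"
      by (intro tendsto_intros YY)
    then have "(\<lambda>n. Y (Suc n) \<cdot> v) \<longlonglongrightarrow> (1/2) *\<^sub>R (x \<cdot> v + L \<cdot> L \<cdot> v)"
      by (simp add: Y_def half_scaleC)
    then show ?thesis using LIMSEQ_Suc[OF L] LIMSEQ_unique by blast
  qed
  have Ysa: "is_adjoint (Y n) (Y n)" for n
  proof (induction n)
    case (Suc n)
    then show ?case
      using is_adjoint_scaleC[OF is_adjoint_add[OF x(2) is_adjoint_mult[OF Suc Suc]], of "1/2"]
      by (simp add: Y_def)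
  qed (simp add: Y_def)
  have comm: "T * L = L * T" if T: "T * x = x * T" for T
  proof (rule limit_commute[OF L])
    show "T * Y n = Y n * T" for n
    proof (induction n)
      case (Suc n)
      have "T * (Y n * Y n) = Y n * Y n * T" using Suc by (metis mult.assoc)
      then show ?case using T by (simp add: Y_def scaleC_mult_left scaleC_mult_right algebra_simps)
    qed (simp add: Y_def)
  qed
  show ?thesis
  proof (rule that[of "1 - L"])
    show "is_adjoint (1 - L) (1 - L)" using limit_adjoint[OF L Ysa] by (intro is_adjoint_diff) auto
    show "(1 - L) * (1 - L) = 1 - x"
    proof (rule op_eqI)
      fix v
      have "L \<cdot> v + L \<cdot> v = x \<cdot> v + L \<cdot> L \<cdot> v"
        using arg_cong[OF fixpoint[of v], of "\<lambda>u. 2 *\<^sub>R u"] by (simp add: scaleR_2)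
      then show "((1 - L) * (1 - L)) \<cdot> v = (1 - x) \<cdot> v"
        by (simp add: op_linear algebra_simps)
    qed
    show "0 \<le> inner ((1 - L) \<cdot> v) v" for v
    proof -
      have "inner (L \<cdot> v) v \<le> norm (L \<cdot> v) * norm v" by (rule norm_cauchy_schwarz)
      also have "\<dots> \<le> norm v * norm v" by (intro mult_right_mono Lc) simp
      finally show ?thesis by (simp add: inner_diff_left dot_square_norm power2_eq_square)
    qed
    show "T * (1 - L) = (1 - L) * T" if "T * x = x * T" for T
      using comm[OF that] by (simp add: algebra_simps)
  qed
qed

text \<open>Apply the square root to \<open>1 - x = a\<^sup>2\<close>; here \<open>1 - a\<^sup>2\<close> is a contraction because
\<open>\<parallel>v - a\<^sup>2 v\<parallel>\<^sup>2 = \<parallel>v\<parallel>\<^sup>2 - 2 \<parallel>a v\<parallel>\<^sup>2 + \<parallel>a\<^sup>2 v\<parallel>\<^sup>2\<close>.\<close>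
lemma absolute_value_exists:
  fixes a :: "'h::chilbert_space bounded_op"
  assumes a: "contraction a" "is_adjoint a a"
  obtains b where "is_adjoint b b" "b * b = a * a" "contraction b" "\<And>v. 0 \<le> inner (b \<cdot> v) v"
    "\<And>T. T * a = a * T \<Longrightarrow> T * b = b * T"
proof -
  have sa: "inner (a \<cdot> v) w = inner v (a \<cdot> w)" for v w using a(2) by (simp add: is_adjoint_iff)
  have "contraction (1 - a * a)"
    unfolding contraction_def
  proof
    fix v
    have "(norm ((1 - a * a) \<cdot> v))\<^sup>2 = (norm v)\<^sup>2 - 2 * (norm (a \<cdot> v))\<^sup>2 + (norm (a \<cdot> a \<cdot> v))\<^sup>2"
      using sa[of "a \<cdot> v" v] sa[of v "a \<cdot> v"]
      by (simp add: power2_norm_eq_inner inner_diff_left inner_diff_right inner_commute)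
    also have "(norm (a \<cdot> a \<cdot> v))\<^sup>2 \<le> (norm (a \<cdot> v))\<^sup>2"
      using contractionD[OF a(1)] by (intro power_mono) auto
    finally have "(norm ((1 - a * a) \<cdot> v))\<^sup>2 \<le> (norm v)\<^sup>2" using zero_le_power2[of "norm (a \<cdot> v)"] by linarith
    then show "norm ((1 - a * a) \<cdot> v) \<le> norm v" by (rule power2_le_imp_le) simp
  qed
  moreover have "is_adjoint (1 - a * a) (1 - a * a)"
    using a(2) by (intro is_adjoint_diff is_adjoint_mult) auto
  ultimately obtain b where b: "is_adjoint b b" "b * b = 1 - (1 - a * a)" "\<And>v. 0 \<le> inner (b \<cdot> v) v"
    "\<And>T. T * (1 - a * a) = (1 - a * a) * T \<Longrightarrow> T * b = b * T"
    using sqrt_exists by blast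
  have bb: "b * b = a * a" using b(2) by simp
  have "contraction b"
    unfolding contraction_def
  proof
    fix v
    have "inner (b \<cdot> v) (b \<cdot> v) = inner ((b * b) \<cdot> v) v" using b(1) by (simp add: is_adjoint_iff)
    also have "\<dots> = inner (a \<cdot> v) (a \<cdot> v)" using sa[of "a \<cdot> v" v] by (simp add: bb)
    finally have "norm (b \<cdot> v) = norm (a \<cdot> v)" by (simp add: norm_eq_sqrt_inner)
    then show "norm (b \<cdot> v) \<le> norm v" using contractionD[OF a(1)] by simp
  qed
  moreover have "T * b = b * T" if "T * a = a * T" for T
  proof (rule b(4))
    have "T * (a * a) = a * a * T" using that by (metis mult.assoc)
    then show "T * (1 - a * a) = (1 - a * a) * T" by (simp add: algebra_simps)
  qed
  ultimately show ?thesis using that[of b] b bb by blast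
qed

context vn_algebra
begin

text \<open>With \<open>b = \<bar>a\<bar>\<close> let \<open>e\<close> be the projection onto the kernel of \<open>b - a\<close>. Since
\<open>(b - a) (b + a) = 0\<close>, the operator \<open>a\<close> equals \<open>b\<close> on the range of \<open>e\<close> and \<open>- b\<close> on its
complement, so \<open>a = b u\<close> with the symmetry \<open>u = 2 e - 1\<close>. Then \<open>2 a - u = (2 b - 1) u\<close>, and
\<open>2 b - 1\<close> is a contraction because \<open>0 \<le> b \<le> 1\<close>.\<close>
lemma sign_projection:
  assumes aM: "a \<in> M" and a: "contraction a" "is_adjoint a a"
  obtains e where "e \<in> M" "projection e" "\<And>T. T \<in> M \<Longrightarrow> T * a = a * T \<Longrightarrow> T * e = e * T"
    "contraction (2 *\<^sub>C a - (2 *\<^sub>C e - 1))"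
proof -
  obtain b where b: "is_adjoint b b" "b * b = a * a" "contraction b" "\<And>v. 0 \<le> inner (b \<cdot> v) v"
    "\<And>T. T * a = a * T \<Longrightarrow> T * b = b * T"
    using absolute_value_exists[OF a] by blast
  have bM: "b \<in> M"
  proof (rule M_commutantI)
    fix S assume "S \<in> commutant M"
    then have "S * a = a * S" using commutantD aM by blast
    then show "b * S = S * b" using b(5) by simp
  qed
  obtain e where e: "projection e" "e \<in> M" "\<And>x. (\<forall>s\<in>{b - a}. s * x = 0) \<longleftrightarrow> e * x = x"
    using right_annihilator_projection[of "{b - a}"] aM bM by auto
  have ee: "e * e = e" "is_adjoint e e" using e(1) by (auto simp: projection_def)
  have ae: "a * e = b * e" using e(3)[of e] ee by (simp add: algebra_simps)
  have comm: "T * e = e * T" if T: "T \<in> M" "T * a = a * T" for T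
  proof -
    have *: "e * (T * e) = T * e" if T: "T * a = a * T" for T
    proof -
      have "T * (b - a) = (b - a) * T" using b(5)[OF T] T by (simp add: algebra_simps)
      then have "(b - a) * (T * e) = T * ((b - a) * e)" by (metis mult.assoc)
      also have "\<dots> = 0" using ae by (simp add: left_diff_distrib)
      finally show ?thesis using e(3) by blast
    qed
    obtain T' where T': "T' \<in> M" "is_adjoint T' T" using M_adjoint T by blast
    have "is_adjoint (a * T') (T * a)" "is_adjoint (T' * a) (a * T)"
      using T' a(2) by (auto intro: is_adjoint_mult)
    then have "T' * a = a * T'" using T(2) is_adjoint_unique by metis
    then have "e * (T' * e) = T' * e" by (rule *)
    moreover have "is_adjoint (e * T * e) (e * (T' * e))" "is_adjoint (e * T) (T' * e)"
      using T'(2)[THEN is_adjoint_sym] ee(2) by (auto intro: is_adjoint_mult)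
    ultimately have "e * T * e = e * T" using is_adjoint_unique by metis
    then show ?thesis using *[OF T(2)] by (simp add: mult.assoc)
  qed
  have ab: "a * b = b * a" using b(5)[of a] by simp
  have "(b - a) * (b + a) = 0" using ab b(2) by (simp add: algebra_simps)
  then have "e * (b + a) = b + a" using e(3) by blast
  moreover have "a * e = e * a" "b * e = e * b" using comm aM bM ab by auto
  ultimately have be: "(b + a) * e = b + a" by (simp add: algebra_simps)
  define u where "u = 2 *\<^sub>C e - 1"
  have two: "2 *\<^sub>C x = x + x" for x :: "'h bounded_op"
    using scaleC_add_left[of 1 1 x] by (simp add: scaleC_one)
  have abu: "a = b * u"
    using be ae by (simp add: u_def two algebra_simps)
  have uu: "u * u = 1" "is_adjoint u u"
    using ee by (auto simp: u_def two algebra_simps intro!: is_adjoint_diff is_adjoint_add)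
  have un: "norm (u \<cdot> v) = norm v" for v
  proof -
    have "inner (u \<cdot> v) (u \<cdot> v) = inner ((u * u) \<cdot> v) v" using uu(2) by (simp add: is_adjoint_iff)
    then show ?thesis by (simp add: uu norm_eq_sqrt_inner)
  qed
  have "2 *\<^sub>C a - u = (b + b - 1) * u" by (simp add: two abu algebra_simps)
  moreover have "norm ((b + b - 1) \<cdot> w) \<le> norm w" for w
  proof -
    define y where "y = b \<cdot> w"
    have sa: "inner (b \<cdot> v) w = inner v (b \<cdot> w)" for v w using b(1) by (simp add: is_adjoint_iff)
    \<comment> \<open>positivity of \<open>b\<close> at \<open>w - b w\<close> gives \<open>b\<^sup>2 \<le> b\<close>\<close>
    have "0 \<le> inner (b \<cdot> (w - y)) (w - y)" by (rule b(4))
    also have "\<dots> = inner y w - 2 * inner y y + inner (b \<cdot> y) y"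
      using sa[of y w] by (simp add: y_def op_linear inner_diff_left inner_diff_right inner_commute)
    also have "inner (b \<cdot> y) y \<le> norm (b \<cdot> y) * norm y" by (rule norm_cauchy_schwarz)
    also have "\<dots> \<le> norm y * norm y" using contractionD[OF b(3)] by (intro mult_right_mono) auto
    finally have "inner y y \<le> inner y w" by (simp add: dot_square_norm power2_eq_square)
    moreover have "(norm (y + y - w))\<^sup>2 = 4 * inner y y - 4 * inner y w + (norm w)\<^sup>2"
      by (simp add: power2_norm_eq_inner inner_diff_left inner_diff_right inner_add_left inner_add_right inner_commute)
    ultimately have "(norm (y + y - w))\<^sup>2 \<le> (norm w)\<^sup>2" by simp
    then have "norm (y + y - w) \<le> norm w" by (rule power2_le_imp_le) simp
    then show ?thesis by (simp add: y_def)
  qed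
  ultimately have "contraction (2 *\<^sub>C a - u)" unfolding contraction_def by (metis op_simps(4) un)
  then show ?thesis using that[of e] e comm by (simp add: u_def)
qed

end

section \<open>Binary expansions and centres of corners\<close>

lemma norm_reflection:
  assumes "projection e" shows "norm ((2 *\<^sub>C e - 1) \<cdot> v) = norm v"
proof -
  have ee: "e \<cdot> e \<cdot> w = e \<cdot> w" for w
    using assms unfolding projection_def by (metis op_simps(4))
  have "inner (e \<cdot> v) (e \<cdot> v) = inner (e \<cdot> v) v"
    using assms ee[of v] unfolding projection_def is_adjoint_iff by metis
  moreover have "2 *\<^sub>C x = x + x" for x :: 'a
    using scaleC_add_left[of 1 1 x] by (simp add: scaleC_one)
  ultimately have "inner ((2 *\<^sub>C e - 1) \<cdot> v) ((2 *\<^sub>C e - 1) \<cdot> v) = inner v v"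
    by (simp add: inner_add_left inner_add_right inner_diff_left inner_diff_right inner_commute)
  then show ?thesis by (simp add: norm_eq_sqrt_inner)
qed

context vn_algebra
begin

text \<open>Applying the hypothesis to \<open>m\<close> and, after taking adjoints, to its adjoint gives
\<open>m e = e m e = e m\<close>.\<close>
lemma central_if_range_invariant:
  assumes e: "projection e" "e \<in> M" and inv: "\<And>m. m \<in> M \<Longrightarrow> e * (m * e) = m * e" and m: "m \<in> M"
  shows "e * m = m * e"
proof -
  obtain m' where m': "m' \<in> M" "is_adjoint m' m" using M_adjoint m by blast
  have "is_adjoint e e" using e(1) by (simp add: projection_def)
  then have "is_adjoint (e * m * e) (e * (m' * e))" "is_adjoint (e * m) (m' * e)"
    using m'(2)[THEN is_adjoint_sym] by (auto intro: is_adjoint_mult)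
  then have "e * m * e = e * m" using inv[OF m'(1)] is_adjoint_unique by metis
  then show ?thesis using inv[OF m] by (simp add: mult.assoc)
qed

text \<open>The right annihilator of the right ideal \<open>S M\<close> is invariant under left multiplication by
\<open>M\<close>, so the projection that generates it is central. Its complement is the central carrier
of \<open>S\<close>.\<close>
lemma ideal_annihilator:
  assumes S: "S \<subseteq> M"
  obtains z where "z \<in> center M" "projection z" "\<And>x. (\<forall>s\<in>S. \<forall>m\<in>M. s * m * x = 0) \<longleftrightarrow> z * x = x"
proof -
  define J where "J = {s * m | s m. s \<in> S \<and> m \<in> M}"
  have "J \<subseteq> M" using S by (auto simp: J_def)
  then obtain e where e: "projection e" "e \<in> M" "\<And>x. (\<forall>s\<in>J. s * x = 0) \<longleftrightarrow> e * x = x"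
    using right_annihilator_projection by blast
  have ex: "(\<forall>s\<in>S. \<forall>m\<in>M. s * m * x = 0) \<longleftrightarrow> e * x = x" for x
    unfolding e(3)[symmetric] J_def by blast
  have ee: "e * e = e" using e(1) by (simp add: projection_def)
  have "e * (m * e) = m * e" if m: "m \<in> M" for m
  proof -
    have "s * n * (m * e) = 0" if "s \<in> S" "n \<in> M" for s n
      using ex[of e] ee that m by (metis M_mult mult.assoc)
    then show ?thesis using ex[of "m * e"] by blast
  qed
  then have "e \<in> center M" using central_if_range_invariant e(1,2) by (auto simp: center_def)
  then show ?thesis using that e ex by blast
qed

text \<open>Iterate \<open>a \<mapsto> 2 a - (2 e - 1)\<close> with \<open>e\<close> the sign projection of \<open>a\<close>: all remainders are
contractions, and after \<open>n\<close> steps the remainder enters with the factor \<open>2\<^sup>-\<^sup>n\<close>.\<close>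
lemma binary_expansion:
  assumes "a \<in> M" "contraction a" "is_adjoint a a"
  obtains E where "\<And>k::nat. projection (E k)" "\<And>k. E k \<in> M" "\<And>k T. T \<in> M \<Longrightarrow> T * a = a * T \<Longrightarrow> T * E k = E k * T"
    "\<And>v. (\<lambda>n. \<Sum>k<n. (1/2) ^ Suc k *\<^sub>R ((2 *\<^sub>C E k - 1) \<cdot> v)) \<longlonglongrightarrow> a \<cdot> v"
proof -
  define good where "good a \<longleftrightarrow> a \<in> M \<and> contraction a \<and> is_adjoint a a" for a :: "'h bounded_op"
  have "\<exists>e. e \<in> M \<and> projection e \<and> (\<forall>T\<in>M. T * a = a * T \<longrightarrow> T * e = e * T) \<and>
    contraction (2 *\<^sub>C a - (2 *\<^sub>C e - 1))" if "good a" for a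
    using that sign_projection[of a] unfolding good_def by metis
  then obtain F where F: "\<And>a. good a \<Longrightarrow> F a \<in> M \<and> projection (F a) \<and>
    (\<forall>T\<in>M. T * a = a * T \<longrightarrow> T * F a = F a * T) \<and> contraction (2 *\<^sub>C a - (2 *\<^sub>C F a - 1))" by metis
  define R where "R n = ((\<lambda>a. 2 *\<^sub>C a - (2 *\<^sub>C F a - 1)) ^^ n) a" for n
  have R_simps: "R 0 = a" "R (Suc n) = 2 *\<^sub>C R n - (2 *\<^sub>C F (R n) - 1)" for n by (simp_all add: R_def)
  have sa: "is_adjoint (2 *\<^sub>C b) (2 *\<^sub>C b)" if "is_adjoint b b" for b :: "'h bounded_op"
    using is_adjoint_scaleC[OF that, of 2] by simp
  have good: "good (R n)" for n
  proof (induction n)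
    case 0 then show ?case using assms by (simp add: good_def R_simps)
  next
    case (Suc n)
    then show ?case using F[OF Suc] unfolding good_def R_simps projection_def
      by (auto intro!: is_adjoint_diff sa)
  qed
  have comm: "T * R n = R n * T" if T: "T \<in> M" "T * a = a * T" for T n
  proof (induction n)
    case (Suc n)
    then have "T * F (R n) = F (R n) * T" using F[OF good[of n]] T by blast
    then show ?case using Suc unfolding R_simps
      by (simp add: left_diff_distrib right_diff_distrib scaleC_mult_left scaleC_mult_right)
  qed (simp add: R_simps T)
  define E where "E k = F (R k)" for k
  have "a \<cdot> v = (\<Sum>k<n. (1/2) ^ Suc k *\<^sub>R ((2 *\<^sub>C E k - 1) \<cdot> v)) + (1/2) ^ n *\<^sub>R (R n \<cdot> v)" for n v
  proof (induction n)
    case (Suc n)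
    have "R (Suc n) \<cdot> v = 2 *\<^sub>R (R n \<cdot> v) - (2 *\<^sub>C E n - 1) \<cdot> v"
      using scaleR_scaleC[of 2 "R n \<cdot> v"] by (simp add: R_simps E_def)
    then have "R n \<cdot> v = (1/2) *\<^sub>R ((2 *\<^sub>C E n - 1) \<cdot> v + R (Suc n) \<cdot> v)" by simp
    then have "(1/2) ^ n *\<^sub>R (R n \<cdot> v) = (1/2) ^ Suc n *\<^sub>R ((2 *\<^sub>C E n - 1) \<cdot> v) + (1/2) ^ Suc n *\<^sub>R (R (Suc n) \<cdot> v)"
      by (simp only: scaleR_add_right scaleR_scaleR power_Suc2)
    then show ?case using Suc by simp
  qed (simp add: R_simps)
  then have eq: "(\<Sum>k<n. (1/2) ^ Suc k *\<^sub>R ((2 *\<^sub>C E k - 1) \<cdot> v)) = a \<cdot> v - (1/2) ^ n *\<^sub>R (R n \<cdot> v)" for n v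
    by (simp add: eq_diff_eq)
  have "(\<lambda>n. (1/2) ^ n *\<^sub>R (R n \<cdot> v)) \<longlonglongrightarrow> 0" for v
  proof (rule Lim_null_comparison)
    show "\<forall>\<^sub>F n in sequentially. norm ((1/2) ^ n *\<^sub>R (R n \<cdot> v)) \<le> (1/2) ^ n * norm v"
      using good by (auto simp: good_def contraction_def intro!: mult_left_mono always_eventually)
    show "(\<lambda>n. (1/2) ^ n * norm v) \<longlonglongrightarrow> 0"
      by (intro tendsto_mult_left_zero LIMSEQ_power_zero) simp
  qed
  from tendsto_diff[OF tendsto_const this]
  have "(\<lambda>n. \<Sum>k<n. (1/2) ^ Suc k *\<^sub>R ((2 *\<^sub>C E k - 1) \<cdot> v)) \<longlonglongrightarrow> a \<cdot> v" for v
    unfolding eq by simp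
  moreover have "T * E k = E k * T" if "T \<in> M" "T * a = a * T" for T k
    using F[OF good[of k]] comm[OF that] that unfolding E_def by blast
  ultimately show ?thesis using that[of E] F[OF good] unfolding E_def by blast
qed

text \<open>Real and imaginary part, scaled by \<open>\<gamma>\<close> to contractions. Giving \<open>a\<close> and \<open>b\<close> explicitly in
terms of \<open>x\<close> and its adjoint lets commutation relations pass to them.\<close>
lemma self_adjoint_decomposition:
  assumes "x \<in> M"
  obtains x' a b \<gamma> where "x' \<in> M" "is_adjoint x' x"
    "a = \<gamma> *\<^sub>C (x + x')" "b = (\<gamma> * \<i>) *\<^sub>C (x' - x)"
    "a \<in> M" "b \<in> M" "is_adjoint a a" "is_adjoint b b" "contraction a" "contraction b"
    "\<gamma> \<noteq> 0" "x = (1 / (2 * \<gamma>)) *\<^sub>C (a + \<i> *\<^sub>C b)"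
proof -
  obtain x' where x': "x' \<in> M" "is_adjoint x' x" using M_adjoint assms by blast
  obtain K where K: "K > 0" "\<And>v. norm (x \<cdot> v) \<le> norm v * K"
    using bounded_linear.pos_bounded[OF bounded_linear_op] by blast
  obtain K' where K': "K' > 0" "\<And>v. norm (x' \<cdot> v) \<le> norm v * K'"
    using bounded_linear.pos_bounded[OF bounded_linear_op] by blast
  define r where "r = 1 / (K + K')"
  have r: "r > 0" using K(1) K'(1) by (simp add: r_def)
  define \<gamma> where "\<gamma> = complex_of_real r"
  have \<gamma>: "\<gamma> \<noteq> 0" "cnj \<gamma> = \<gamma>" using r by (simp_all add: \<gamma>_def)
  define a b where "a = \<gamma> *\<^sub>C (x + x')" and "b = (\<gamma> * \<i>) *\<^sub>C (x' - x)"
  have bound: "r * (norm (x \<cdot> v) + norm (x' \<cdot> v)) \<le> norm v" for v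
  proof -
    have "norm (x \<cdot> v) + norm (x' \<cdot> v) \<le> norm v * (K + K')"
      using K(2)[of v] K'(2)[of v] by (simp add: distrib_left)
    then show ?thesis using K(1) K'(1) by (simp add: r_def divide_le_eq)
  qed
  have ca: "contraction a" unfolding contraction_def
  proof
    fix v
    have "norm (a \<cdot> v) = r * norm (x \<cdot> v + x' \<cdot> v)" using r by (simp add: a_def \<gamma>_def norm_scaleC)
    also have "\<dots> \<le> r * (norm (x \<cdot> v) + norm (x' \<cdot> v))" using r by (intro mult_left_mono norm_triangle_ineq) auto
    finally show "norm (a \<cdot> v) \<le> norm v" using bound[of v] by linarith
  qed
  have cb: "contraction b" unfolding contraction_def
  proof
    fix v
    have "norm (b \<cdot> v) = r * norm (x' \<cdot> v - x \<cdot> v)" using r by (simp add: b_def \<gamma>_def norm_scaleC norm_mult)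
    also have "\<dots> \<le> r * (norm (x \<cdot> v) + norm (x' \<cdot> v))"
      using r norm_triangle_ineq4[of "x' \<cdot> v" "x \<cdot> v"] by (intro mult_left_mono) auto
    finally show "norm (b \<cdot> v) \<le> norm v" using bound[of v] by linarith
  qed
  have "is_adjoint (x' + x) (x + x')" using x'(2) is_adjoint_sym by (intro is_adjoint_add) auto
  from is_adjoint_scaleC[OF this, of \<gamma>] have aa: "is_adjoint a a" by (simp add: a_def \<gamma> add.commute)
  have "is_adjoint (x - x') (x' - x)" using x'(2) is_adjoint_sym by (intro is_adjoint_diff) auto
  from is_adjoint_scaleC[OF this, of "\<gamma> * \<i>"] have "is_adjoint ((- (\<gamma> * \<i>)) *\<^sub>C (x - x')) b" by (simp add: b_def \<gamma>)
  moreover have "(- (\<gamma> * \<i>)) *\<^sub>C (x - x') = b"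
  proof -
    have "(- (\<gamma> * \<i>)) *\<^sub>C (x - x') + (\<gamma> * \<i>) *\<^sub>C (x - x') = 0"
      by (simp only: scaleC_add_left[symmetric]) (use scaleC_add_left[of 0 0 "x - x'"] in simp)
    then show ?thesis by (simp add: b_def scaleC_diff_right eq_neg_iff_add_eq_0[symmetric])
  qed
  ultimately have bb: "is_adjoint b b" by simp
  have "\<i> * (\<gamma> * \<i>) = - \<gamma>" by (simp add: complex_eq_iff)
  then have "\<i> *\<^sub>C b = (- \<gamma>) *\<^sub>C (x' - x)" by (simp only: b_def scaleC_scaleC)
  also have "\<dots> = \<gamma> *\<^sub>C x - \<gamma> *\<^sub>C x'"
    using scaleC_add_left[of "-\<gamma>" \<gamma> "x' - x"] scaleC_add_left[of 0 0 "x' - x"]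
    by (simp add: scaleC_diff_right add_eq_0_iff2)
  finally have "a + \<i> *\<^sub>C b = \<gamma> *\<^sub>C x + \<gamma> *\<^sub>C x" by (simp add: a_def scaleC_add_right)
  also have "\<dots> = (2 * \<gamma>) *\<^sub>C x" by (simp add: scaleC_add_left[symmetric])
  finally have "x = (1 / (2 * \<gamma>)) *\<^sub>C (a + \<i> *\<^sub>C b)" using \<gamma> by (simp add: scaleC_scaleC scaleC_one)
  moreover have abM: "a \<in> M" "b \<in> M" using x' assms by (simp_all add: a_def b_def)
  ultimately show ?thesis using that[OF x' a_def b_def abM aa bb ca cb \<gamma>(1)] by argo
qed

lemma commutes_if_commutes_with_projections:
  assumes b: "\<And>e. e \<in> M \<Longrightarrow> projection e \<Longrightarrow> b * e = e * b" and x: "x \<in> M"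
  shows "b * x = x * b"
proof -
  have *: "b * a = a * b" if a: "a \<in> M" "contraction a" "is_adjoint a a" for a
  proof -
    obtain E where E: "\<And>k::nat. projection (E k)" "\<And>k. E k \<in> M" "\<And>k T. T \<in> M \<Longrightarrow> T * a = a * T \<Longrightarrow> T * E k = E k * T"
      "\<And>v. (\<lambda>n. \<Sum>k<n. (1/2) ^ Suc k *\<^sub>R ((2 *\<^sub>C E k - 1) \<cdot> v)) \<longlonglongrightarrow> a \<cdot> v"
      by (rule binary_expansion[OF a], rule that)
    have bE: "b \<cdot> (2 *\<^sub>C E k - 1) \<cdot> v = (2 *\<^sub>C E k - 1) \<cdot> b \<cdot> v" for k v
    proof -
      have "b * (2 *\<^sub>C E k - 1) = (2 *\<^sub>C E k - 1) * b"
        using b[OF E(2) E(1)] by (simp add: left_diff_distrib right_diff_distrib scaleC_mult_left scaleC_mult_right)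
      then show ?thesis by (metis op_simps(4))
    qed
    show ?thesis
    proof (rule op_eqI)
      fix v
      have "(\<lambda>n. b \<cdot> (\<Sum>k<n. (1/2) ^ Suc k *\<^sub>R ((2 *\<^sub>C E k - 1) \<cdot> v))) \<longlonglongrightarrow> b \<cdot> a \<cdot> v"
        by (rule bounded_linear.tendsto[OF bounded_linear_op E(4)])
      moreover have "b \<cdot> (\<Sum>k<n. (1/2) ^ Suc k *\<^sub>R ((2 *\<^sub>C E k - 1) \<cdot> v)) =
        (\<Sum>k<n. (1/2) ^ Suc k *\<^sub>R ((2 *\<^sub>C E k - 1) \<cdot> b \<cdot> v))" for n
        unfolding linear_sum[OF bounded_linear.linear[OF bounded_linear_op]]
          linear_scale[OF bounded_linear.linear[OF bounded_linear_op]] bE ..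
      ultimately show "(b * a) \<cdot> v = (a * b) \<cdot> v"
        using E(4)[of "b \<cdot> v"] LIMSEQ_unique by simp
    qed
  qed
  obtain x' a c \<gamma> where "a \<in> M" "c \<in> M" "is_adjoint a a" "is_adjoint c c" "contraction a" "contraction c"
    and xe: "x = (1 / (2 * \<gamma>)) *\<^sub>C (a + \<i> *\<^sub>C c)"
    using self_adjoint_decomposition[OF x] by metis
  then have "b * a = a * b" "b * c = c * b" using * by auto
  then show ?thesis
    unfolding xe by (simp add: distrib_left distrib_right scaleC_mult_left scaleC_mult_right)
qed

text \<open>If \<open>q\<close> is a central projection of \<open>pMp\<close>, then \<open>q M (p - q) = 0\<close>, so the central carrier \<open>z\<close>
of \<open>q\<close> annihilates \<open>p - q\<close>, and \<open>z p = z q = q\<close>.\<close>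
lemma corner_central_projection_lift:
  assumes p: "p \<in> M" "p * p = p"
    and q: "q \<in> M" "p * q = q" "q * p = q" "q * q = q"
    and comm: "\<And>y. y \<in> M \<Longrightarrow> q * (p * y * p) = (p * y * p) * q"
  obtains z where "z \<in> center M" "projection z" "z * p = q"
proof -
  obtain y where y: "y \<in> center M" "projection y" "\<And>x. (\<forall>s\<in>{q}. \<forall>m\<in>M. s * m * x = 0) \<longleftrightarrow> y * x = x"
    using ideal_annihilator[of "{q}"] q by auto
  have yy: "y * y = y" "is_adjoint y y" using y(2) by (auto simp: projection_def)
  have "q * 1 * y = 0" using y(3)[of y] yy by blast
  moreover have "y * q = q * y" using y(1) q by (auto simp: center_def)
  ultimately have yq: "y * q = 0" by simp
  have "q * m * (p - q) = 0" if m: "m \<in> M" for m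
  proof -
    have "q * m * p = q * (p * m * p)" using q by (metis mult.assoc)
    moreover have "q * m * q = q * (p * m * p) * q" using q by (metis mult.assoc)
    moreover have "q * (p * m * p) * q = q * (p * m * p)" using comm[OF m] q(4) by (metis mult.assoc)
    ultimately show ?thesis by (simp add: right_diff_distrib)
  qed
  then have "y * (p - q) = p - q" using y(3) by blast
  then have "(1 - y) * p = q" using yq by (simp add: left_diff_distrib right_diff_distrib)
  moreover have "1 - y \<in> center M" using y(1) by (simp add: center_def left_diff_distrib right_diff_distrib)
  moreover have "projection (1 - y)"
    using yy by (auto simp: projection_def algebra_simps intro!: is_adjoint_diff)
  ultimately show ?thesis using that by blast
qed

text \<open>The digits of the binary expansion of a self-adjoint central element of \<open>pMp\<close> are central
projections of \<open>pMp\<close> once compressed to the corner. Lifting each of them gives a convergent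
expansion of the central element sought.\<close>
lemma corner_center_lift:
  assumes p: "p \<in> M" "projection p" and c: "c \<in> M" "p * c = c" "c * p = c"
    and comm: "\<And>y. y \<in> M \<Longrightarrow> c * (p * y * p) = (p * y * p) * c"
  shows "\<exists>z\<in>center M. z * p = c"
proof -
  have pp: "p * p = p" "is_adjoint p p" using p(2) by (auto simp: projection_def)
  have *: "\<exists>z\<in>center M. z * p = a"
    if a: "a \<in> M" "contraction a" "is_adjoint a a" and ap: "p * a = a" "a * p = a"
      and acomm: "\<And>y. y \<in> M \<Longrightarrow> a * (p * y * p) = (p * y * p) * a" for a
  proof -
    obtain E where E: "\<And>k::nat. projection (E k)" "\<And>k. E k \<in> M" "\<And>k T. T \<in> M \<Longrightarrow> T * a = a * T \<Longrightarrow> T * E k = E k * T"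
      "\<And>v. (\<lambda>n. \<Sum>k<n. (1/2) ^ Suc k *\<^sub>R ((2 *\<^sub>C E k - 1) \<cdot> v)) \<longlonglongrightarrow> a \<cdot> v"
      by (rule binary_expansion[OF a], rule that)
    have "\<exists>z. z \<in> center M \<and> projection z \<and> z * p = E k * p" for k
    proof -
      have pE: "p * E k = E k * p" using E(3)[OF p(1)] ap by simp
      have EE: "E k * E k = E k" using E(1) by (simp add: projection_def)
      have 1: "p * (E k * p) = E k * p" "E k * p * p = E k * p" "E k * p * (E k * p) = E k * p"
        using pE pp EE by (metis mult.assoc)+
      have 2: "E k * p * (p * y * p) = (p * y * p) * (E k * p)" if y: "y \<in> M" for y
      proof -
        have "p * y * p * E k = E k * (p * y * p)"
          using E(3)[of "p * y * p" k] acomm[OF y] y p by simp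
        then show ?thesis using pE pp by (metis mult.assoc)
      qed
      obtain z where "z \<in> center M" "projection z" "z * p = E k * p"
        using corner_central_projection_lift[OF p(1) pp(1) _ 1 2] E(2) p(1) by auto
      then show ?thesis by blast
    qed
    then obtain z where z: "\<And>k. z k \<in> center M" "\<And>k. projection (z k)" "\<And>k. z k * p = E k * p" by metis
    have zM: "z k \<in> M" and zx: "x \<in> M \<Longrightarrow> x * z k = z k * x" for k x
      using z(1)[of k] unfolding center_def by auto
    define T where "T n = (\<Sum>k<n. complex_of_real ((1/2) ^ Suc k) *\<^sub>C (2 *\<^sub>C z k - 1))" for n
    have T_Suc: "T (Suc n) \<cdot> v - T n \<cdot> v = (1/2) ^ Suc n *\<^sub>R ((2 *\<^sub>C z n - 1) \<cdot> v)" for n v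
      unfolding T_def scaleR_scaleC by (simp del: op_simps(2) of_real_power)
    obtain L where L: "\<And>v. (\<lambda>n. T n \<cdot> v) \<longlonglongrightarrow> L \<cdot> v"
    proof (rule bounded_op_limit[of "\<lambda>k. (1/2) ^ Suc k" T])
      show "summable (\<lambda>k. (1 / 2::real) ^ Suc k)" by (intro summable_Suc_iff[THEN iffD2] summable_geometric) simp
      show "norm (T (Suc k) \<cdot> v - T k \<cdot> v) \<le> (1 / 2) ^ Suc k * norm v" for k v
        unfolding T_Suc norm_scaleR norm_reflection[OF z(2)] by simp
    qed auto
    have comm: "S * T n = T n * S" if S: "\<And>k. S * z k = z k * S" for S n
      unfolding T_def sum_distrib_left sum_distrib_right
      by (intro sum.cong refl) (simp add: scaleC_mult_left scaleC_mult_right left_diff_distrib right_diff_distrib S)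
    have Lcomm: "S * L = L * S" if S: "\<And>k. S * z k = z k * S" for S
      by (rule limit_commute[OF L comm[OF S]])
    have "L \<in> M"
    proof (rule M_commutantI)
      fix S assume "S \<in> commutant M"
      then have "S * z k = z k * S" for k using commutantD zM by blast
      then show "L * S = S * L" using Lcomm[of S] by simp
    qed
    moreover have "L * x = x * L" if "x \<in> M" for x
      using Lcomm[OF zx[OF that]] by simp
    ultimately have "L \<in> center M" by (simp add: center_def)
    moreover have "L * p = a"
    proof (rule op_eqI)
      fix v
      have zp: "z k \<cdot> p \<cdot> v = E k \<cdot> p \<cdot> v" for k using z(3)[of k] by (metis op_simps(4))
      have "T n \<cdot> p \<cdot> v = (\<Sum>k<n. (1/2) ^ Suc k *\<^sub>R ((2 *\<^sub>C E k - 1) \<cdot> p \<cdot> v))" for n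
      proof (induction n)
        case (Suc n)
        have "T (Suc n) \<cdot> p \<cdot> v = T n \<cdot> p \<cdot> v + (1/2) ^ Suc n *\<^sub>R ((2 *\<^sub>C z n - 1) \<cdot> p \<cdot> v)"
          using T_Suc[of n "p \<cdot> v"] by (simp only: diff_eq_eq add.commute)
        then show ?case using Suc by (simp add: zp)
      qed (simp add: T_def)
      then have "(\<lambda>n. T n \<cdot> p \<cdot> v) \<longlonglongrightarrow> a \<cdot> p \<cdot> v" using E(4)[of "p \<cdot> v"] by simp
      then have "L \<cdot> p \<cdot> v = a \<cdot> p \<cdot> v" using L LIMSEQ_unique by blast
      also have "\<dots> = a \<cdot> v" using ap(2) by (metis op_simps(4))
      finally show "(L * p) \<cdot> v = a \<cdot> v" by simp
    qed
    ultimately show ?thesis by blast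
  qed
  obtain c' a b \<gamma> where d: "c' \<in> M" "is_adjoint c' c"
    "a = \<gamma> *\<^sub>C (c + c')" "b = (\<gamma> * \<i>) *\<^sub>C (c' - c)"
    "a \<in> M" "b \<in> M" "is_adjoint a a" "is_adjoint b b" "contraction a" "contraction b"
    "c = (1 / (2 * \<gamma>)) *\<^sub>C (a + \<i> *\<^sub>C b)"
    using self_adjoint_decomposition[OF c(1)] by metis
  have "is_adjoint (c' * p) (p * c)" "is_adjoint (p * c') (c * p)"
    using d(2) pp(2) by (auto intro: is_adjoint_mult)
  then have c'p: "c' * p = c'" "p * c' = c'" using c d(2) is_adjoint_unique by metis+
  have c'comm: "c' * (p * y * p) = (p * y * p) * c'" if y: "y \<in> M" for y
  proof -
    obtain y' where y': "y' \<in> M" "is_adjoint y' y" using M_adjoint y by blast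
    then have "is_adjoint (p * y * p) (p * (y' * p))"
      using pp(2) by (intro is_adjoint_mult is_adjoint_sym[OF y'(2)]) auto
    then have "is_adjoint (c' * (p * y * p)) (p * (y' * p) * c)" "is_adjoint (p * y * p * c') (c * (p * (y' * p)))"
      using d(2) by (auto intro: is_adjoint_mult)
    then show ?thesis using comm[OF y'(1)] is_adjoint_unique by (metis mult.assoc)
  qed
  note scale = scaleC_mult_left scaleC_mult_right distrib_left distrib_right left_diff_distrib right_diff_distrib
  have "p * a = a" "a * p = a" "p * b = b" "b * p = b"
    unfolding d(3,4) by (simp_all only: scale c c'p)
  moreover have "a * (p * y * p) = (p * y * p) * a" "b * (p * y * p) = (p * y * p) * b" if "y \<in> M" for y
    unfolding d(3,4) by (simp_all only: scale comm[OF that] c'comm[OF that])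
  ultimately have "\<exists>z\<in>center M. z * p = a" "\<exists>z\<in>center M. z * p = b"
    using *[OF d(5,9,7)] *[OF d(6,10,8)] by blast+
  then obtain z w where zw: "z \<in> center M" "z * p = a" "w \<in> center M" "w * p = b" by blast
  have "(1 / (2 * \<gamma>)) *\<^sub>C (z + \<i> *\<^sub>C w) \<in> center M"
    using zw by (simp add: center_def scaleC_mult_left scaleC_mult_right distrib_left distrib_right)
  moreover have "(1 / (2 * \<gamma>)) *\<^sub>C (z + \<i> *\<^sub>C w) * p = c"
    by (simp only: scaleC_mult_left distrib_right zw d(11)[symmetric])
  ultimately show ?thesis by blast
qed

end

section \<open>A projection balanced over the centre\<close>

lemma centerD: "z \<in> center M \<Longrightarrow> z \<in> M" "z \<in> center M \<Longrightarrow> x \<in> M \<Longrightarrow> z * x = x * z"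
  by (auto simp: center_def)

lemma projectionD: "projection e \<Longrightarrow> e * e = e" "projection e \<Longrightarrow> is_adjoint e e"
  by (auto simp: projection_def)

lemma projection_compl: "projection e \<Longrightarrow> projection (1 - e)"
  by (auto simp: projection_def algebra_simps intro!: is_adjoint_diff)

lemma projection_mult:
  assumes "projection e" "projection f" "e * f = f * e" shows "projection (e * f)"
proof -
  have "e * f * (e * f) = e * f" using assms projectionD(1) by (metis mult.assoc)
  moreover have "is_adjoint (f * e) (e * f)" using assms projectionD(2) by (intro is_adjoint_mult)
  ultimately show ?thesis using assms(3) by (simp add: projection_def)
qed

context vn_algebra
begin

lemma center_mult: "z \<in> center M \<Longrightarrow> w \<in> center M \<Longrightarrow> z * w \<in> center M"
proof -
  assume z: "z \<in> center M" and w: "w \<in> center M"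
  have "z * w * x = x * (z * w)" if "x \<in> M" for x
    using centerD(2)[OF z that] centerD(2)[OF w that] by (metis mult.assoc)
  then show ?thesis using centerD(1)[OF z] centerD(1)[OF w] unfolding center_def by blast
qed

lemma center_compl: "z \<in> center M \<Longrightarrow> 1 - z \<in> center M"
  unfolding center_def by (auto simp: left_diff_distrib right_diff_distrib)

text \<open>With \<open>y = x\<^sup>*\<close> the self-adjoint operator \<open>x\<^sup>* x\<close> has square zero, hence vanishes, and so does
\<open>x\<close>.\<close>
lemma M_semiprime:
  assumes x: "x \<in> M" and 0: "\<And>y. y \<in> M \<Longrightarrow> x * y * x = 0" shows "x = 0"
proof -
  obtain x' where x': "x' \<in> M" "is_adjoint x' x" using M_adjoint x by blast
  have n: "T \<cdot> v = 0" if "is_adjoint T' T" "(T' * T) \<cdot> v = 0" for T T' :: "'h bounded_op" and v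
  proof -
    have "inner (T \<cdot> v) (T \<cdot> v) = inner v ((T' * T) \<cdot> v)" using that(1) by (simp add: is_adjoint_iff)
    then show ?thesis using that(2) by simp
  qed
  have "is_adjoint (x' * x) (x' * x)" using is_adjoint_mult[OF is_adjoint_sym[OF x'(2)] x'(2)] .
  moreover have "x' * x * (x' * x) = 0" using 0[OF x'(1)] by (metis mult.assoc mult_zero_right)
  ultimately have "(x' * x) \<cdot> v = 0" for v using n by (metis op_simps(5))
  then show ?thesis using n[OF x'(2)] by (intro op_eqI) simp
qed

text \<open>Both \<open>e\<close> and \<open>z - e\<close> have central carrier \<open>z\<close>.\<close>
definition balanced_pair :: "'h bounded_op \<Rightarrow> 'h bounded_op \<Rightarrow> bool" where
  "balanced_pair e z \<longleftrightarrow> e \<in> M \<and> projection e \<and> z \<in> center M \<and> projection z \<and> z * e = e \<and>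
    (\<forall>x\<in>M. (\<forall>m\<in>M. e * m * x = 0) \<longrightarrow> z * x = 0) \<and>
    (\<forall>x\<in>M. (\<forall>m\<in>M. (z - e) * m * x = 0) \<longrightarrow> z * x = 0)"

text \<open>If \<open>b\<close> commutes with all projections, it commutes with everything, by the binary expansion.\<close>
lemma noncentral_projection:
  assumes y: "y \<in> center M" "projection y" and na: "\<not> abelian_projection M y"
  obtains b q where "b \<in> M" "y * b = b" "q \<in> M" "projection q" "y * q = q" "b * q \<noteq> q * b"
proof -
  have yM: "y \<in> M" using y centerD by blast
  obtain x1 x2 where x: "x1 \<in> M" "x2 \<in> M" "(y * x1 * y) * (y * x2 * y) \<noteq> (y * x2 * y) * (y * x1 * y)"
    using na y(2) yM by (auto simp: abelian_projection_def)
  define b where "b = y * x2 * y"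
  have bM: "b \<in> M" using x yM by (simp add: b_def)
  have "y * y = y" using projectionD y by blast
  then have yb: "y * b = b" "b * y = b" unfolding b_def by (metis mult.assoc)+
  have "\<exists>e\<in>M. projection e \<and> b * e \<noteq> e * b"
  proof (rule ccontr)
    assume "\<not> ?thesis"
    then have "b * (y * x1 * y) = (y * x1 * y) * b"
      using commutes_if_commutes_with_projections[of b "y * x1 * y"] x yM by simp
    then show False using x(3) by (simp add: b_def)
  qed
  then obtain e where e: "e \<in> M" "projection e" "b * e \<noteq> e * b" by blast
  have "y * e = e * y" using centerD(2)[OF y(1) e(1)] .
  then have "b * (y * e) = b * e" "y * e * b = e * b" "projection (y * e)" "y * (y * e) = y * e"
    using yb \<open>y * y = y\<close> projection_mult[OF y(2) e(2)] by (metis mult.assoc)+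
  then show ?thesis using that[of b "y * e"] bM yb e yM by simp
qed

text \<open>Start with a noncentral projection \<open>q\<close> below \<open>y\<close> and cut down to the product \<open>z\<close> of \<open>y\<close> and
the central carriers of \<open>q\<close> and \<open>y - q\<close>. If \<open>z\<close> were \<open>0\<close>, then \<open>q M (y - q) = 0\<close> and \<open>q\<close>
would be central below \<open>y\<close>.\<close>
lemma balanced_pair_exists:
  assumes y: "y \<in> center M" "projection y" and na: "\<not> abelian_projection M y"
  obtains e z where "balanced_pair e z" "z \<noteq> 0" "y * z = z"
proof -
  obtain b q where b: "b \<in> M" "y * b = b" and q: "q \<in> M" "projection q" "y * q = q" and bq: "b * q \<noteq> q * b"
    using noncentral_projection[OF assms] by blast
  have yM: "y \<in> M" and yc: "\<And>x. x \<in> M \<Longrightarrow> y * x = x * y" using y centerD by blast+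
  have yy: "y * y = y" and qq: "q * q = q" using projectionD y q by blast+
  have qy: "q * y = q" using yc q by metis
  obtain n1 where n1: "n1 \<in> center M" "projection n1" "\<And>x. (\<forall>s\<in>{q}. \<forall>m\<in>M. s * m * x = 0) \<longleftrightarrow> n1 * x = x"
    using ideal_annihilator[of "{q}"] q by auto
  obtain n2 where n2: "n2 \<in> center M" "projection n2" "\<And>x. (\<forall>s\<in>{y - q}. \<forall>m\<in>M. s * m * x = 0) \<longleftrightarrow> n2 * x = x"
    using ideal_annihilator[of "{y - q}"] q yM by auto
  have n1n: "n1 * n1 = n1" and n2n: "n2 * n2 = n2" using projectionD n1 n2 by blast+
  have "q * 1 * n1 = 0" using n1(3)[of n1] n1n M_one by blast
  then have qn1: "q * n1 = 0" by simp
  have "(y - q) * 1 * n2 = 0" using n2(3)[of n2] n2n M_one by blast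
  then have yqn2: "(y - q) * n2 = 0" by simp
  define w where "w = (1 - n1) * (1 - n2)"
  define z where "z = y * w"
  define e where "e = z * q"
  have wc: "w \<in> center M" unfolding w_def by (intro center_mult center_compl n1 n2)
  have wp: "projection w" unfolding w_def
    using projection_mult[OF projection_compl[OF n1(2)] projection_compl[OF n2(2)]]
      centerD(2)[OF center_compl[OF n1(1)] centerD(1)[OF center_compl[OF n2(1)]]] by blast
  have zc: "z \<in> center M" unfolding z_def by (intro center_mult wc y)
  have zp: "projection z" unfolding z_def
    using projection_mult[OF y(2) wp] yc centerD(1)[OF wc] by blast
  have zM: "z \<in> M" and zcomm: "\<And>x. x \<in> M \<Longrightarrow> z * x = x * z" using zc centerD by blast+
  have zz: "z * z = z" using zp projectionD by blast
  have yz: "y * z = z" unfolding z_def using yy by (metis mult.assoc)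
  have n1z: "n1 * z = 0"
  proof -
    have "n1 * z = y * (n1 * (1 - n1)) * (1 - n2)"
      unfolding z_def w_def using yc[OF centerD(1)[OF n1(1)]] by (metis mult.assoc)
    then show ?thesis by (simp add: right_diff_distrib n1n)
  qed
  have n2z: "n2 * z = 0"
  proof -
    have "z = (1 - n2) * (y * (1 - n1))"
      using centerD(2)[OF center_compl[OF n2(1)], of "y * (1 - n1)"] yM centerD(1)[OF n1(1)]
      unfolding z_def w_def by (simp add: mult.assoc)
    then have "n2 * z = n2 * (1 - n2) * (y * (1 - n1))" by (simp add: mult.assoc)
    then show ?thesis by (simp add: right_diff_distrib n2n)
  qed
  have bal: "balanced_pair e z"
    unfolding balanced_pair_def
  proof (intro conjI ballI impI)
    show "e \<in> M" "z \<in> center M" "projection z" using zM q zc zp by (simp_all add: e_def)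
    show "projection e" unfolding e_def by (rule projection_mult[OF zp q(2) zcomm[OF q(1)]])
    show "z * e = e" unfolding e_def using zz by (metis mult.assoc)
    fix x assume x: "x \<in> M"
    show "z * x = 0" if "\<forall>m\<in>M. e * m * x = 0"
    proof -
      have "q * m * (z * x) = 0" if m: "m \<in> M" for m
      proof -
        have "q * m * (z * x) = e * m * x" unfolding e_def
          using zcomm[of "q * m"] q m by (metis M_mult mult.assoc)
        then show ?thesis using \<open>\<forall>m\<in>M. e * m * x = 0\<close> m by simp
      qed
      then have "n1 * (z * x) = z * x" using n1(3) by blast
      then show ?thesis using n1z by (metis mult.assoc mult_zero_left)
    qed
    show "z * x = 0" if "\<forall>m\<in>M. (z - e) * m * x = 0"
    proof -
      have ze: "z - e = z * (y - q)" unfolding e_def right_diff_distrib using yz zcomm[OF yM] by simp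
      have "(y - q) * m * (z * x) = 0" if m: "m \<in> M" for m
      proof -
        have "(y - q) * m * (z * x) = (z - e) * m * x" unfolding ze
          using zcomm[of "(y - q) * m"] q yM m by (metis M_mult M_diff mult.assoc)
        then show ?thesis using \<open>\<forall>m\<in>M. (z - e) * m * x = 0\<close> m by simp
      qed
      then have "n2 * (z * x) = z * x" using n2(3) by blast
      then show ?thesis using n2z by (metis mult.assoc mult_zero_left)
    qed
  qed
  have "z \<noteq> 0"
  proof
    assume z0: "z = 0"
    have t0: "q * m * (y - q) = 0" if m: "m \<in> M" for m
    proof -
      define t where "t = q * m * (y - q)"
      have tM: "t \<in> M" using q m yM by (simp add: t_def)
      have "t * n2 = 0" unfolding t_def using yqn2 by (simp add: mult.assoc)
      moreover have "t * n1 = 0"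
      proof -
        have "t * n1 = n1 * t" using centerD(2)[OF n1(1) tM] by simp
        also have "\<dots> = n1 * q * (m * (y - q))" by (simp add: t_def mult.assoc)
        also have "n1 * q = 0" using centerD(2)[OF n1(1) q(1)] qn1 by simp
        finally show ?thesis by simp
      qed
      moreover have "t * y = t" unfolding t_def using yy qy by (simp add: mult.assoc left_diff_distrib)
      ultimately have "t * z = t"
        unfolding z_def w_def by (simp add: algebra_simps) (simp flip: mult.assoc)
      then show ?thesis using z0 by (simp add: t_def)
    qed
    have sa: "is_adjoint q q" "is_adjoint (y - q) (y - q)"
      using q y by (auto intro: is_adjoint_diff projectionD)
    have t0': "(y - q) * m * q = 0" if m: "m \<in> M" for m
    proof -
      obtain m' where m': "m' \<in> M" "is_adjoint m' m" using M_adjoint m by blast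
      have "is_adjoint (q * (m' * (y - q))) ((y - q) * m * q)"
        using m' sa by (intro is_adjoint_mult) auto
      moreover have "q * (m' * (y - q)) = 0" using t0[OF m'(1)] by (simp add: mult.assoc)
      ultimately show ?thesis using is_adjoint_unique is_adjoint_sym is_adjoint_01(2) by metis
    qed
    have b_y: "b * y = b" using yc[OF b(1)] b(2) by simp
    have "q * b * y = q * b" by (simp add: mult.assoc b_y)
    then have "q * b = q * b * q" using t0[OF b(1)] by (simp add: right_diff_distrib)
    moreover have "b * q = q * b * q" using t0'[OF b(1)] by (simp add: left_diff_distrib b(2))
    ultimately show False using bq by simp
  qed
  then show ?thesis using that bal yz by blast
qed

text \<open>By Zorn's lemma there is a maximal family of nonzero balanced pairs with orthogonal central
carriers. The carriers have no common annihilator, since otherwise the central projection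
that generates this annihilator would contain a further balanced pair. The projection \<open>p\<close> is
the supremum of the first components, obtained as the complement of their right annihilator,
and \<open>z p = e\<close> for each pair, so that faithfulness can be tested on one pair at a time.\<close>
lemma balanced_projection_exists:
  assumes no_I1: "\<not> has_type_I1_central_summand M"
  shows "\<exists>p\<in>M. projection p \<and> (\<forall>x\<in>M. (\<forall>y\<in>M. p * y * x = 0) \<longrightarrow> x = 0) \<and>
    (\<forall>x\<in>M. (\<forall>y\<in>M. (1 - p) * y * x = 0) \<longrightarrow> x = 0)"
proof -
  define \<F> where "\<F> = {F. (\<forall>(e, z)\<in>F. balanced_pair e z \<and> z \<noteq> 0) \<and>
    (\<forall>u\<in>F. \<forall>v\<in>F. u \<noteq> v \<longrightarrow> snd u * snd v = 0)}"
  have "\<exists>F\<in>\<F>. \<forall>X\<in>\<F>. F \<subseteq> X \<longrightarrow> X = F"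
  proof (rule subset_Zorn_nonempty)
    show "\<F> \<noteq> {}" unfolding \<F>_def by blast
    fix C assume "C \<noteq> {}" and ch: "subset.chain \<F> C"
    then have CF: "C \<subseteq> \<F>" and tot: "\<And>X Y. X \<in> C \<Longrightarrow> Y \<in> C \<Longrightarrow> X \<subseteq> Y \<or> Y \<subseteq> X"
      by (auto simp: subset_chain_def)
    show "\<Union>C \<in> \<F>"
      unfolding \<F>_def
    proof (intro CollectI conjI ballI impI)
      fix u v assume uv: "u \<in> \<Union>C" "v \<in> \<Union>C" "u \<noteq> v"
      then obtain X where "X \<in> C" "u \<in> X" "v \<in> X" using tot by blast
      then show "snd u * snd v = 0" using CF uv(3) unfolding \<F>_def by blast
    next
      fix u assume "u \<in> \<Union>C"
      then show "case u of (e, z) \<Rightarrow> balanced_pair e z \<and> z \<noteq> 0" using CF unfolding \<F>_def by blast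
    qed
  qed
  then obtain F where FF: "F \<in> \<F>" and Fmax: "\<And>X. X \<in> \<F> \<Longrightarrow> F \<subseteq> X \<Longrightarrow> X = F" by blast
  have Fb: "balanced_pair e z" "z \<noteq> 0" if "(e, z) \<in> F" for e z using FF that unfolding \<F>_def by auto
  have Fo: "z * z' = 0" if "(e, z) \<in> F" "(e', z') \<in> F" "(e, z) \<noteq> (e', z')" for e z e' z'
    using FF that unfolding \<F>_def by force
  have bal: "e \<in> M" "z \<in> M" "z * e = e" "e * z = e" "e * e = e" "z * z = z" "is_adjoint e e" "is_adjoint z z"
    "\<And>x. x \<in> M \<Longrightarrow> z * x = x * z"
    "\<And>x. x \<in> M \<Longrightarrow> (\<And>m. m \<in> M \<Longrightarrow> e * m * x = 0) \<Longrightarrow> z * x = 0"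
    "\<And>x. x \<in> M \<Longrightarrow> (\<And>m. m \<in> M \<Longrightarrow> (z - e) * m * x = 0) \<Longrightarrow> z * x = 0"
    if "(e, z) \<in> F" for e z
    using Fb(1)[OF that] unfolding balanced_pair_def projection_def center_def by auto
  have total: "x = 0" if x: "x \<in> M" and zx: "\<And>e z. (e, z) \<in> F \<Longrightarrow> z * x = 0" for x
  proof -
    have "snd ` F \<subseteq> M" using bal(2) by auto
    then obtain y where y: "y \<in> center M" "projection y"
      "\<And>x. (\<forall>s\<in>snd ` F. \<forall>m\<in>M. s * m * x = 0) \<longleftrightarrow> y * x = x"
      using ideal_annihilator by blast
    have zy: "z * y = 0" if "(e, z) \<in> F" for e z
    proof -
      have "z * 1 * y = 0" using y(3)[of y] projectionD(1)[OF y(2)] that M_one by (metis image_eqI snd_conv)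
      then show ?thesis by simp
    qed
    have "s * m * x = 0" if s: "s \<in> snd ` F" and m: "m \<in> M" for s m
    proof -
      obtain e where e: "(e, s) \<in> F" using s by auto
      have "s * m * x = m * (s * x)" using bal(9)[OF e m] by (simp add: mult.assoc)
      then show ?thesis using zx[OF e] by simp
    qed
    then have yx: "y * x = x" using y(3) by blast
    have "y = 0"
    proof (rule ccontr)
      assume "y \<noteq> 0"
      then have "\<not> abelian_projection M y"
        using no_I1 y(1) unfolding has_type_I1_central_summand_def by blast
      then obtain e z where ez: "balanced_pair e z" "z \<noteq> 0" "y * z = z"
        using balanced_pair_exists[OF y(1,2)] by blast
      have zM: "z \<in> M" using ez(1) unfolding balanced_pair_def center_def by blast
      have z'z: "z' * z = 0" if "(e', z') \<in> F" for e' z'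
        using zy[OF that] ez(3) by (metis mult.assoc mult_zero_left)
      have zz': "z * z' = 0" if "(e', z') \<in> F" for e' z'
        using z'z[OF that] bal(9)[OF that zM] by simp
      have "insert (e, z) F \<in> \<F>"
        using FF ez z'z zz' unfolding \<F>_def by auto
      then have "(e, z) \<in> F" using Fmax by blast
      then have "z * z = 0" using z'z by blast
      then show False using ez(1,2) projectionD(1) unfolding balanced_pair_def by metis
    qed
    then show ?thesis using yx by simp
  qed
  have "fst ` F \<subseteq> M" using bal(1) by auto
  then obtain r where r: "projection r" "r \<in> M" "\<And>x. (\<forall>s\<in>fst ` F. s * x = 0) \<longleftrightarrow> r * x = x"
    using right_annihilator_projection by blast
  define p where "p = 1 - r"
  have pM: "p \<in> M" and pp: "projection p" using r projection_compl by (auto simp: p_def)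
  have p0: "p * x = 0" if "\<And>e z. (e, z) \<in> F \<Longrightarrow> e * x = 0" for x
  proof -
    have "\<forall>s\<in>fst ` F. s * x = 0" using that by auto
    then have "r * x = x" using r(3) by blast
    then show ?thesis by (simp add: p_def left_diff_distrib)
  qed
  have zp: "z * p = e" if ez: "(e, z) \<in> F" for e z
  proof -
    have "e * r = 0" using r(3)[of r] projectionD(1)[OF r(1)] ez by force
    then have ep: "e * p = e" by (simp add: p_def right_diff_distrib)
    moreover have "is_adjoint (p * e) (e * p)"
      using projectionD(2)[OF pp] bal(7)[OF ez] by (intro is_adjoint_mult)
    ultimately have pe: "p * e = e" using bal(7)[OF ez] is_adjoint_unique by metis
    have "p * (z - e) = 0"
    proof (rule p0)
      fix e' z' assume e': "(e', z') \<in> F"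
      show "e' * (z - e) = 0"
      proof (cases "(e', z') = (e, z)")
        case True then show ?thesis using bal(4,5)[OF ez] by (simp add: right_diff_distrib)
      next
        case False
        have "e' * u = 0" if "z * u = u" for u
        proof -
          have "e' * u = e' * (z' * z) * u" using bal(4)[OF e'] that by (metis mult.assoc)
          then show ?thesis by (simp add: Fo[OF e' ez False])
        qed
        then show ?thesis using bal(3,6)[OF ez] by (simp add: right_diff_distrib)
      qed
    qed
    then have "p * z = e" using pe by (simp add: right_diff_distrib)
    then show ?thesis using bal(9)[OF ez pM] by simp
  qed
  show ?thesis
  proof (intro bexI[OF _ pM] conjI ballI impI pp)
    show "x = 0" if x: "x \<in> M" and 0: "\<forall>y\<in>M. p * y * x = 0" for x
    proof (rule total[OF x])
      fix e z assume ez: "(e, z) \<in> F"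
      show "z * x = 0"
      proof (rule bal(10)[OF ez x])
        fix m assume "m \<in> M"
        then have "z * (p * m * x) = 0" using 0 by simp
        then show "e * m * x = 0" using zp[OF ez] by (metis mult.assoc)
      qed
    qed
    show "x = 0" if x: "x \<in> M" and 0: "\<forall>y\<in>M. (1 - p) * y * x = 0" for x
    proof (rule total[OF x])
      fix e z assume ez: "(e, z) \<in> F"
      show "z * x = 0"
      proof (rule bal(11)[OF ez x])
        fix m assume "m \<in> M"
        then have "z * ((1 - p) * m * x) = 0" using 0 by simp
        moreover have "z * (1 - p) = z - e" using zp[OF ez] by (simp add: right_diff_distrib)
        ultimately show "(z - e) * m * x = 0" by (metis mult.assoc)
      qed
    qed
  qed
qed

lemma M_semiprime_algebra: "semiprime_algebra M"
proof unfold_locales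
  show "x = 0" if "x \<in> M" "\<And>y. y \<in> M \<Longrightarrow> x * y * x = 0" for x by (rule M_semiprime[OF that])
qed (simp_all add: scaleC_mult_left scaleC_mult_right)

lemma peirce_exists:
  assumes "\<not> has_type_I1_central_summand M"
  shows "\<exists>p f. peirce M p f"
proof -
  interpret semiprime_algebra M by (rule M_semiprime_algebra)
  obtain p where pM: "p \<in> M" "projection p"
    and p_left: "\<forall>x\<in>M. (\<forall>y\<in>M. p * y * x = 0) \<longrightarrow> x = 0"
    and f_left: "\<forall>x\<in>M. (\<forall>y\<in>M. (1 - p) * y * x = 0) \<longrightarrow> x = 0"
    using balanced_projection_exists[OF assms] by (elim bexE conjE)
  have pl: "x = 0" if "x \<in> M" "\<And>y. y \<in> M \<Longrightarrow> p * y * x = 0" for x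
    by (rule p_left[rule_format, OF that])
  have fl: "x = 0" if "x \<in> M" "\<And>y. y \<in> M \<Longrightarrow> (1 - p) * y * x = 0" for x
    by (rule f_left[rule_format, OF that])
  note p = pM pl fl
  define f where "f = 1 - p"
  have f: "f \<in> M" "projection f" using pM projection_compl by (auto simp: f_def)
  have right: "x = 0" if q: "projection q" "\<And>x. x \<in> M \<Longrightarrow> (\<And>y. y \<in> M \<Longrightarrow> q * y * x = 0) \<Longrightarrow> x = 0"
    and x: "x \<in> M" and 0: "\<And>y. y \<in> M \<Longrightarrow> x * y * q = 0" for q x
  proof -
    obtain x' where x': "x' \<in> M" "is_adjoint x' x" using M_adjoint x by blast
    have "x' = 0"
    proof (rule q(2)[OF x'(1)])
      fix y assume "y \<in> M"
      then obtain y' where y': "y' \<in> M" "is_adjoint y' y" using M_adjoint by blast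
      have "is_adjoint (q * (y * x')) (x * y' * q)"
        using x' is_adjoint_sym[OF y'(2)] projectionD(2)[OF q(1)] by (intro is_adjoint_mult)
      then have "q * (y * x') = 0" using 0[OF y'(1)] is_adjoint_01(2) is_adjoint_unique by metis
      then show "q * y * x' = 0" by (simp add: mult.assoc)
    qed
    then show ?thesis using x'(2) is_adjoint_01(2) is_adjoint_sym is_adjoint_unique by metis
  qed
  have lift: "\<exists>z\<in>Z. z * q = c"
    if "q \<in> M" "projection q" "c \<in> M" "q * c = c" "c * q = c" "\<And>y. y \<in> M \<Longrightarrow> \<lbrace>c, q * y * q\<rbrace> = 0" for q c
    using corner_center_lift[OF that(1-5)] that(6) unfolding Z_def center_def lie_bracket_def right_minus_eq by blast
  have pp: "p * p = p" using p(2) projectionD by blast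
  have "peirce M p f"
  proof unfold_locales
    show "p + f = 1" "p * p = p" "p * f = 0" "f * p = 0" "f * f = f"
      using pp by (simp_all add: f_def left_diff_distrib right_diff_distrib)
    show "p \<in> M" "f \<in> M" by fact+
    show "x = 0" if "x \<in> M" "\<And>y. y \<in> M \<Longrightarrow> p * y * x = 0" for x by (rule p(3)[OF that])
    show "x = 0" if "x \<in> M" "\<And>y. y \<in> M \<Longrightarrow> f * y * x = 0" for x
      by (rule fl[folded f_def, OF that])
    show "x = 0" if "x \<in> M" "\<And>y. y \<in> M \<Longrightarrow> x * y * p = 0" for x by (rule right[OF p(2,3) that])
    show "x = 0" if "x \<in> M" "\<And>y. y \<in> M \<Longrightarrow> x * y * f = 0" for x
      using right[OF f(2) p(4)[folded f_def] that] .
    show "\<exists>z\<in>Z. z * p = c"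
      if "c \<in> M" "p * c = c" "c * p = c" "\<And>y. y \<in> M \<Longrightarrow> \<lbrace>c, p * y * p\<rbrace> = 0" for c
      by (rule lift[OF p(1,2) that])
    show "\<exists>z\<in>Z. z * f = c"
      if "c \<in> M" "f * c = c" "c * f = c" "\<And>y. y \<in> M \<Longrightarrow> \<lbrace>c, f * y * f\<rbrace> = 0" for c
      by (rule lift[OF f that])
  qed
  then show ?thesis by blast
qed

end

section \<open>Lie derivations of von Neumann algebras\<close>

theorem corollary3p14:
  fixes A :: "'h::chilbert_space bounded_op set"
    and n :: nat
    and \<phi> :: "'h bounded_op \<Rightarrow> 'h bounded_op"
  assumes "von_neumann_algebra A"
    and "\<not> has_type_I1_central_summand A"
    and "n \<ge> 2"
    and "lie_n_derivation_on n A \<phi>"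
  shows "standard_on n A \<phi>"
proof -
  interpret vn_algebra A using assms(1) by unfold_locales
  obtain p f where "peirce A p f" using peirce_exists[OF assms(2)] by blast
  then interpret peirce A p f .
  obtain k where n: "n = Suc k" and k: "k \<ge> 1" using assms(3) by (cases n) auto
  have \<phi>: "\<phi> \<in> A \<rightarrow> A" "\<forall>x\<in>A. \<forall>y\<in>A. \<phi> (x + y) = \<phi> x + \<phi> y" "\<forall>c. \<forall>x\<in>A. \<phi> (c *\<^sub>C x) = c *\<^sub>C \<phi> x"
    "\<And>x. (\<forall>i\<in>{1..n}. x i \<in> A) \<Longrightarrow> \<phi> (lie_poly n x) = (\<Sum>i=1..n. lie_poly n (x(i := \<phi> (x i))))"
    using assms(4) unfolding lie_n_derivation_on_def clinear_map_on_def by blast+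
  have lie_fold: "lie_fold_derivation k \<phi>"
    unfolding lie_fold_derivation_def
  proof (intro conjI ballI allI impI)
    fix x ys assume x: "x \<in> A" and ys: "set ys \<subseteq> A" "length ys = k"
    define u where "u i = (x # ys) ! (i - 1)" for i
    have u1: "u 1 = x" by (simp add: u_def)
    have map: "map u [2..<Suc (Suc k)] = ys"
      using ys(2) by (intro nth_equalityI) (auto simp: u_def simp del: upt_Suc)
    have "u i \<in> A" if "i \<in> {1..n}" for i
    proof -
      have "(x # ys) ! (i - 1) \<in> set (x # ys)" using that ys(2) n by (intro nth_mem) auto
      then show ?thesis using x ys(1) unfolding u_def by auto
    qed
    then show "\<phi> (foldl lie_bracket x ys) = fold_deriv \<phi> x (\<phi> x) ys"
      using \<phi>(4)[of u] unfolding n sum_lie_poly_fold_deriv unfolding lie_poly_foldl map u1 by blast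
  qed (use \<phi>(1-3) in \<open>auto simp: clinear_map_on_def\<close>)
  obtain h \<tau> where h: "h \<in> A \<rightarrow> A" "\<forall>x\<in>A. \<forall>y\<in>A. h (x + y) = h x + h y" "\<forall>c. \<forall>x\<in>A. h (c *\<^sub>C x) = c *\<^sub>C h x"
    "\<forall>x\<in>A. \<forall>y\<in>A. h (x * y) = h x * y + x * h y"
    and \<tau>: "\<tau> \<in> A \<rightarrow> Z" "\<forall>x\<in>A. \<forall>y\<in>A. \<tau> (x + y) = \<tau> x + \<tau> y" "\<forall>c. \<forall>x\<in>A. \<tau> (c *\<^sub>C x) = c *\<^sub>C \<tau> x"
    and sum: "\<forall>x\<in>A. \<phi> x = h x + \<tau> x"
    using lie_fold_derivation_splits[OF lie_fold k, unfolded splits_def clinear_map_on_def] by (elim exE conjE)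
  have d_lie: "h \<lbrace>x, y\<rbrace> = \<lbrace>h x, y\<rbrace> + \<lbrace>x, h y\<rbrace>" if "x \<in> A" "y \<in> A" for x y
  proof -
    have "h (x * y) = h (\<lbrace>x, y\<rbrace> + y * x)" by (simp add: lie_bracket_def)
    also have "\<dots> = h \<lbrace>x, y\<rbrace> + h (y * x)" using h(2) that by blast
    finally show ?thesis using h(4) that by (simp add: lie_bracket_def algebra_simps)
  qed
  \<comment> \<open>brackets do not see \<open>\<tau>\<close>, so the derivatives along \<open>\<phi>\<close> and along \<open>h\<close> coincide\<close>
  have same: "fold_deriv \<phi> x x' ys = fold_deriv h x x' ys" if "x \<in> A" "set ys \<subseteq> A" for x x' ys
    using that
  proof (induction ys arbitrary: x x')
    case (Cons y ys)
    have "\<lbrace>x, \<tau> y\<rbrace> = 0" using Cons.prems by (intro lie_Z(2) funcset_mem[OF \<tau>(1)]) auto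
    then have "\<lbrace>x, \<phi> y\<rbrace> = \<lbrace>x, h y\<rbrace>" using sum Cons.prems by (simp add: lie_bracket_def algebra_simps)
    then show ?case using Cons by simp
  qed simp
  have \<tau>_lie_poly: "\<tau> (lie_poly n x) = 0" if x: "\<forall>i\<in>{1..n}. x i \<in> A" for x
  proof -
    obtain y ys where ys: "map x [2..<Suc (Suc k)] = y # ys"
      using k by (cases "map x [2..<Suc (Suc k)]") (auto simp del: upt_Suc)
    have sub: "set (y # ys) \<subseteq> A" unfolding ys[symmetric] using x n by auto
    have x1: "x 1 \<in> A" using x n by auto
    have "\<phi> (lie_poly n x) = fold_deriv \<phi> (x 1) (\<phi> (x 1)) (y # ys)"
      using \<phi>(4)[OF x] unfolding n sum_lie_poly_fold_deriv ys .
    also have "\<dots> = fold_deriv h (x 1) (\<phi> (x 1)) (y # ys)" by (rule same[OF x1 sub])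
    also have "\<dots> = fold_deriv h (x 1) (h (x 1)) (y # ys)"
    proof -
      have "\<lbrace>\<tau> (x 1), y\<rbrace> = 0" using x1 sub by (intro lie_Z(1) funcset_mem[OF \<tau>(1)]) auto
      then have "\<lbrace>\<phi> (x 1), y\<rbrace> = \<lbrace>h (x 1), y\<rbrace>" using sum x1 by (simp add: lie_bracket_def algebra_simps)
      then show ?thesis by simp
    qed
    also have "\<dots> = h (lie_poly n x)"
      using fold_deriv_derivation[of h "x 1" "y # ys"] d_lie x1 sub unfolding n lie_poly_foldl ys by metis
    finally have "\<phi> (lie_poly n x) = h (lie_poly n x)" .
    moreover have "lie_poly n x \<in> A"
      unfolding n lie_poly_foldl ys by (rule foldl_closed[OF x1 sub])
    ultimately show ?thesis using sum by simp
  qed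
  have Z_eq: "Z = center A" unfolding Z_def center_def ..
  show ?thesis
    unfolding standard_on_def derivation_on_def clinear_map_on_def
  proof (rule exI[of _ h], rule exI[of _ \<tau>], intro conjI)
    show "\<tau> \<in> A \<rightarrow> center A" using \<tau>(1) unfolding Z_eq .
  qed (use h \<tau> sum \<tau>_lie_poly in blast)+
qed

end
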